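(* Let $(\beta_p)_{p\ge 2}$ be real numbers with $\sum_{p\ge2}2^p\beta_p^2<\infty$, and let $\xi(u)=\sum_{p\ge 2}\beta_p^2u^p$. Let $\mu\in M[0,1]$ and suppose $(\mu_n)_{n\ge1}\subset M[0,1]$ converges to $\mu$. (i) For every $j\ge0$, $\partial_x^j\Phi_\mu$ exists and is continuous on $\mathbb R\times[0,1]$, and $\lim_{n\to\infty}\partial_x^j\Phi_{\mu_n}=\partial_x^j\Phi_\mu$ uniformly on $\mathbb R\times[0,1]$. (ii) Let $P$ be a polynomial on $\mathbb R^j$ for some $j\ge1$. Then $$u\mapsto\mathbb E\,P\big(\partial_x\Phi_\mu(M(u),u),\dots,\partial_x^j\Phi_\mu(M(u),u)\big)\exp W_\mu(u),\quad u\in[0,1],$$ is a continuous function, and uniformly in $u\in[0,1]$, $$\lim_{n\to\infty}\mathbb E\,P\big(\partial_x\Phi_{\mu_n}(M(u),u),\dots,\partial_x^j\Phi_{\mu_n}(M(u),u)\big)\exp W_{\mu_n}(u)=\mathbb E\,P\big(\partial_x\Phi_\mu(M(u),u),\dots,\partial_x^j\Phi_\mu(M(u),u)\big)\exp W_\mu(u).$$ (iii) If $\mu$ is continuous on $[0,1]$ (its distribution function $u\mapsto\mu([0,u])$ is continuous on $[0,1]$), then $\partial_u\partial_x^j\Phi_\mu$ exists and is continuous on $\mathbb R\times[0,1]$ for all $j\ge0$.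
   Context: $M[0,1]$ is the set of Borel probability measures on $[0,1]$ with the metric $d(\mu,\mu')=\int_0^1|\mu([0,u])-\mu'([0,u])|\,du$ (convergence in $d$ is weak convergence); $M_d[0,1]\subset M[0,1]$ is the subset of measures with finitely many atoms (and nothing else). Parisi PDE solution. For $\mu\in M_d[0,1]$ with atoms $0\le q_1<\dots<q_{k+1}\le 1$ ($k\ge0$), put $m_p=\mu([0,q_p])$ for $1\le p\le k+1$, $m_0=0$, $q_0=0$, $q_{k+2}=1$. Define $\Phi_\mu:\mathbb R\times[0,1]\to\mathbb R$ by $\Phi_\mu(x,u)=\log\cosh x+\frac12(\xi'(1)-\xi'(u))$ for $q_{k+1}\le u\le1$ and recursively, for $p=k,k-1,\dots,0$ and $q_p\le u<q_{p+1}$, $$\Phi_\mu(x,u)=\frac1{m_p}\log\mathbb E\exp m_p\Phi_\mu\big(x+z\sqrt{\xi'(q_{p+1})-\xi'(u)},\,q_{p+1}\big),$$ $z$ a standard Gaussian, where for $m_p=0$ the right side means $\mathbb E\,\Phi_\mu(x+z\sqrt{\xi'(q_{p+1})-\xi'(u)},q_{p+1})$. (This solves $\partial_u\Phi_\mu=-\frac{\xi''(u)}2(\partial_x^2\Phi_\mu+\mu([0,u])(\partial_x\Phi_\mu)^2)$ with $\Phi_\mu(x,1)=\log\cosh x$.) The map $\mu\mapsto\Phi_\mu$ is known to be Lipschitz from $(M_d[0,1],d)$ to $C(\mathbb R\times[0,1])$ with the uniform distance, and $\Phi_\mu$ for general $\mu\in M[0,1]$ is defined by continuous extension. Let $B=(B(t))_{t\ge0}$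 be a standard Brownian motion (started at $0$), $M(u)=B(\xi'(u))$ for $u\in[0,1]$, and for $\mu\in M[0,1]$, $u\in[0,1]$, $$W_\mu(u)=\int_{[0,u]}\big(\Phi_\mu(M(u),u)-\Phi_\mu(M(t),t)\big)\,d\mu(t).$$ *)

theory Defs
  imports "HOL-Probability.Probability" "HOL-Library.Poly_Mapping"
begin

definition xi :: "(nat \<Rightarrow> real) \<Rightarrow> real \<Rightarrow> real" where
  "xi \<beta> u = (\<Sum>\<^sub>\<infinity>p\<in>{2..}. (\<beta> p)\<^sup>2 * u ^ p)"

(* The series for xi converges on [-2, 2] in the intended case, so deriv at u = 0 and u = 1 is
   an ordinary two-sided derivative. *)
definition dxi :: "(nat \<Rightarrow> real) \<Rightarrow> real \<Rightarrow> real" where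
  "dxi \<beta> = deriv (xi \<beta>)"

definition M01 :: "real measure set" where
  "M01 = {\<mu>. prob_space \<mu> \<and> sets \<mu> = sets (restrict_space borel {0..1})}"

definition d01 :: "real measure \<Rightarrow> real measure \<Rightarrow> real" where
  "d01 \<mu> \<nu> = (LINT u:{0..1}|lborel. \<bar>measure \<mu> {0..u} - measure \<nu> {0..u}\<bar>)"

definition atoms :: "real measure \<Rightarrow> real set" where
  "atoms \<mu> = {q \<in> {0..1}. measure \<mu> {q} > 0}"

definition Md01 :: "real measure set" where
  "Md01 = {\<mu> \<in> M01. finite (atoms \<mu>) \<and> measure \<mu> (atoms \<mu>) = 1}"

(* (1/m) log E exp (m f(x + z sqrt v)) for a standard Gaussian z, read as E f(x + z sqrt v)
   when m = 0. *)
definition parisi_step :: "real \<Rightarrow> real \<Rightarrow> (real \<Rightarrow> real) \<Rightarrow> real \<Rightarrow> real" where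
  "parisi_step m v f x =
    (if m = 0 then (LINT z|std_normal_distribution. f (x + z * sqrt v))
     else 1 / m * ln (LINT z|std_normal_distribution. exp (m * f (x + z * sqrt v))))"

(* In parisi_rec \<beta> \<mu> m qs x u, the list qs holds the atoms q_{p+1} < ... < q_{k+1} that have not
   been passed yet, and m = m_p. The case q \<le> u moves on to the next atom; otherwise
   q_p \<le> u < q_{p+1} = q, and one Gaussian step is applied to Phi(., q_{p+1}), which is
   evaluated with the remaining atoms q_{p+2}, ..., all larger than q. *)
fun parisi_rec ::
  "(nat \<Rightarrow> real) \<Rightarrow> real measure \<Rightarrow> real \<Rightarrow> real list \<Rightarrow> real \<Rightarrow> real \<Rightarrow> real" where
  "parisi_rec \<beta> \<mu> m [] x u = ln (cosh x) + 1 / 2 * (dxi \<beta> 1 - dxi \<beta> u)"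
| "parisi_rec \<beta> \<mu> m (q # qs) x u =
    (if q \<le> u then parisi_rec \<beta> \<mu> (measure \<mu> {0..q}) qs x u
     else parisi_step m (dxi \<beta> q - dxi \<beta> u)
            (\<lambda>y. parisi_rec \<beta> \<mu> (measure \<mu> {0..q}) qs y q) x)"

definition Phi_d :: "(nat \<Rightarrow> real) \<Rightarrow> real measure \<Rightarrow> real \<Rightarrow> real \<Rightarrow> real" where
  "Phi_d \<beta> \<mu> = parisi_rec \<beta> \<mu> 0 (sorted_list_of_set (atoms \<mu>))"

definition Md01_nhds :: "real measure \<Rightarrow> real measure filter" where
  "Md01_nhds \<mu> = (INF e\<in>{0<..}. principal {\<nu> \<in> Md01. d01 \<nu> \<mu> < e})"

(* The extension from the dense set Md01 to M01. The map Phi_d is Lipschitz from (Md01, d01) to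
   the uniform distance, so the limit exists (uniformly in x and u \<in> [0,1]) and agrees with
   Phi_d on Md01. The filter is not punctured: it contains \<mu> itself when \<mu> \<in> Md01. *)
definition Phi :: "(nat \<Rightarrow> real) \<Rightarrow> real measure \<Rightarrow> real \<Rightarrow> real \<Rightarrow> real" where
  "Phi \<beta> \<mu> x u = Lim (Md01_nhds \<mu>) (\<lambda>\<nu>. Phi_d \<beta> \<nu> x u)"

(* Since deriv is total, existence of this derivative has to be asserted separately. *)
definition dxPhi :: "(nat \<Rightarrow> real) \<Rightarrow> real measure \<Rightarrow> nat \<Rightarrow> real \<Rightarrow> real \<Rightarrow> real" where
  "dxPhi \<beta> \<mu> j x u = (deriv ^^ j) (\<lambda>y. Phi \<beta> \<mu> y u) x"

definition dxPhi_exists :: "(nat \<Rightarrow> real) \<Rightarrow> real measure \<Rightarrow> nat \<Rightarrow> real \<Rightarrow> real \<Rightarrow> bool" where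
  "dxPhi_exists \<beta> \<mu> j x u \<longleftrightarrow>
    (\<forall>i<j. \<forall>y. (deriv ^^ i) (\<lambda>y. Phi \<beta> \<mu> y u) field_differentiable at y)"

(* Continuity is required of every path, not just almost every one: otherwise the pathwise
   integrals in W need not be measurable when the underlying measure is not complete. *)
locale brownian_motion = prob_space \<Omega> for \<Omega> :: "'a measure" +
  fixes B :: "real \<Rightarrow> 'a \<Rightarrow> real"
  assumes measurable_B: "\<And>t. 0 \<le> t \<Longrightarrow> random_variable borel (B t)"
    and start: "\<And>\<omega>. \<omega> \<in> space \<Omega> \<Longrightarrow> B 0 \<omega> = 0"
    and continuous_paths: "\<And>\<omega>. \<omega> \<in> space \<Omega> \<Longrightarrow> continuous_on {0..} (\<lambda>t. B t \<omega>)"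
    and indep_increments: "\<And>t n. \<lbrakk>0 \<le> t 0; incseq t\<rbrakk> \<Longrightarrow>
          indep_vars (\<lambda>_. borel) (\<lambda>i \<omega>. B (t (Suc i)) \<omega> - B (t i) \<omega>) {..<n::nat}"
    and gaussian_increments: "\<And>s t. \<lbrakk>0 \<le> s; s < t\<rbrakk> \<Longrightarrow>
          distributed \<Omega> lborel (\<lambda>\<omega>. B t \<omega> - B s \<omega>) (normal_density 0 (sqrt (t - s)))"

definition MB :: "(nat \<Rightarrow> real) \<Rightarrow> (real \<Rightarrow> 'a \<Rightarrow> real) \<Rightarrow> real \<Rightarrow> 'a \<Rightarrow> real" where
  "MB \<beta> B u \<omega> = B (dxi \<beta> u) \<omega>"

definition W ::
  "(nat \<Rightarrow> real) \<Rightarrow> (real \<Rightarrow> 'a \<Rightarrow> real) \<Rightarrow> real measure \<Rightarrow> real \<Rightarrow> 'a \<Rightarrow> real" where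
  "W \<beta> B \<mu> u \<omega> =
    (LINT t:{0..u}|\<mu>. Phi \<beta> \<mu> (MB \<beta> B u \<omega>) u - Phi \<beta> \<mu> (MB \<beta> B t \<omega>) t)"

(* Polynomials are finitely supported maps from monomials to coefficients, and monomials are
   finitely supported maps from variable indices to exponents. *)
type_synonym mpoly_real = "(nat \<Rightarrow>\<^sub>0 nat) \<Rightarrow>\<^sub>0 real"

definition mpoly_vars :: "mpoly_real \<Rightarrow> nat set" where
  "mpoly_vars P = (\<Union>m\<in>Poly_Mapping.keys P. Poly_Mapping.keys m)"

definition mpoly_eval :: "mpoly_real \<Rightarrow> (nat \<Rightarrow> real) \<Rightarrow> real" where
  "mpoly_eval P y = (\<Sum>m\<in>Poly_Mapping.keys P. Poly_Mapping.lookup P m *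
     (\<Prod>i\<in>Poly_Mapping.keys m. y i ^ Poly_Mapping.lookup m i))"

definition PexpW :: "(nat \<Rightarrow> real) \<Rightarrow> (real \<Rightarrow> 'a \<Rightarrow> real) \<Rightarrow> mpoly_real \<Rightarrow>
    real measure \<Rightarrow> real \<Rightarrow> 'a \<Rightarrow> real" where
  "PexpW \<beta> B P \<mu> u \<omega> =
    mpoly_eval P (\<lambda>i. dxPhi \<beta> \<mu> i (MB \<beta> B u \<omega>) u) * exp (W \<beta> B \<mu> u \<omega>)"

end

theory Submission
  imports Defs
begin

text \<open>A Parisi step takes \<open>exp (m * f)\<close> to its Gaussian average, so the quotients of the higher
  derivatives of \<open>exp (m * f)\<close> by \<open>exp (m * f)\<close> are averaged against a tilted Gaussian law. Their
  bounds survive a step, and when \<open>m\<close> changes they change by at most a multiple of the mass of the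
  atom; this bounds all positive-order \<open>x\<close>-derivatives of \<open>\<Phi>\<^sub>\<mu>\<close> uniformly in \<open>\<mu>\<close>. With such
  bounds, interpolation between derivatives turns the Lipschitz dependence of \<open>\<Phi>\<^sub>\<mu>\<close> on \<open>\<mu>\<close> into
  uniform convergence of every derivative, which is (i). For (ii), \<open>W\<close> converges along every
  continuous path, and Jensen's inequality together with the Lipschitz bounds on \<open>\<Phi>\<^sub>\<mu>\<close> bounds the
  second moment of \<open>exp W\<close>, so the expectations converge as well. For (iii), the distribution function
  is almost constant on a short interval, hence \<open>\<Phi>\<^sub>\<mu>\<close> is close to a single step there, and
  expanding that step for small variance gives the Parisi equation, which is then differentiated
  in \<open>x\<close>.\<close>

subsection \<open>Smooth functions of one variable\<close>

text \<open>The obstacle is uniformity: there may be arbitrarily many atoms, \<open>m\<close> may be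
  arbitrarily close to 0 although a step divides by \<open>m\<close>, and \<Phi> itself is
  unbounded. The losses at the atoms telescope, because the masses add up to at most 1 and the
  factor at each order depends only on the bounds of lower order. Division by \<open>m\<close> is
  harmless because every error term keeps a factor \<open>m\<close> until the end. Unboundedness is
  why only positive orders are bounded and why order 0 enters through differences alone.

  The induction runs backwards from time 1, where the distribution function is 1 and the terminal
  value is \<open>ln (cosh x)\<close>: for \<open>m = 1\<close> the quotients are those of the
  derivatives of \<open>cosh\<close> by \<open>cosh\<close>, bounded by 1. Gaussian averaging
  multiplies \<open>cosh\<close> by \<open>exp (v / 2)\<close>, so the closed formula beyond the
  last atom is itself a step of mass 1, and one rule covers every interval free of atoms.

  Uniformity in time in (ii) comes from joint sequential continuity in measure and time together
  with compactness of [0,1].\<close>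

definition smooth :: "(real \<Rightarrow> real) \<Rightarrow> bool" where
  "smooth f \<longleftrightarrow> (\<forall>n x. ((deriv ^^ n) f has_real_derivative (deriv ^^ Suc n) f x) (at x))"

lemma higher_deriv_eqI:
  fixes F :: "nat \<Rightarrow> real \<Rightarrow> real"
  assumes "F 0 = f" and "\<And>n x. (F n has_real_derivative F (Suc n) x) (at x)"
  shows "(deriv ^^ n) f = F n"
proof (induction n)
  case (Suc n)
  have "deriv (F n) = F (Suc n)"
    using assms(2) by (intro ext DERIV_imp_deriv) auto
  with Suc show ?case by simp
qed (simp add: assms)

lemma smoothI:
  fixes F :: "nat \<Rightarrow> real \<Rightarrow> real"
  assumes "F 0 = f" and "\<And>n x. (F n has_real_derivative F (Suc n) x) (at x)"
  shows "smooth f"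
  unfolding smooth_def using higher_deriv_eqI[of F f, OF assms] assms(2) by metis

lemma smoothD: "smooth f \<Longrightarrow> ((deriv ^^ n) f has_real_derivative (deriv ^^ Suc n) f x) (at x)"
  by (simp add: smooth_def)

lemma smoothD0: "smooth f \<Longrightarrow> (f has_real_derivative deriv f x) (at x)"
  using smoothD[of f 0 x] by simp

lemma smooth_continuous_higher: "smooth f \<Longrightarrow> continuous_on S ((deriv ^^ n) f)"
  using smoothD DERIV_continuous_on[of S "(deriv ^^ n) f"] has_field_derivative_at_within by blast

lemma higher_deriv_deriv: "(deriv ^^ n) (deriv f) = (deriv ^^ Suc n) f" for f :: "real \<Rightarrow> real"
  by (simp add: funpow_swap1)

lemma smooth_higher_deriv: "smooth f \<Longrightarrow> smooth ((deriv ^^ k) f)"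
  by (rule smoothI[of "\<lambda>n. (deriv ^^ (n + k)) f"]) (auto dest: smoothD)

lemma smooth_deriv: "smooth f \<Longrightarrow> smooth (deriv f)"
  using smooth_higher_deriv[of f 1] by simp

text \<open>Quotients and products with an exponential are closed under differentiation but have no
  convenient formula for the derivative of order \<open>n\<close>. A closed class is enough:
  choosing a derivative inside it and iterating the choice yields all orders.\<close>

lemma smooth_coinduct:
  assumes "P f" and step: "\<And>g. P g \<Longrightarrow> \<exists>g'. P g' \<and> (\<forall>x. (g has_real_derivative g' x) (at x))"
  shows "smooth f"
proof -
  obtain D where D: "\<And>g. P g \<Longrightarrow> P (D g) \<and> (\<forall>x. (g has_real_derivative D g x) (at x))"
    using step by metis
  have "P ((D ^^ n) f)" for n
    by (induction n) (use assms D in auto)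
  then show ?thesis
    by (intro smoothI[of "\<lambda>n. (D ^^ n) f"]) (use D in auto)
qed

lemma smooth_if_deriv:
  assumes "\<And>x. (f has_real_derivative f' x) (at x)" and "smooth f'"
  shows "smooth f"
  by (rule smooth_coinduct[where P = "\<lambda>g. g = f \<or> smooth g"])
    (use assms smoothD0 smooth_deriv in blast)+

lemma smooth_const: "smooth (\<lambda>x. c)"
  by (rule smoothI[of "\<lambda>n x. if n = 0 then c else 0"]) auto

lemma
  assumes "smooth f" "smooth g"
  shows smooth_lincomb: "smooth (\<lambda>x. a * f x + b * g x)"
    and higher_deriv_lincomb:
      "(deriv ^^ n) (\<lambda>x. a * f x + b * g x) x = a * (deriv ^^ n) f x + b * (deriv ^^ n) g x"
proof -
  define F where "F n x = a * (deriv ^^ n) f x + b * (deriv ^^ n) g x" for n x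
  have D: "(F n has_real_derivative F (Suc n) x) (at x)" for n x
    unfolding F_def by (intro DERIV_add DERIV_cmult smoothD assms)
  show "smooth (\<lambda>x. a * f x + b * g x)"
    by (rule smoothI[of F, OF _ D]) (simp add: F_def fun_eq_iff)
  show "(deriv ^^ n) (\<lambda>x. a * f x + b * g x) x = a * (deriv ^^ n) f x + b * (deriv ^^ n) g x"
    by (subst higher_deriv_eqI[of F, OF _ D]) (auto simp: F_def)
qed

lemma smooth_diff: "smooth f \<Longrightarrow> smooth g \<Longrightarrow> smooth (\<lambda>x. f x - g x)"
  using smooth_lincomb[of f g 1 "-1"] by simp

lemma smooth_add: "smooth f \<Longrightarrow> smooth g \<Longrightarrow> smooth (\<lambda>x. f x + g x)"
  using smooth_lincomb[of f g 1 "1"] by simp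

lemma smooth_cmult: "smooth f \<Longrightarrow> smooth (\<lambda>x. c * f x)"
  using smooth_lincomb[of f f c 0] by simp

lemma higher_deriv_cmult: "smooth f \<Longrightarrow> (deriv ^^ n) (\<lambda>x. c * f x) x = c * (deriv ^^ n) f x"
  using higher_deriv_lincomb[of f f n c 0] by simp

lemma
  assumes "smooth f" "smooth g"
  shows smooth_mult: "smooth (\<lambda>x. f x * g x)"
    and higher_deriv_mult_real: "(deriv ^^ n) (\<lambda>x. f x * g x) x =
      (\<Sum>i\<le>n. real (n choose i) * (deriv ^^ i) f x * (deriv ^^ (n - i)) g x)"
proof -
  define F where "F n x = (\<Sum>i\<le>n. real (n choose i) * (deriv ^^ i) f x * (deriv ^^ (n - i)) g x)" for n x
  have D: "(F n has_real_derivative F (Suc n) x) (at x)" for n x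
  proof -
    let ?a = "\<lambda>i j. (deriv ^^ i) f x * (deriv ^^ j) g x"
    have "(F n has_real_derivative (\<Sum>i\<le>n. real (n choose i) *
        (?a (Suc i) (n - i) + ?a i (Suc (n - i))))) (at x)"
      unfolding F_def
    proof (rule DERIV_sum)
      fix i
      have "((\<lambda>x. real (n choose i) * ((deriv ^^ i) f x * (deriv ^^ (n - i)) g x)) has_real_derivative
        real (n choose i) * ((deriv ^^ Suc i) f x * (deriv ^^ (n - i)) g x + (deriv ^^ Suc (n - i)) g x * (deriv ^^ i) f x)) (at x)"
        by (intro DERIV_cmult DERIV_mult smoothD assms)
      then show "((\<lambda>x. real (n choose i) * (deriv ^^ i) f x * (deriv ^^ (n - i)) g x) has_real_derivative
          real (n choose i) * (?a (Suc i) (n - i) + ?a i (Suc (n - i)))) (at x)"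
        by (simp add: mult_ac)
    qed
    also have "(\<Sum>i\<le>n. real (n choose i) * (?a (Suc i) (n - i) + ?a i (Suc (n - i)))) =
      (\<Sum>i\<le>n. real (n choose i) * ?a (Suc i) (n - i)) + (\<Sum>i\<le>n. real (n choose i) * ?a i (Suc n - i))"
      unfolding sum.distrib[symmetric] by (intro sum.cong) (auto simp: Suc_diff_le distrib_left)
    \<comment> \<open>The added term has coefficient \<open>n choose Suc n\<close>, which is 0.
      After the shift of the index the two sums combine by Pascal's rule.\<close>
    also have "(\<Sum>i\<le>n. real (n choose i) * ?a i (Suc n - i)) =
        (\<Sum>i\<le>Suc n. real (n choose i) * ?a i (Suc n - i))"
      by simp
    also have "\<dots> = ?a 0 (Suc n) + (\<Sum>i\<le>n. real (n choose Suc i) * ?a (Suc i) (n - i))"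
      by (subst sum.atMost_Suc_shift) simp
    also have "(\<Sum>i\<le>n. real (n choose i) * ?a (Suc i) (n - i)) + \<dots> = F (Suc n) x"
      unfolding F_def
      by (subst sum.atMost_Suc_shift) (simp add: sum.distrib algebra_simps)
    finally show ?thesis .
  qed
  show "smooth (\<lambda>x. f x * g x)"
    by (rule smoothI[of F, OF _ D]) (simp add: F_def fun_eq_iff)
  show "(deriv ^^ n) (\<lambda>x. f x * g x) x =
      (\<Sum>i\<le>n. real (n choose i) * (deriv ^^ i) f x * (deriv ^^ (n - i)) g x)"
    by (subst higher_deriv_eqI[of F, OF _ D]) (auto simp: F_def)
qed

lemma smooth_divide:
  assumes "smooth f" "smooth g" "\<And>x. g x \<noteq> 0"
  shows "smooth (\<lambda>x. f x / g x)"
proof (rule smooth_coinduct[where P = "\<lambda>h. \<exists>a b. smooth a \<and> smooth b \<and> (\<forall>x. b x \<noteq> 0) \<and> h = (\<lambda>x. a x / b x)"])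
  fix h assume "\<exists>a b. smooth a \<and> smooth b \<and> (\<forall>x. b x \<noteq> 0) \<and> h = (\<lambda>x. a x / b x)"
  then obtain a b where ab: "smooth a" "smooth b" "\<forall>x. b x \<noteq> 0" "h = (\<lambda>x. a x / b x)" by blast
  let ?h' = "\<lambda>x. (deriv a x * b x - a x * deriv b x) / (b x * b x)"
  have "smooth (\<lambda>x. deriv a x * b x - a x * deriv b x)" "smooth (\<lambda>x. b x * b x)"
    using ab by (auto intro!: smooth_diff smooth_mult smooth_deriv)
  moreover have "(h has_real_derivative ?h' x) (at x)" for x
    unfolding ab(4) by (rule DERIV_divide) (use ab smoothD0 in auto)
  ultimately show "\<exists>h'. (\<exists>a b. smooth a \<and> smooth b \<and> (\<forall>x. b x \<noteq> 0) \<and> h' = (\<lambda>x. a x / b x)) \<and>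
      (\<forall>x. (h has_real_derivative h' x) (at x))"
    using ab(3) by (intro exI[of _ ?h'] conjI exI[of _ "\<lambda>x. deriv a x * b x - a x * deriv b x"]
        exI[of _ "\<lambda>x. b x * b x"]) auto
qed (use assms in blast)

lemma smooth_ln:
  assumes "smooth g" "\<And>x. g x > 0"
  shows "smooth (\<lambda>x. ln (g x))"
proof (rule smooth_if_deriv)
  fix x
  show "((\<lambda>x. ln (g x)) has_real_derivative deriv g x / g x) (at x)"
    using smoothD0[OF assms(1), of x] assms(2)[of x]
    by (auto intro!: derivative_eq_intros)
next
  show "smooth (\<lambda>x. deriv g x / g x)"
    using assms by (intro smooth_divide smooth_deriv) (auto simp: less_le)
qed

lemma smooth_exp:
  assumes "smooth g"
  shows "smooth (\<lambda>x. exp (g x))"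
proof (rule smooth_coinduct[where P = "\<lambda>h. \<exists>a. smooth a \<and> h = (\<lambda>x. a x * exp (g x))"])
  show "\<exists>a. smooth a \<and> (\<lambda>x. exp (g x)) = (\<lambda>x. a x * exp (g x))"
    by (rule exI[of _ "\<lambda>x. 1"]) (simp add: smooth_const)
next
  fix h assume "\<exists>a. smooth a \<and> h = (\<lambda>x. a x * exp (g x))"
  then obtain a where a: "smooth a" "h = (\<lambda>x. a x * exp (g x))" by blast
  let ?b = "\<lambda>x. deriv a x + a x * deriv g x"
  have "smooth ?b"
    using a assms by (auto intro!: smooth_add smooth_mult smooth_deriv)
  moreover have "(h has_real_derivative ?b x * exp (g x)) (at x)" for x
    unfolding a(2) using smoothD0[OF a(1), of x] smoothD0[OF assms, of x]
    by (auto intro!: derivative_eq_intros simp: algebra_simps)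
  ultimately show "\<exists>g'. (\<exists>a. smooth a \<and> g' = (\<lambda>x. a x * exp (g x))) \<and>
      (\<forall>x. (h has_real_derivative g' x) (at x))"
    by (intro exI[of _ "\<lambda>x. ?b x * exp (g x)"]) auto
qed

section \<open>Interpolation between derivatives and uniform limits of smooth functions\<close>

lemma interpolation_inequality:
  fixes f f' f'' :: "real \<Rightarrow> real"
  assumes "\<And>x. (f has_real_derivative f' x) (at x)"
    and "\<And>x. (f' has_real_derivative f'' x) (at x)"
    and "\<And>x. \<bar>f x\<bar> \<le> e" and "\<And>x. \<bar>f'' x\<bar> \<le> K" and "h > 0"
  shows "\<bar>f' x\<bar> \<le> 2 * e / h + h * K"
proof -
  \<comment> \<open>Somewhere in the interval the slope equals a difference quotient, hence is at
    most \<open>2 * e / h\<close>; from there back to \<open>x\<close> it changes by at most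
    \<open>h * K\<close>. The free length \<open>h\<close> balances the two terms.\<close>
  obtain c where c: "x < c" "c < x + h" "f (x + h) - f x = h * f' c"
    using MVT2[of x "x + h" f f'] assms by auto
  obtain d where d: "x < d" "d < c" "f' c - f' x = (c - x) * f'' d"
    using MVT2[of x c f' f''] assms c(1) by auto
  have "\<bar>f' c - f' x\<bar> \<le> h * K"
    unfolding d(3) abs_mult using c d assms(4)[of d] by (intro mult_mono) auto
  moreover have "\<bar>h * f' c\<bar> \<le> 2 * e"
    using assms(3)[of x] assms(3)[of "x + h"] c(3) by linarith
  then have "\<bar>f' c\<bar> \<le> 2 * e / h"
    using \<open>h > 0\<close> by (simp add: abs_mult field_simps)
  ultimately show ?thesis by linarith
qed

text \<open>Order 0 is left out because \<Phi> grows linearly in \<open>x\<close>;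
  \<open>K n\<close> therefore belongs to order \<open>Suc n\<close>.\<close>

definition smooth_bounded :: "(nat \<Rightarrow> real) \<Rightarrow> (real \<Rightarrow> real) \<Rightarrow> bool" where
  "smooth_bounded K f \<longleftrightarrow> smooth f \<and> (\<forall>n x. \<bar>(deriv ^^ Suc n) f x\<bar> \<le> K n)"

lemma smooth_bounded_smooth: "smooth_bounded K f \<Longrightarrow> smooth f"
  by (simp add: smooth_bounded_def)

lemma smooth_bounded_le: "smooth_bounded K f \<Longrightarrow> \<bar>(deriv ^^ Suc n) f x\<bar> \<le> K n"
  by (simp add: smooth_bounded_def)

lemma smooth_bounded_nonneg: "smooth_bounded K f \<Longrightarrow> 0 \<le> K n"
  using smooth_bounded_le[of K f n 0] by linarith

text \<open>Each order costs one interpolation, with the bound two orders above the one already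
  controlled. The tolerance \<delta> depends only on \<open>K\<close>, the order and \<epsilon>,
  which later makes it uniform in measure and time.\<close>

lemma smooth_bounded_higher_deriv_close:
  assumes "\<epsilon> > 0"
  shows "\<exists>\<delta>>0. \<forall>f g. smooth_bounded K f \<longrightarrow> smooth_bounded K g \<longrightarrow> (\<forall>x. \<bar>f x - g x\<bar> \<le> \<delta>) \<longrightarrow>
    (\<forall>x. \<bar>(deriv ^^ j) f x - (deriv ^^ j) g x\<bar> \<le> \<epsilon>)"
  using assms
proof (induction j arbitrary: \<epsilon>)
  case 0
  then show ?case by auto
next
  case (Suc j)
  \<comment> \<open>Chosen so that the second-derivative term takes at most half of \<epsilon>; the
    tolerance \<open>\<epsilon> * h / 4\<close> at order \<open>j\<close> then makes the other term
    the other half.\<close>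
  define h where "h = \<epsilon> / (4 * (\<bar>K (Suc j)\<bar> + 1))"
  have h: "h > 0" "h * (2 * \<bar>K (Suc j)\<bar>) \<le> \<epsilon> / 2"
    using Suc.prems by (auto simp: h_def field_simps)
  have "\<epsilon> * h / 4 > 0"
    using Suc.prems h by auto
  from Suc.IH[OF this] obtain \<delta> where \<delta>: "\<delta> > 0"
    "\<And>f g x. smooth_bounded K f \<Longrightarrow> smooth_bounded K g \<Longrightarrow> (\<forall>x. \<bar>f x - g x\<bar> \<le> \<delta>) \<Longrightarrow>
      \<bar>(deriv ^^ j) f x - (deriv ^^ j) g x\<bar> \<le> \<epsilon> * h / 4" by blast
  have "\<bar>(deriv ^^ Suc j) f x - (deriv ^^ Suc j) g x\<bar> \<le> \<epsilon>"
    if fg: "smooth_bounded K f" "smooth_bounded K g" "\<forall>x. \<bar>f x - g x\<bar> \<le> \<delta>" for f g x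
  proof -
    have D: "((\<lambda>x. (deriv ^^ n) f x - (deriv ^^ n) g x) has_real_derivative
          (deriv ^^ Suc n) f x - (deriv ^^ Suc n) g x) (at x)" for n x
        using fg by (intro DERIV_diff smoothD smooth_bounded_smooth)
    have "\<bar>(deriv ^^ Suc j) f x - (deriv ^^ Suc j) g x\<bar> \<le> 2 * (\<epsilon> * h / 4) / h + h * (2 * \<bar>K (Suc j)\<bar>)"
    proof (rule interpolation_inequality[OF D D _ _ h(1)])
      show "\<bar>(deriv ^^ j) f x - (deriv ^^ j) g x\<bar> \<le> \<epsilon> * h / 4" for x
        by (rule \<delta>(2)) (use fg in auto)
      show "\<bar>(deriv ^^ Suc (Suc j)) f x - (deriv ^^ Suc (Suc j)) g x\<bar> \<le> 2 * \<bar>K (Suc j)\<bar>" for x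
        using smooth_bounded_le[OF fg(1), of "Suc j" x] smooth_bounded_le[OF fg(2), of "Suc j" x]
        by linarith
    qed
    also have "\<dots> \<le> \<epsilon>"
      using h by simp
    finally show "\<bar>(deriv ^^ Suc j) f x - (deriv ^^ Suc j) g x\<bar> \<le> \<epsilon>" .
  qed
  with \<delta>(1) show ?case by blast
qed

text \<open>Sup-norm convergence of the functions alone makes the derivatives of every order
  uniformly Cauchy, by the preceding lemma. Termwise differentiation identifies their limits, and
  the bounds survive pointwise.\<close>

lemma smooth_bounded_limit:
  fixes f :: "nat \<Rightarrow> real \<Rightarrow> real"
  assumes f: "\<And>n. smooth_bounded K (f n)"
    and lim: "\<And>e. e > 0 \<Longrightarrow> \<exists>N. \<forall>n\<ge>N. \<forall>x. \<bar>f n x - g x\<bar> \<le> e"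
  shows "smooth_bounded K g"
proof -
  note sm = smooth_bounded_smooth[OF f]
  have C: "\<exists>N. \<forall>m\<ge>N. \<forall>n\<ge>N. \<forall>x. \<bar>(deriv ^^ j) (f m) x - (deriv ^^ j) (f n) x\<bar> \<le> e" if "e > 0" for e j
  proof -
    from smooth_bounded_higher_deriv_close[OF that, of K j] obtain \<delta> where \<delta>: "\<delta> > 0"
      "\<And>f g x. smooth_bounded K f \<Longrightarrow> smooth_bounded K g \<Longrightarrow> (\<forall>x. \<bar>f x - g x\<bar> \<le> \<delta>) \<Longrightarrow>
      \<bar>(deriv ^^ j) f x - (deriv ^^ j) g x\<bar> \<le> e" by blast
    obtain N where N: "\<forall>n\<ge>N. \<forall>x. \<bar>f n x - g x\<bar> \<le> \<delta> / 2"
      using lim[of "\<delta> / 2"] \<delta> by auto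
    have "\<bar>f m x - f n x\<bar> \<le> \<delta>" if "m \<ge> N" "n \<ge> N" for m n x
    proof -
      have "\<bar>f m x - g x\<bar> \<le> \<delta> / 2" "\<bar>f n x - g x\<bar> \<le> \<delta> / 2" using that N by auto
      then show ?thesis by linarith
    qed
    with \<delta>(2) f show ?thesis by blast
  qed
  define G where "G j x = lim (\<lambda>n. (deriv ^^ j) (f n) x)" for j x
  have G: "(\<lambda>n. (deriv ^^ j) (f n) x) \<longlonglongrightarrow> G j x" for j x
  proof -
    have "Cauchy (\<lambda>n. (deriv ^^ j) (f n) x)"
      unfolding Cauchy_def
    proof (intro allI impI)
      fix e :: real assume "e > 0"
      then obtain N where N: "\<forall>m\<ge>N. \<forall>n\<ge>N. \<forall>x. \<bar>(deriv ^^ j) (f m) x - (deriv ^^ j) (f n) x\<bar> \<le> e / 2"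
        using C[of "e / 2" j] by auto
      have "dist ((deriv ^^ j) (f m) x) ((deriv ^^ j) (f n) x) < e" if "m \<ge> N" "n \<ge> N" for m n
      proof -
        have "\<bar>(deriv ^^ j) (f m) x - (deriv ^^ j) (f n) x\<bar> \<le> e / 2" using N that by blast
        then show ?thesis using \<open>e > 0\<close> by (simp add: dist_real_def)
      qed
      then show "\<exists>M. \<forall>m\<ge>M. \<forall>n\<ge>M. dist ((deriv ^^ j) (f m) x) ((deriv ^^ j) (f n) x) < e" by blast
    qed
    then show ?thesis
      unfolding G_def using Cauchy_convergent_iff convergent_LIMSEQ_iff by blast
  qed
  have G0: "G 0 = g"
  proof
    fix x
    have "(\<lambda>n. f n x) \<longlonglongrightarrow> g x"
    proof (rule LIMSEQ_I)
      fix r :: real assume "r > 0"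
      then obtain N where "\<forall>n\<ge>N. \<forall>x. \<bar>f n x - g x\<bar> \<le> r / 2" using lim[of "r / 2"] by auto
      then show "\<exists>no. \<forall>n\<ge>no. norm (f n x - g x) < r"
        using \<open>r > 0\<close> by (intro exI[of _ N]) (smt (verit) field_sum_of_halves real_norm_def)
    qed
    with G[of 0 x] show "G 0 x = g x" using LIMSEQ_unique by auto
  qed
  have D: "(G j has_real_derivative G (Suc j) x) (at x)" for j x
  proof -
    have "\<exists>h. \<forall>x\<in>UNIV. (\<lambda>n. (deriv ^^ j) (f n) x) \<longlonglongrightarrow> h x \<and> (h has_derivative (*) (G (Suc j) x)) (at x within UNIV)"
    proof (rule has_derivative_sequence[where f' = "\<lambda>n x. (*) ((deriv ^^ Suc j) (f n) x)" and ?x0.0 = 0, OF _ _ _ _ G])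
      show "((deriv ^^ j) (f n) has_derivative (*) ((deriv ^^ Suc j) (f n) x)) (at x within UNIV)" for n x
        using smoothD[OF sm, of j n x] by (simp only: has_field_derivative_def)
      fix e :: real assume "e > 0"
      then obtain N where N: "\<forall>m\<ge>N. \<forall>n\<ge>N. \<forall>x. \<bar>(deriv ^^ Suc j) (f m) x - (deriv ^^ Suc j) (f n) x\<bar> \<le> e"
        using C[of e "Suc j"] by auto
      have "\<bar>(deriv ^^ Suc j) (f n) x - G (Suc j) x\<bar> \<le> e" if "n \<ge> N" for n x
      proof (rule tendsto_upperbound)
        show "(\<lambda>m. \<bar>(deriv ^^ Suc j) (f n) x - (deriv ^^ Suc j) (f m) x\<bar>) \<longlonglongrightarrow> \<bar>(deriv ^^ Suc j) (f n) x - G (Suc j) x\<bar>"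
          by (intro tendsto_intros G)
        show "\<forall>\<^sub>F m in sequentially. \<bar>(deriv ^^ Suc j) (f n) x - (deriv ^^ Suc j) (f m) x\<bar> \<le> e"
          using N that by (auto simp: eventually_sequentially)
      qed auto
      then show "\<forall>\<^sub>F n in sequentially. \<forall>x\<in>UNIV. \<forall>h. norm ((deriv ^^ Suc j) (f n) x * h - G (Suc j) x * h) \<le> e * norm h"
        unfolding eventually_sequentially left_diff_distrib[symmetric] norm_mult
        by (intro exI[of _ N]) (auto intro!: mult_right_mono)
    qed auto
    then obtain h where h: "\<And>x. (\<lambda>n. (deriv ^^ j) (f n) x) \<longlonglongrightarrow> h x" "\<And>x. (h has_derivative (*) (G (Suc j) x)) (at x)"
      by auto
    have "h = G j" using h(1) G LIMSEQ_unique by blast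
    then show ?thesis using h(2) by (simp add: has_field_derivative_def)
  qed
  have "\<bar>G (Suc n) x\<bar> \<le> K n" for n x
    by (rule tendsto_upperbound[OF tendsto_rabs[OF G]]) (use smooth_bounded_le[OF f] in auto)
  then show ?thesis
    unfolding smooth_bounded_def higher_deriv_eqI[OF G0 D] using smoothI[OF G0 D] by blast
qed

text \<open>\<open>m * exp_bell m (\<lambda>i. (deriv ^^ Suc i) f x) n\<close> is the \<open>Suc n\<close>-th derivative of
  \<open>exp (m * f)\<close> at \<open>x\<close>, divided by \<open>exp (m * f x)\<close>. The factor \<open>m\<close> is split off so that the case
  \<open>m = 0\<close> gives the derivatives of \<open>f\<close> themselves.\<close>

fun exp_bell :: "real \<Rightarrow> (nat \<Rightarrow> real) \<Rightarrow> nat \<Rightarrow> real" where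
  "exp_bell m y n = y n + m * (\<Sum>i<n. real (n choose Suc i) * y (n - Suc i) * exp_bell m y i)"

declare exp_bell.simps[simp del]

text \<open>Lipschitz constant of \<open>exp_bell m y n\<close> in \<open>m\<close> when
  \<open>K\<close> bounds \<open>y\<close>: the first sum comes from the explicit factor
  \<open>m\<close>, the second from the \<open>m\<close> inside the recursive calls. Since the
  summand \<open>y n\<close> does not involve \<open>m\<close>, only the values of \<open>K\<close>
  below \<open>n\<close> occur, which is what permits induction on the order.\<close>

fun exp_bell_lip :: "(nat \<Rightarrow> real) \<Rightarrow> nat \<Rightarrow> real" where
  "exp_bell_lip K n = (\<Sum>i<n. real (n choose Suc i) * K (n - Suc i) * exp_bell 1 K i) +
    (\<Sum>i<n. real (n choose Suc i) * K (n - Suc i) * exp_bell_lip K i)"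

declare exp_bell_lip.simps[simp del]

lemma exp_bell_0_left: "exp_bell 0 y n = y n"
  by (subst exp_bell.simps) simp

lemma exp_bell_nonneg:
  assumes "\<And>i. i \<le> n \<Longrightarrow> 0 \<le> K i"
  shows "0 \<le> exp_bell 1 K n"
  using assms
proof (induction n rule: less_induct)
  case (less n)
  have "0 \<le> (\<Sum>i<n. real (n choose Suc i) * K (n - Suc i) * exp_bell 1 K i)"
    using less by (intro sum_nonneg mult_nonneg_nonneg) auto
  then show ?case
    using less.prems[of n] by (subst exp_bell.simps) simp
qed

lemma exp_bell_lip_nonneg:
  assumes "\<And>i. i < n \<Longrightarrow> 0 \<le> K i"
  shows "0 \<le> exp_bell_lip K n"
  using assms
proof (induction n rule: less_induct)
  case (less n)
  have "0 \<le> (\<Sum>i<n. real (n choose Suc i) * K (n - Suc i) * exp_bell 1 K i)"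
    using less by (intro sum_nonneg mult_nonneg_nonneg exp_bell_nonneg) auto
  moreover have "0 \<le> (\<Sum>i<n. real (n choose Suc i) * K (n - Suc i) * exp_bell_lip K i)"
    using less by (intro sum_nonneg mult_nonneg_nonneg) auto
  ultimately show ?case
    by (subst exp_bell_lip.simps) simp
qed

lemma exp_bell_abs_le:
  assumes "0 \<le> m" "m \<le> 1" and "\<And>i. i \<le> n \<Longrightarrow> \<bar>y i\<bar> \<le> K i"
  shows "\<bar>exp_bell m y n\<bar> \<le> exp_bell 1 K n"
  using assms(3)
proof (induction n rule: less_induct)
  case (less n)
  have K: "0 \<le> K i" if "i \<le> n" for i
    using less.prems[OF that] by linarith
  have "\<bar>\<Sum>i<n. real (n choose Suc i) * y (n - Suc i) * exp_bell m y i\<bar> \<le>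
      (\<Sum>i<n. real (n choose Suc i) * K (n - Suc i) * exp_bell 1 K i)"
    by (rule order.trans[OF sum_abs], rule sum_mono)
      (auto simp: abs_mult intro!: mult_mono less K)
  then have "\<bar>m * (\<Sum>i<n. real (n choose Suc i) * y (n - Suc i) * exp_bell m y i)\<bar> \<le>
      1 * (\<Sum>i<n. real (n choose Suc i) * K (n - Suc i) * exp_bell 1 K i)"
    unfolding abs_mult using assms by (intro mult_mono) auto
  with less.prems[of n] show ?case
    by (subst (1 2) exp_bell.simps) simp
qed

lemma exp_bell_lipschitz:
  assumes "0 \<le> m" "m \<le> 1" "0 \<le> m'" "m' \<le> 1" and "\<And>i. i < n \<Longrightarrow> \<bar>y i\<bar> \<le> K i"
  shows "\<bar>exp_bell m y n - exp_bell m' y n\<bar> \<le> \<bar>m - m'\<bar> * exp_bell_lip K n"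
  using assms(5)
proof (induction n rule: less_induct)
  case (less n)
  have K: "0 \<le> K i" if "i < n" for i
    using less.prems[OF that] by linarith
  let ?c = "\<lambda>i. real (n choose Suc i) * y (n - Suc i)"
  let ?C = "\<lambda>i. real (n choose Suc i) * K (n - Suc i)"
  have c: "\<bar>?c i\<bar> \<le> ?C i" if "i < n" for i
    using less.prems[of "n - Suc i"] that by (auto simp: abs_mult intro!: mult_left_mono)
  have C: "0 \<le> ?C i" if "i < n" for i
    using c[OF that] by linarith
  have B: "\<bar>exp_bell m y i\<bar> \<le> exp_bell 1 K i" if "i < n" for i
    using that by (intro exp_bell_abs_le assms less.prems) auto
  have IH: "\<bar>exp_bell m y i - exp_bell m' y i\<bar> \<le> \<bar>m - m'\<bar> * exp_bell_lip K i" if "i < n" for i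
    using that by (intro less.IH less.prems) auto
  have 1: "\<bar>\<Sum>i<n. ?c i * exp_bell m y i\<bar> \<le> (\<Sum>i<n. ?C i * exp_bell 1 K i)"
  proof (rule order.trans[OF sum_abs], rule sum_mono, subst abs_mult)
    fix i assume "i \<in> {..<n}"
    then show "\<bar>?c i\<bar> * \<bar>exp_bell m y i\<bar> \<le> ?C i * exp_bell 1 K i"
      by (intro mult_mono c C B) auto
  qed
  have 2: "\<bar>\<Sum>i<n. ?c i * (exp_bell m y i - exp_bell m' y i)\<bar> \<le> (\<Sum>i<n. ?C i * (\<bar>m - m'\<bar> * exp_bell_lip K i))"
  proof (rule order.trans[OF sum_abs], rule sum_mono, subst abs_mult)
    fix i assume "i \<in> {..<n}"
    then show "\<bar>?c i\<bar> * \<bar>exp_bell m y i - exp_bell m' y i\<bar> \<le> ?C i * (\<bar>m - m'\<bar> * exp_bell_lip K i)"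
      by (intro mult_mono c C IH) auto
  qed
  \<comment> \<open>The outer factor is changed first and the recursive occurrences afterwards; the
    two parts match the two sums of \<open>exp_bell_lip\<close>.\<close>
  have "exp_bell m y n - exp_bell m' y n = (m - m') * (\<Sum>i<n. ?c i * exp_bell m y i) +
      m' * (\<Sum>i<n. ?c i * (exp_bell m y i - exp_bell m' y i))"
    by (subst (1 2) exp_bell.simps) (simp add: right_diff_distrib sum_subtractf left_diff_distrib)
  then have "\<bar>exp_bell m y n - exp_bell m' y n\<bar> = \<bar>(m - m') * (\<Sum>i<n. ?c i * exp_bell m y i) +
      m' * (\<Sum>i<n. ?c i * (exp_bell m y i - exp_bell m' y i))\<bar>"
    by (rule arg_cong)
  also have "\<dots> \<le> \<bar>m - m'\<bar> * (\<Sum>i<n. ?C i * exp_bell 1 K i) + 1 * (\<Sum>i<n. ?C i * (\<bar>m - m'\<bar> * exp_bell_lip K i))"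
  proof (rule order.trans[OF abs_triangle_ineq], rule add_mono)
    show "\<bar>m' * (\<Sum>i<n. ?c i * (exp_bell m y i - exp_bell m' y i))\<bar> \<le>
        1 * (\<Sum>i<n. ?C i * (\<bar>m - m'\<bar> * exp_bell_lip K i))"
      unfolding abs_mult[of m'] by (rule mult_mono[OF _ 2]) (use assms in auto)
    show "\<bar>(m - m') * (\<Sum>i<n. ?c i * exp_bell m y i)\<bar> \<le> \<bar>m - m'\<bar> * (\<Sum>i<n. ?C i * exp_bell 1 K i)"
      unfolding abs_mult[of "m - m'"] by (rule mult_left_mono[OF 1 abs_ge_zero])
  qed
  also have "\<dots> = \<bar>m - m'\<bar> * exp_bell_lip K n"
  proof -
    have "(\<Sum>i<n. ?C i * (\<bar>m - m'\<bar> * exp_bell_lip K i)) = \<bar>m - m'\<bar> * (\<Sum>i<n. ?C i * exp_bell_lip K i)"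
      by (subst mult.left_commute[of _ "\<bar>m - m'\<bar>"]) (rule sum_distrib_left[symmetric])
    then show ?thesis
      by (simp only: exp_bell_lip.simps[of K n] distrib_left mult_1_left)
  qed
  finally show ?case .
qed

text \<open>Moving the parameter from \<open>m\<close> to 0 turns \<open>exp_bell m y n\<close> into
  \<open>y n\<close>, and the price involves lower orders only. This recovers bounds on the
  derivatives themselves from bounds on the quotients.\<close>

lemma exp_bell_inverse_bound:
  assumes "0 \<le> m" "m \<le> 1" and "\<And>i. i < n \<Longrightarrow> \<bar>y i\<bar> \<le> K i"
  shows "\<bar>y n\<bar> \<le> \<bar>exp_bell m y n\<bar> + exp_bell_lip K n"
proof -
  have "\<bar>exp_bell m y n - exp_bell 0 y n\<bar> \<le> \<bar>m - 0\<bar> * exp_bell_lip K n"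
    using assms by (intro exp_bell_lipschitz) auto
  also have "\<dots> \<le> 1 * exp_bell_lip K n"
  proof (rule mult_right_mono)
    show "0 \<le> exp_bell_lip K n"
      by (rule exp_bell_lip_nonneg) (use assms(3) abs_ge_zero order.trans in blast)
  qed (use assms in auto)
  finally show ?thesis
    by (simp add: exp_bell_0_left)
qed

text \<open>The first derivative is a product, to which the Leibniz rule applies. The summand that
  leaves the exponential undifferentiated gives \<open>y n\<close>, and the others follow by
  induction; this is the origin of the recursion for \<open>exp_bell\<close>.\<close>

lemma higher_deriv_exp:
  assumes "smooth f"
  shows "(deriv ^^ Suc n) (\<lambda>x. exp (m * f x)) x =
    m * exp (m * f x) * exp_bell m (\<lambda>i. (deriv ^^ Suc i) f x) n"
proof (induction n rule: less_induct)
  case (less n)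
  let ?e = "\<lambda>x. exp (m * f x)"
  have e: "smooth ?e"
    by (intro smooth_exp smooth_cmult assms)
  have "deriv ?e = (\<lambda>x. m * (?e x * deriv f x))"
    by (intro ext DERIV_imp_deriv) (use smoothD0[OF assms] in \<open>auto intro!: derivative_eq_intros\<close>)
  then have "(deriv ^^ Suc n) ?e x = (deriv ^^ n) (\<lambda>x. m * (?e x * deriv f x)) x"
    by (simp add: funpow_swap1)
  also have "\<dots> = m * (deriv ^^ n) (\<lambda>x. ?e x * deriv f x) x"
    by (intro higher_deriv_cmult smooth_mult e smooth_deriv assms)
  finally have 1: "(deriv ^^ Suc n) ?e x = m * (deriv ^^ n) (\<lambda>x. ?e x * deriv f x) x" .
  have "(deriv ^^ n) (\<lambda>x. ?e x * deriv f x) x =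
      (\<Sum>i\<le>n. real (n choose i) * (deriv ^^ i) ?e x * (deriv ^^ Suc (n - i)) f x)"
    by (subst higher_deriv_mult_real[OF e smooth_deriv[OF assms]]) (simp only: higher_deriv_deriv)
  also have "\<dots> = exp (m * f x) * (deriv ^^ Suc n) f x +
      (\<Sum>i<n. real (n choose Suc i) * (deriv ^^ Suc i) ?e x * (deriv ^^ Suc (n - Suc i)) f x)"
    by (subst lessThan_Suc_atMost[symmetric], subst sum.lessThan_Suc_shift) simp
  finally have 2: "(deriv ^^ n) (\<lambda>x. ?e x * deriv f x) x = exp (m * f x) * (deriv ^^ Suc n) f x +
      (\<Sum>i<n. real (n choose Suc i) * (deriv ^^ Suc i) ?e x * (deriv ^^ Suc (n - Suc i)) f x)" .
  have 3: "(\<Sum>i<n. real (n choose Suc i) * (deriv ^^ Suc i) ?e x * (deriv ^^ Suc (n - Suc i)) f x) =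
    exp (m * f x) * m * (\<Sum>i<n. real (n choose Suc i) * (deriv ^^ Suc (n - Suc i)) f x * exp_bell m (\<lambda>i. (deriv ^^ Suc i) f x) i)"
    unfolding sum_distrib_left
  proof (intro sum.cong refl)
    fix i assume "i \<in> {..<n}"
    then have "i < n" by simp
    from less[OF this]
    show "real (n choose Suc i) * (deriv ^^ Suc i) ?e x * (deriv ^^ Suc (n - Suc i)) f x =
      exp (m * f x) * m * (real (n choose Suc i) * (deriv ^^ Suc (n - Suc i)) f x * exp_bell m (\<lambda>i. (deriv ^^ Suc i) f x) i)"
      by (simp only: mult_ac)
  qed
  show ?case
    unfolding 1 2 3 exp_bell.simps[of m "\<lambda>i. (deriv ^^ Suc i) f x" n]
    by (simp only: distrib_left mult_ac)
qed

subsection \<open>Gaussian averages\<close>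

abbreviation (input) "normal01 \<equiv> std_normal_distribution"

interpretation normal01: prob_space std_normal_distribution
  by (rule prob_space_normal_density) simp

lemma prob_normal01_UNIV [simp]: "normal01.prob UNIV = 1"
  using normal01.prob_space by simp

lemma exp_bound_mult:
  fixes a b :: real
  assumes "\<bar>a\<bar> \<le> C * exp (c * s)" "\<bar>b\<bar> \<le> D * exp (d * s)"
  shows "\<bar>a * b\<bar> \<le> (C * D) * exp ((c + d) * s)"
proof -
  have "\<bar>a * b\<bar> \<le> (C * exp (c * s)) * (D * exp (d * s))"
    unfolding abs_mult using assms by (intro mult_mono) auto
  then show ?thesis by (simp add: algebra_simps exp_add)
qed

text \<open>Completing the square: an exponential tilt of a centred Gaussian shifts its
  mean.\<close>

lemma std_normal_density_mult_exp:
  "std_normal_density z * exp (a * z) = exp (a\<^sup>2 / 2) * normal_density a 1 z"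
proof -
  have "exp (- (z - 0)\<^sup>2 / (2 * 1\<^sup>2)) * exp (a * z) = exp (a\<^sup>2 / 2) * exp (- (z - a)\<^sup>2 / (2 * 1\<^sup>2))"
    by (simp add: exp_add[symmetric] power2_eq_square field_simps)
  then show ?thesis by (simp add: normal_density_def)
qed

lemma
  shows integrable_normal01_exp: "integrable normal01 (\<lambda>z. exp (a * z))"
    and integral_normal01_exp: "(LINT z|normal01. exp (a * z)) = exp (a\<^sup>2 / 2)"
proof -
  have "has_bochner_integral lborel (\<lambda>z. exp (a\<^sup>2 / 2) * normal_density a 1 z) (exp (a\<^sup>2 / 2) * 1)"
    by (intro has_bochner_integral_mult_right) (simp add: has_bochner_integral_iff)
  then have "has_bochner_integral lborel (\<lambda>z. std_normal_density z *\<^sub>R exp (a * z)) (exp (a\<^sup>2 / 2))"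
    by (simp add: std_normal_density_mult_exp)
  then have "has_bochner_integral normal01 (\<lambda>z. exp (a * z)) (exp (a\<^sup>2 / 2))"
    by (intro has_bochner_integral_density) auto
  then show "integrable normal01 (\<lambda>z. exp (a * z))" "(LINT z|normal01. exp (a * z)) = exp (a\<^sup>2 / 2)"
    by (auto simp: has_bochner_integral_iff)
qed

lemma integrable_normal01_exp_abs: "integrable normal01 (\<lambda>z. exp (a * \<bar>z\<bar>))"
proof (rule Bochner_Integration.integrable_bound)
  show "integrable normal01 (\<lambda>z. exp (a * z) + exp (- a * z))"
    by (intro Bochner_Integration.integrable_add integrable_normal01_exp)
  show "AE z in normal01. norm (exp (a * \<bar>z\<bar>)) \<le> norm (exp (a * z) + exp (- a * z))"
  proof (rule AE_I2)
    fix z :: real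
    have "0 < exp (a * z)" "0 < exp (- a * z)" by auto
    then show "norm (exp (a * \<bar>z\<bar>)) \<le> norm (exp (a * z) + exp (- a * z))"
      by (cases "0 \<le> z") auto
  qed
qed auto

text \<open>The source of all Gaussian constants below: powers of \<open>\<bar>z\<bar>\<close> are
  absorbed into exponentials by \<open>power_abs_le_exp\<close>, so a single family of moments is
  enough.\<close>

definition gmgf :: "real \<Rightarrow> real" where
  "gmgf a = (LINT z|normal01. exp (a * \<bar>z\<bar>))"

lemma gmgf_nonneg: "0 \<le> gmgf a"
  unfolding gmgf_def by (intro integral_nonneg_AE) auto

text \<open>A class of integrands with finite Gaussian averages for every variance, stable under
  products and under averaging. It contains \<open>exp (m * f)\<close> for Lipschitz
  \<open>f\<close>, together with its derivatives when those of \<open>f\<close> are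
  bounded.\<close>

definition exp_growth :: "(real \<Rightarrow> real) \<Rightarrow> bool" where
  "exp_growth F \<longleftrightarrow> continuous_on UNIV F \<and> (\<exists>C c. 0 \<le> C \<and> 0 \<le> c \<and> (\<forall>y. \<bar>F y\<bar> \<le> C * exp (c * \<bar>y\<bar>)))"

lemma exp_growthI:
  assumes "continuous_on UNIV F" "\<And>y. \<bar>F y\<bar> \<le> C * exp (c * \<bar>y\<bar>)"
  shows "exp_growth F"
proof -
  have "0 \<le> C" using assms(2)[of 0] by (simp add: order.trans[OF abs_ge_zero])
  have "\<bar>F y\<bar> \<le> C * exp (\<bar>c\<bar> * \<bar>y\<bar>)" for y
    by (rule order.trans[OF assms(2)]) (use \<open>0 \<le> C\<close> in \<open>auto intro!: mult_left_mono mult_right_mono\<close>)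
  with assms(1) \<open>0 \<le> C\<close> show ?thesis unfolding exp_growth_def by (intro conjI exI[of _ C] exI[of _ "\<bar>c\<bar>"]) auto
qed

lemma exp_growthE:
  assumes "exp_growth F"
  obtains C c where "0 \<le> C" "0 \<le> c" "\<And>y. \<bar>F y\<bar> \<le> C * exp (c * \<bar>y\<bar>)"
  using assms unfolding exp_growth_def by blast

lemma exp_growth_continuous: "exp_growth F \<Longrightarrow> continuous_on UNIV F"
  by (simp add: exp_growth_def)

lemma exp_growth_measurable: "exp_growth F \<Longrightarrow> F \<in> borel_measurable borel"
  by (intro borel_measurable_continuous_onI exp_growth_continuous)

lemma exp_growth_bounded:
  assumes "continuous_on UNIV F" "\<And>y. \<bar>F y\<bar> \<le> C"
  shows "exp_growth F"
  by (rule exp_growthI[of F C 0]) (use assms in auto)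

lemma exp_growth_mult:
  assumes "exp_growth F" "exp_growth H"
  shows "exp_growth (\<lambda>y. F y * H y)"
proof -
  obtain C c where C: "\<And>y. \<bar>F y\<bar> \<le> C * exp (c * \<bar>y\<bar>)" using exp_growthE[OF assms(1)] by blast
  obtain D d where D: "\<And>y. \<bar>H y\<bar> \<le> D * exp (d * \<bar>y\<bar>)" using exp_growthE[OF assms(2)] by blast
  show ?thesis
    by (rule exp_growthI[OF _ exp_bound_mult[OF C D]])
      (intro continuous_on_mult exp_growth_continuous assms)
qed

lemma exp_growth_add:
  assumes "exp_growth F" "exp_growth H"
  shows "exp_growth (\<lambda>y. F y + H y)"
proof -
  obtain C c where C: "0 \<le> C" "0 \<le> c" "\<And>y. \<bar>F y\<bar> \<le> C * exp (c * \<bar>y\<bar>)" using exp_growthE[OF assms(1)] by blast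
  obtain D d where D: "0 \<le> D" "0 \<le> d" "\<And>y. \<bar>H y\<bar> \<le> D * exp (d * \<bar>y\<bar>)" using exp_growthE[OF assms(2)] by blast
  have "\<bar>F y + H y\<bar> \<le> (C + D) * exp ((c + d) * \<bar>y\<bar>)" for y
  proof -
    have "exp (c * \<bar>y\<bar>) \<le> exp ((c + d) * \<bar>y\<bar>)" "exp (d * \<bar>y\<bar>) \<le> exp ((c + d) * \<bar>y\<bar>)"
      using C D by (auto intro!: mult_right_mono)
    then have "C * exp (c * \<bar>y\<bar>) \<le> C * exp ((c + d) * \<bar>y\<bar>)" "D * exp (d * \<bar>y\<bar>) \<le> D * exp ((c + d) * \<bar>y\<bar>)"
      using C D by (auto intro!: mult_left_mono simp del: exp_le_cancel_iff)
    with C(3)[of y] D(3)[of y] show ?thesis unfolding distrib_right by linarith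
  qed
  then show ?thesis
    by (rule exp_growthI[rotated]) (intro continuous_on_add exp_growth_continuous assms)
qed

lemma exp_growth_const: "exp_growth (\<lambda>y. c)"
  by (rule exp_growth_bounded[of _ "\<bar>c\<bar>"]) auto

lemma exp_growth_cmult: "exp_growth F \<Longrightarrow> exp_growth (\<lambda>y. c * F y)"
  by (intro exp_growth_mult exp_growth_const)

text \<open>The heat semigroup, with the variance \<open>v\<close> as its time.\<close>

definition gauss_exp :: "real \<Rightarrow> (real \<Rightarrow> real) \<Rightarrow> real \<Rightarrow> real" where
  "gauss_exp v F x = (LINT z|normal01. F (x + z * sqrt v))"

lemma gauss_shift_bound:
  fixes x z v :: real
  assumes "\<And>y. \<bar>F y\<bar> \<le> C * exp (c * \<bar>y\<bar>)" "0 \<le> C" "0 \<le> c" "0 \<le> v"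
  shows "\<bar>F (x + z * sqrt v)\<bar> \<le> C * exp (c * \<bar>x\<bar>) * exp (c * sqrt v * \<bar>z\<bar>)"
proof -
  have "\<bar>x + z * sqrt v\<bar> \<le> \<bar>x\<bar> + sqrt v * \<bar>z\<bar>"
    using abs_triangle_ineq[of x "z * sqrt v"] assms(4) by (simp add: abs_mult mult.commute)
  then have "c * \<bar>x + z * sqrt v\<bar> \<le> c * \<bar>x\<bar> + c * sqrt v * \<bar>z\<bar>"
    using assms(3) mult_left_mono[of _ _ c] by (fastforce simp: distrib_left mult.assoc)
  then have "C * exp (c * \<bar>x + z * sqrt v\<bar>) \<le> C * exp (c * \<bar>x\<bar> + c * sqrt v * \<bar>z\<bar>)"
    using assms(2) by (intro mult_left_mono) auto
  with assms(1)[of "x + z * sqrt v"] show ?thesis by (simp add: exp_add)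
qed

lemma exp_growth_shift_measurable:
  "exp_growth F \<Longrightarrow> (\<lambda>z. F (x + z * sqrt v)) \<in> borel_measurable normal01"
  by (rule measurable_compose[OF _ exp_growth_measurable]) auto

lemma exp_growth_integrable:
  assumes "exp_growth F" "0 \<le> v"
  shows "integrable normal01 (\<lambda>z. F (x + z * sqrt v))"
proof -
  obtain C c where C: "0 \<le> C" "0 \<le> c" "\<And>y. \<bar>F y\<bar> \<le> C * exp (c * \<bar>y\<bar>)" using exp_growthE[OF assms(1)] by blast
  show ?thesis
  proof (rule Bochner_Integration.integrable_bound)
    show "integrable normal01 (\<lambda>z. C * exp (c * \<bar>x\<bar>) * exp (c * sqrt v * \<bar>z\<bar>))"
      by (intro integrable_mult_right integrable_normal01_exp_abs)
    show "AE z in normal01. norm (F (x + z * sqrt v)) \<le> norm (C * exp (c * \<bar>x\<bar>) * exp (c * sqrt v * \<bar>z\<bar>))"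
      using gauss_shift_bound[of F C c v x, OF C(3,1,2) assms(2)] C(1) by (auto simp: abs_mult)
  qed (rule exp_growth_shift_measurable[OF assms(1)])
qed

lemma gauss_exp_0: "gauss_exp 0 F x = F x"
  by (simp add: gauss_exp_def)

lemma gauss_exp_const: "gauss_exp v (\<lambda>y. c) x = c"
  by (simp add: gauss_exp_def)

lemma gauss_exp_mono:
  assumes "exp_growth F" "exp_growth H" "0 \<le> v" "\<And>y. F y \<le> H y"
  shows "gauss_exp v F x \<le> gauss_exp v H x"
  unfolding gauss_exp_def using assms by (intro integral_mono exp_growth_integrable) auto

lemma gauss_exp_cmult: "gauss_exp v (\<lambda>y. c * F y) x = c * gauss_exp v F x"
  by (simp add: gauss_exp_def)

lemma gauss_exp_add:
  assumes "exp_growth F" "exp_growth H" "0 \<le> v"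
  shows "gauss_exp v (\<lambda>y. F y + H y) x = gauss_exp v F x + gauss_exp v H x"
  unfolding gauss_exp_def using assms by (intro Bochner_Integration.integral_add exp_growth_integrable) auto

lemma gauss_exp_pos:
  assumes "exp_growth F" "0 \<le> v" "\<And>y. F y > 0"
  shows "gauss_exp v F x > 0"
proof -
  let ?f = "\<lambda>z. F (x + z * sqrt v)"
  have "0 \<le> gauss_exp v F x"
    unfolding gauss_exp_def using assms(3) by (intro integral_nonneg_AE) (auto intro: less_imp_le)
  moreover have "gauss_exp v F x \<noteq> 0"
  proof
    assume "gauss_exp v F x = 0"
    then have "AE z in normal01. ?f z = 0"
      unfolding gauss_exp_def
      by (subst (asm) integral_nonneg_eq_0_iff_AE) (use assms exp_growth_integrable in \<open>auto intro: less_imp_le\<close>)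
    then have "AE z in normal01. False"
      by eventually_elim (use assms(3) in \<open>auto simp: less_le\<close>)
    then show False using normal01.AE_False by simp
  qed
  ultimately show ?thesis by linarith
qed

lemma gmgf_pos: "0 < gmgf a"
proof -
  have "exp_growth (\<lambda>y. exp (a * \<bar>y\<bar>))"
    by (rule exp_growthI[of _ 1 a]) (auto intro!: continuous_intros)
  from gauss_exp_pos[OF this, of 1 0] show ?thesis by (simp add: gauss_exp_def gmgf_def)
qed

lemma gauss_exp_growth_bound:
  assumes "exp_growth F" "\<And>y. \<bar>F y\<bar> \<le> C * exp (c * \<bar>y\<bar>)" "0 \<le> C" "0 \<le> c" "0 \<le> v"
  shows "\<bar>gauss_exp v F x\<bar> \<le> C * gmgf (c * sqrt v) * exp (c * \<bar>x\<bar>)"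
proof -
  have "\<bar>gauss_exp v F x\<bar> \<le> (LINT z|normal01. \<bar>F (x + z * sqrt v)\<bar>)"
    unfolding gauss_exp_def by (rule integral_abs_bound)
  also have "\<dots> \<le> (LINT z|normal01. C * exp (c * \<bar>x\<bar>) * exp (c * sqrt v * \<bar>z\<bar>))"
    by (intro integral_mono integrable_abs exp_growth_integrable assms gauss_shift_bound
        integrable_mult_right integrable_normal01_exp_abs)
  also have "\<dots> = C * gmgf (c * sqrt v) * exp (c * \<bar>x\<bar>)"
    by (simp add: gmgf_def)
  finally show ?thesis .
qed

lemma exp_growth_gauss_exp:
  assumes "exp_growth F" "0 \<le> v"
  shows "exp_growth (gauss_exp v F)"
proof -
  obtain C c where C: "0 \<le> C" "0 \<le> c" "\<And>y. \<bar>F y\<bar> \<le> C * exp (c * \<bar>y\<bar>)" using exp_growthE[OF assms(1)] by blast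
  show ?thesis
  proof (rule exp_growthI[OF _ gauss_exp_growth_bound[OF assms(1) C(3,1,2) assms(2)]])
    show "continuous_on UNIV (gauss_exp v F)"
      unfolding continuous_on_sequentially
    proof (intro allI ballI impI, elim conjE)
      fix xs :: "nat \<Rightarrow> real" and x assume lim: "xs \<longlonglongrightarrow> x"
      from convergent_imp_Bseq[OF convergentI[OF lim]] obtain R where R: "\<And>n. \<bar>xs n\<bar> \<le> R"
        unfolding Bseq_def by auto
      show "(gauss_exp v F \<circ> xs) \<longlonglongrightarrow> gauss_exp v F x"
        unfolding gauss_exp_def o_def
      proof (rule integral_dominated_convergence[where w = "\<lambda>z. C * exp (c * R) * exp (c * sqrt v * \<bar>z\<bar>)"])
        show "AE z in normal01. (\<lambda>i. F (xs i + z * sqrt v)) \<longlonglongrightarrow> F (x + z * sqrt v)"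
        proof (rule AE_I2)
          fix z
          have "isCont F (x + z * sqrt v)"
            using exp_growth_continuous[OF assms(1)] by (simp add: continuous_on_eq_continuous_at)
          then show "(\<lambda>i. F (xs i + z * sqrt v)) \<longlonglongrightarrow> F (x + z * sqrt v)"
            by (rule isCont_tendsto_compose) (intro tendsto_intros lim)
        qed
        show "AE z in normal01. norm (F (xs i + z * sqrt v)) \<le> C * exp (c * R) * exp (c * sqrt v * \<bar>z\<bar>)" for i
        proof (rule AE_I2)
          fix z
          have "C * exp (c * \<bar>xs i\<bar>) * exp (c * sqrt v * \<bar>z\<bar>) \<le> C * exp (c * R) * exp (c * sqrt v * \<bar>z\<bar>)"
            using C R[of i] by (auto intro!: mult_left_mono mult_right_mono)
          with gauss_shift_bound[of F C c v "xs i" z, OF C(3,1,2) assms(2)]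
          show "norm (F (xs i + z * sqrt v)) \<le> C * exp (c * R) * exp (c * sqrt v * \<bar>z\<bar>)" by simp
        qed
      qed (intro exp_growth_shift_measurable assms integrable_mult_right integrable_normal01_exp_abs)+
    qed
  qed
qed

text \<open>Dominated convergence for difference quotients: along a null sequence of increments
  bounded by \<open>R\<close>, the mean value inequality bounds each quotient by the supremum of
  \<open>F'\<close> over a ball of radius \<open>R\<close>, which is integrable in
  \<open>z\<close>.\<close>

lemma DERIV_gauss_exp:
  assumes F: "exp_growth F" "\<And>x. (F has_real_derivative F' x) (at x)" and F': "exp_growth F'"
    and v: "0 \<le> v"
  shows "(gauss_exp v F has_real_derivative gauss_exp v F' x) (at x)"
proof -
  obtain C c where C: "0 \<le> C" "0 \<le> c" "\<And>y. \<bar>F' y\<bar> \<le> C * exp (c * \<bar>y\<bar>)" using exp_growthE[OF F'] by blast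
  have "(\<lambda>h. (gauss_exp v F (x + h) - gauss_exp v F x) / h) \<midarrow>0\<rightarrow> gauss_exp v F' x"
  proof (subst tendsto_at_iff_sequentially, intro allI impI)
    fix hs :: "nat \<Rightarrow> real" assume hs: "\<forall>i. hs i \<in> UNIV - {0}" "hs \<longlonglongrightarrow> 0"
    from convergent_imp_Bseq[OF convergentI[OF hs(2)]] obtain R where R: "\<And>n. \<bar>hs n\<bar> \<le> R"
      unfolding Bseq_def by auto
    define q where "q i z = (F (x + hs i + z * sqrt v) - F (x + z * sqrt v)) / hs i" for i z
    have eq: "(gauss_exp v F (x + hs i) - gauss_exp v F x) / hs i = (LINT z|normal01. q i z)" for i
      unfolding q_def gauss_exp_def by (simp add: F v exp_growth_integrable)
    have "(\<lambda>i. LINT z|normal01. q i z) \<longlonglongrightarrow> (LINT z|normal01. F' (x + z * sqrt v))"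
    proof (rule integral_dominated_convergence[where w = "\<lambda>z. C * exp (c * (\<bar>x\<bar> + R)) * exp (c * sqrt v * \<bar>z\<bar>)"])
      show "(\<lambda>z. F' (x + z * sqrt v)) \<in> borel_measurable normal01"
        by (rule exp_growth_shift_measurable[OF F'])
      show "q i \<in> borel_measurable normal01" for i
        unfolding q_def by (intro borel_measurable_divide borel_measurable_diff exp_growth_shift_measurable F(1) borel_measurable_const)
      show "integrable normal01 (\<lambda>z. C * exp (c * (\<bar>x\<bar> + R)) * exp (c * sqrt v * \<bar>z\<bar>))"
        by (intro integrable_mult_right integrable_normal01_exp_abs)
      show "AE z in normal01. (\<lambda>i. q i z) \<longlonglongrightarrow> F' (x + z * sqrt v)"
      proof (rule AE_I2)
        fix z
        have "((\<lambda>h. (F (x + z * sqrt v + h) - F (x + z * sqrt v)) / h) \<longlongrightarrow> F' (x + z * sqrt v)) (at 0)"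
          using F(2)[of "x + z * sqrt v"] by (simp add: DERIV_def)
        then have "(\<lambda>i. (F (x + z * sqrt v + hs i) - F (x + z * sqrt v)) / hs i) \<longlonglongrightarrow> F' (x + z * sqrt v)"
          using hs by (subst (asm) tendsto_at_iff_sequentially) (auto simp: o_def)
        then show "(\<lambda>i. q i z) \<longlonglongrightarrow> F' (x + z * sqrt v)"
          unfolding q_def by (simp add: add_ac)
      qed
      show "AE z in normal01. norm (q i z) \<le> C * exp (c * (\<bar>x\<bar> + R)) * exp (c * sqrt v * \<bar>z\<bar>)" for i
      proof (rule AE_I2)
        fix z
        let ?B = "C * exp (c * (\<bar>x\<bar> + R)) * exp (c * sqrt v * \<bar>z\<bar>)"
        have B: "\<bar>F' (x + t + z * sqrt v)\<bar> \<le> ?B" if "\<bar>t\<bar> \<le> R" for t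
        proof -
          have "\<bar>x + t\<bar> \<le> \<bar>x\<bar> + R" using that by linarith
          then have "C * exp (c * \<bar>x + t\<bar>) * exp (c * sqrt v * \<bar>z\<bar>) \<le> ?B"
            using C by (auto intro!: mult_left_mono mult_right_mono)
          with gauss_shift_bound[of F' C c v "x + t" z, OF C(3,1,2) v] show ?thesis by linarith
        qed
        have "hs i \<noteq> 0" using hs by auto
        have "\<bar>F (x + hs i + z * sqrt v) - F (x + 0 + z * sqrt v)\<bar> \<le> ?B * \<bar>hs i - 0\<bar>"
        proof (rule field_differentiable_bound[where S = "{-\<bar>hs i\<bar>..\<bar>hs i\<bar>}" and f = "\<lambda>t. F (x + t + z * sqrt v)"
              and f' = "\<lambda>t. F' (x + t + z * sqrt v)", simplified])
          fix t assume "- \<bar>hs i\<bar> \<le> t \<and> t \<le> \<bar>hs i\<bar>"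
          then have "\<bar>t\<bar> \<le> R" using R[of i] by linarith
          then show "\<bar>F' (x + t + z * sqrt v)\<bar> \<le> ?B" by (rule B)
        next
          fix t
          have "((\<lambda>t. F (x + t + z * sqrt v)) has_real_derivative F' (x + t + z * sqrt v) * 1) (at t)"
            by (rule DERIV_chain2[OF F(2)]) (auto intro!: derivative_eq_intros)
          then show "((\<lambda>t. F (x + t + z * sqrt v)) has_real_derivative F' (x + t + z * sqrt v)) (at t within {- \<bar>hs i\<bar>..\<bar>hs i\<bar>})"
            by (simp add: has_field_derivative_at_within)
        qed auto
        then show "norm (q i z) \<le> ?B"
          using \<open>hs i \<noteq> 0\<close> by (simp add: q_def field_simps)
      qed
    qed
    then show "((\<lambda>h. (gauss_exp v F (x + h) - gauss_exp v F x) / h) \<circ> hs) \<longlonglongrightarrow> gauss_exp v F' x"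
      unfolding o_def eq by (simp add: gauss_exp_def)
  qed
  then show ?thesis by (simp add: DERIV_def)
qed

lemma smooth_gauss_exp:
  assumes "smooth F" "\<And>n. exp_growth ((deriv ^^ n) F)" "0 \<le> v"
  shows "smooth (gauss_exp v F)" and "(deriv ^^ n) (gauss_exp v F) = gauss_exp v ((deriv ^^ n) F)"
proof -
  have D: "(gauss_exp v ((deriv ^^ n) F) has_real_derivative gauss_exp v ((deriv ^^ Suc n) F) x) (at x)" for n x
    by (intro DERIV_gauss_exp assms smoothD)
  show "smooth (gauss_exp v F)"
    by (rule smoothI[of "\<lambda>n. gauss_exp v ((deriv ^^ n) F)"]) (use D in auto)
  show "(deriv ^^ n) (gauss_exp v F) = gauss_exp v ((deriv ^^ n) F)"
    by (rule higher_deriv_eqI[of "\<lambda>n. gauss_exp v ((deriv ^^ n) F)"]) (use D in auto)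
qed

text \<open>The two coordinates of the product measure serve as independent standard Gaussians, so
  that the convolution of normal laws applies. Both variances are positive because a degenerate law
  has no density.\<close>

lemma normal01_sum_distributed:
  assumes "0 < a" "0 < b"
  shows "distributed (normal01 \<Otimes>\<^sub>M normal01) lborel (\<lambda>p. fst p * sqrt a + snd p * sqrt b) (normal_density 0 (sqrt (a + b)))"
proof -
  let ?P = "normal01 \<Otimes>\<^sub>M normal01"
  interpret P: pair_prob_space normal01 normal01 ..
  have sP: "sets ?P = sets (borel \<Otimes>\<^sub>M borel)"
    by (intro sets_pair_measure_cong) auto
  have df: "distr ?P lborel fst = normal01"
  proof -
    have "distr ?P lborel fst = distr ?P normal01 fst" by (intro distr_cong) auto
    then show ?thesis by (simp add: normal01.distr_pair_fst)
  qed
  have ds: "distr ?P lborel snd = normal01"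
  proof (rule measure_eqI)
    fix A :: "real set" assume "A \<in> sets (distr ?P lborel snd)"
    then have A: "A \<in> sets borel" by simp
    have "emeasure (distr ?P lborel snd) A = emeasure ?P (snd -` A \<inter> space ?P)"
      using A by (subst emeasure_distr) auto
    also have "snd -` A \<inter> space ?P = UNIV \<times> A" by (auto simp: space_pair_measure)
    also have "emeasure ?P \<dots> = emeasure normal01 UNIV * emeasure normal01 A"
      using A by (intro normal01.emeasure_pair_measure_Times) auto
    also have "\<dots> = emeasure normal01 A"
      using normal01.emeasure_space_1 by simp
    finally show "emeasure (distr ?P lborel snd) A = emeasure normal01 A" .
  qed simp
  have d1: "distributed ?P lborel fst std_normal_density" "distributed ?P lborel snd std_normal_density"
    unfolding distributed_def using df ds by (auto simp: normal_density_nonneg)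
  have ind: "P.indep_var borel fst borel snd"
    unfolding P.indep_var_distribution_eq
  proof (intro conjI)
    have "distr ?P borel fst = distr ?P lborel fst" "distr ?P borel snd = distr ?P lborel snd"
      by (intro distr_cong; simp)+
    then have "distr ?P borel fst \<Otimes>\<^sub>M distr ?P borel snd = ?P" by (simp add: df ds)
    also have "\<dots> = distr ?P (borel \<Otimes>\<^sub>M borel) (\<lambda>x. x)"
      by (subst distr_id2) (auto simp: sP)
    finally show "distr ?P borel fst \<Otimes>\<^sub>M distr ?P borel snd = distr ?P (borel \<Otimes>\<^sub>M borel) (\<lambda>x. (fst x, snd x))"
      by simp
  qed auto
  have "distributed ?P lborel (\<lambda>x. 0 + sqrt a * fst x) (normal_density (0 + sqrt a * 0) (\<bar>sqrt a\<bar> * 1))"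
    by (rule P.normal_density_affine[OF d1(1)]) (use assms in auto)
  moreover have "distributed ?P lborel (\<lambda>x. 0 + sqrt b * snd x) (normal_density (0 + sqrt b * 0) (\<bar>sqrt b\<bar> * 1))"
    by (rule P.normal_density_affine[OF d1(2)]) (use assms in auto)
  moreover have "P.indep_var borel ((\<lambda>x. sqrt a * x) \<circ> fst) borel ((\<lambda>x. sqrt b * x) \<circ> snd)"
    by (rule P.indep_var_compose[OF ind]) auto
  ultimately have "distributed ?P lborel (\<lambda>x. sqrt a * fst x + sqrt b * snd x) (normal_density (0 + 0) (sqrt ((sqrt a)\<^sup>2 + (sqrt b)\<^sup>2)))"
    using assms by (intro P.add_indep_normal) (auto simp: o_def)
  then show ?thesis using assms by (simp add: mult.commute)
qed

lemma normal01_scaled_distributed: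
  assumes "0 < a"
  shows "distributed normal01 lborel (\<lambda>z. z * sqrt a) (normal_density 0 (sqrt a))"
proof -
  have "distributed normal01 lborel (\<lambda>z. z) std_normal_density"
    unfolding distributed_def by (auto simp: normal_density_nonneg distr_id2)
  from normal01.normal_density_affine[OF this, of "sqrt a" 0] show ?thesis
    using assms by (simp add: mult.commute)
qed

text \<open>Fubini turns the iterated average into one over a pair of independent Gaussians, and
  their scaled sum has variance \<open>a + b\<close>. Variance 0 is treated apart for lack of a
  density.\<close>

lemma gauss_exp_semigroup:
  assumes F: "exp_growth F" and ab: "0 \<le> a" "0 \<le> b"
  shows "gauss_exp a (gauss_exp b F) x = gauss_exp (a + b) F x"
proof (cases "a = 0 \<or> b = 0")
  case True
  then show ?thesis
    by (auto simp: gauss_exp_0 gauss_exp_0[abs_def])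
next
  case False
  with ab have ab: "0 < a" "0 < b" by auto
  let ?P = "normal01 \<Otimes>\<^sub>M normal01"
  interpret P: pair_prob_space normal01 normal01 ..
  have Fm[measurable]: "F \<in> borel_measurable borel" by (rule exp_growth_measurable[OF F])
  obtain C c where C: "0 \<le> C" "0 \<le> c" "\<And>y. \<bar>F y\<bar> \<le> C * exp (c * \<bar>y\<bar>)" using exp_growthE[OF F] by blast
  let ?g = "\<lambda>p. F (x + (fst p * sqrt a + snd p * sqrt b))"
  have Fabs: "exp_growth (\<lambda>y. \<bar>F y\<bar>)"
    by (rule exp_growthI[of _ C c]) (use C exp_growth_continuous[OF F] in \<open>auto intro!: continuous_intros\<close>)
  have int: "integrable ?P ?g"
  proof (rule P.Fubini_integrable)
    have "(\<lambda>z. LINT y|normal01. norm (?g (z, y))) = (\<lambda>z. gauss_exp b (\<lambda>y. \<bar>F y\<bar>) (x + z * sqrt a))"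
      by (simp add: gauss_exp_def add_ac)
    then show "integrable normal01 (\<lambda>z. LINT y|normal01. norm (?g (z, y)))"
      using exp_growth_integrable[OF exp_growth_gauss_exp[OF Fabs, of b], of a x] ab by simp
    show "AE z in normal01. integrable normal01 (\<lambda>y. ?g (z, y))"
      using exp_growth_integrable[OF F, of b] ab by (auto simp: add.assoc[symmetric])
  qed measurable
  have "gauss_exp a (gauss_exp b F) x = (LINT z|normal01. LINT y|normal01. ?g (z, y))"
    by (simp add: gauss_exp_def add.assoc)
  also have "\<dots> = integral\<^sup>L ?P ?g"
    by (rule P.integral_fst'[OF int])
  also have "\<dots> = (LINT y|lborel. normal_density 0 (sqrt (a + b)) y * F (x + y))"
    using distributed_integral[OF normal01_sum_distributed[OF ab], of "\<lambda>y. F (x + y)"] by simp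
  also have "\<dots> = gauss_exp (a + b) F x"
    unfolding gauss_exp_def
    using distributed_integral[OF normal01_scaled_distributed[of "a + b"], of "\<lambda>y. F (x + y)"] ab by simp
  finally show ?thesis .
qed

subsection \<open>The Parisi step\<close>

text \<open>The constant 1 fits because the terminal value \<open>ln (cosh x)\<close> has slope at
  most 1, and every step preserves it. It also gives the growth needed for all exponential averages
  to be finite.\<close>

definition nonexpansive :: "(real \<Rightarrow> real) \<Rightarrow> bool" where
  "nonexpansive f \<longleftrightarrow> (\<forall>x y. \<bar>f x - f y\<bar> \<le> \<bar>x - y\<bar>)"

lemma nonexpansiveD: "nonexpansive f \<Longrightarrow> \<bar>f x - f y\<bar> \<le> \<bar>x - y\<bar>"
  by (simp add: nonexpansive_def)

lemma nonexpansive_continuous: "nonexpansive f \<Longrightarrow> continuous_on S f"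
  unfolding nonexpansive_def
  by (rule lipschitz_on_continuous_on[of 1]) (auto simp: lipschitz_on_def dist_real_def)

lemma nonexpansive_deriv:
  assumes "nonexpansive f" "(f has_real_derivative d) (at x)"
  shows "\<bar>d\<bar> \<le> 1"
proof (rule tendsto_upperbound)
  show "((\<lambda>h. \<bar>(f (x + h) - f x) / h\<bar>) \<longlongrightarrow> \<bar>d\<bar>) (at 0)"
    using assms(2) unfolding DERIV_def by (intro tendsto_rabs)
  show "\<forall>\<^sub>F h in at 0. \<bar>(f (x + h) - f x) / h\<bar> \<le> 1"
    unfolding eventually_at_topological
  proof (intro exI[of _ UNIV] conjI ballI impI)
    fix h :: real assume "h \<noteq> 0"
    with nonexpansiveD[OF assms(1), of "x + h" x] show "\<bar>(f (x + h) - f x) / h\<bar> \<le> 1"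
      by (simp add: field_simps)
  qed auto
qed simp

lemma nonexpansive_exp_growth_exp:
  assumes "nonexpansive f"
  shows "exp_growth (\<lambda>y. exp (m * f y))"
proof (rule exp_growthI)
  show "continuous_on UNIV (\<lambda>y. exp (m * f y))"
    by (intro continuous_intros nonexpansive_continuous assms)
  fix y
  have "\<bar>f y\<bar> \<le> \<bar>f 0\<bar> + \<bar>y\<bar>" using nonexpansiveD[OF assms, of y 0] by simp
  then have "\<bar>m * f y\<bar> \<le> \<bar>m\<bar> * \<bar>f 0\<bar> + \<bar>m\<bar> * \<bar>y\<bar>"
    by (simp add: abs_mult mult_left_mono flip: distrib_left)
  then have "m * f y \<le> \<bar>m\<bar> * \<bar>f 0\<bar> + \<bar>m\<bar> * \<bar>y\<bar>" by linarith
  then show "\<bar>exp (m * f y)\<bar> \<le> exp (\<bar>m\<bar> * \<bar>f 0\<bar>) * exp (\<bar>m\<bar> * \<bar>y\<bar>)"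
    by (simp add: exp_add[symmetric])
qed

lemma nonexpansive_exp_growth:
  assumes "nonexpansive f"
  shows "exp_growth f"
proof (rule exp_growthI)
  fix y
  have "\<bar>f y\<bar> \<le> \<bar>f 0\<bar> + \<bar>y\<bar>" using nonexpansiveD[OF assms, of y 0] by simp
  also have "\<dots> \<le> \<bar>f 0\<bar> * exp (1 * \<bar>y\<bar>) + exp (1 * \<bar>y\<bar>)"
  proof (intro add_mono)
    have "1 + \<bar>y\<bar> \<le> exp \<bar>y\<bar>" by (rule exp_ge_add_one_self)
    then show "\<bar>y\<bar> \<le> exp (1 * \<bar>y\<bar>)" unfolding mult_1_left by linarith
  qed (simp add: mult_le_cancel_left1)
  finally show "\<bar>f y\<bar> \<le> (\<bar>f 0\<bar> + 1) * exp (1 * \<bar>y\<bar>)" by (simp add: algebra_simps)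
qed (intro nonexpansive_continuous assms)

lemma nonexpansive_shift: "nonexpansive f \<Longrightarrow> nonexpansive (\<lambda>y. f (y + c))"
  unfolding nonexpansive_def by (metis add_diff_cancel_right)

lemma nonexpansive_add_const: "nonexpansive f \<Longrightarrow> nonexpansive (\<lambda>y. f y + c)"
  unfolding nonexpansive_def by simp

lemma parisi_step_eq:
  "parisi_step m v f x = (if m = 0 then gauss_exp v f x else ln (gauss_exp v (\<lambda>y. exp (m * f y)) x) / m)"
  by (simp add: parisi_step_def gauss_exp_def)

lemma gauss_exp_exp_pos:
  "nonexpansive f \<Longrightarrow> 0 \<le> v \<Longrightarrow> 0 < gauss_exp v (\<lambda>y. exp (m * f y)) x"
  by (intro gauss_exp_pos nonexpansive_exp_growth_exp) auto

lemma exp_parisi_step: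
  assumes "nonexpansive f" "0 \<le> v" "m \<noteq> 0"
  shows "exp (m * parisi_step m v f x) = gauss_exp v (\<lambda>y. exp (m * f y)) x"
  using assms gauss_exp_exp_pos[OF assms(1,2)] by (simp add: parisi_step_eq)

lemma parisi_step_0: "parisi_step m 0 f x = f x"
  by (simp add: parisi_step_eq gauss_exp_0)

lemma parisi_step_add_const:
  assumes "nonexpansive f" "0 \<le> v"
  shows "parisi_step m v (\<lambda>y. f y + c) x = parisi_step m v f x + c"
proof (cases "m = 0")
  case True
  then show ?thesis
    using gauss_exp_add[OF nonexpansive_exp_growth[OF assms(1)] exp_growth_const assms(2)]
    by (simp add: parisi_step_eq gauss_exp_const)
next
  case False
  have "gauss_exp v (\<lambda>y. exp (m * (f y + c))) x = exp (m * c) * gauss_exp v (\<lambda>y. exp (m * f y)) x"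
    by (subst gauss_exp_cmult[symmetric]) (simp add: exp_add[symmetric] algebra_simps)
  then show ?thesis
    using False gauss_exp_exp_pos[OF assms, of m x]
    by (simp add: parisi_step_eq ln_mult add_divide_distrib)
qed

lemma parisi_step_mono:
  assumes "nonexpansive f" "nonexpansive g" "0 \<le> v" "0 \<le> m" "\<And>y. f y \<le> g y"
  shows "parisi_step m v f x \<le> parisi_step m v g x"
proof (cases "m = 0")
  case True
  then show ?thesis
    using gauss_exp_mono[OF nonexpansive_exp_growth nonexpansive_exp_growth] assms
    by (simp add: parisi_step_eq)
next
  case False
  have "gauss_exp v (\<lambda>y. exp (m * f y)) x \<le> gauss_exp v (\<lambda>y. exp (m * g y)) x"
    by (intro gauss_exp_mono nonexpansive_exp_growth_exp assms) (use assms in \<open>auto intro: mult_left_mono\<close>)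
  then show ?thesis
    using False gauss_exp_exp_pos[OF assms(1,3), of m x] assms(4)
    by (simp add: parisi_step_eq divide_right_mono)
qed

text \<open>A monotone map that commutes with adding constants contracts the sup norm: apply both
  properties to \<open>f \<le> g + e\<close> and \<open>g \<le> f + e\<close>.\<close>

lemma parisi_step_contraction:
  assumes "nonexpansive f" "nonexpansive g" "0 \<le> v" "0 \<le> m" "\<And>y. \<bar>f y - g y\<bar> \<le> e"
  shows "\<bar>parisi_step m v f x - parisi_step m v g x\<bar> \<le> e"
proof -
  have "parisi_step m v f x \<le> parisi_step m v (\<lambda>y. g y + e) x"
    by (intro parisi_step_mono nonexpansive_add_const assms) (use assms(5) abs_le_iff in \<open>smt (verit)\<close>)
  moreover have "parisi_step m v g x \<le> parisi_step m v (\<lambda>y. f y + e) x"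
    by (intro parisi_step_mono nonexpansive_add_const assms) (use assms(5) abs_le_iff in \<open>smt (verit)\<close>)
  ultimately show ?thesis
    using parisi_step_add_const[OF assms(1,3)] parisi_step_add_const[OF assms(2,3)] by (simp add: abs_le_iff)
qed

lemma parisi_step_shift: "parisi_step m v f (x + c) = parisi_step m v (\<lambda>y. f (y + c)) x"
  by (simp add: parisi_step_def add_ac)

text \<open>The step commutes with translations, and translating a nonexpansive function by
  \<open>x - y\<close> moves it by at most \<open>\<bar>x - y\<bar>\<close> in sup norm; contraction
  does the rest.\<close>

lemma nonexpansive_parisi_step:
  assumes "nonexpansive f" "0 \<le> v" "0 \<le> m"
  shows "nonexpansive (parisi_step m v f)"
  unfolding nonexpansive_def
proof (intro allI)
  fix x y
  have "\<bar>parisi_step m v (\<lambda>t. f (t + (x - y))) y - parisi_step m v f y\<bar> \<le> \<bar>x - y\<bar>"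
  proof (intro parisi_step_contraction nonexpansive_shift assms)
    show "\<bar>f (t + (x - y)) - f t\<bar> \<le> \<bar>x - y\<bar>" for t
      using nonexpansiveD[OF assms(1), of "t + (x - y)" t] by simp
  qed
  then show "\<bar>parisi_step m v f x - parisi_step m v f y\<bar> \<le> \<bar>x - y\<bar>"
    using parisi_step_shift[of m v f y "x - y"] by simp
qed

text \<open>The Cole-Hopf transformation: for fixed \<open>m\<close>, passing to
  \<open>exp (m * f)\<close> conjugates the step to the heat semigroup.\<close>

lemma parisi_step_semigroup:
  assumes "nonexpansive f" "0 \<le> a" "0 \<le> b" "0 \<le> m"
  shows "parisi_step m a (parisi_step m b f) x = parisi_step m (a + b) f x"
proof (cases "m = 0")
  case True
  then have "parisi_step m b f = gauss_exp b f" by (simp add: parisi_step_eq fun_eq_iff)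
  with True show ?thesis
    using gauss_exp_semigroup[OF nonexpansive_exp_growth[OF assms(1)] assms(2,3)]
    by (simp add: parisi_step_eq)
next
  case False
  have "(\<lambda>y. exp (m * parisi_step m b f y)) = gauss_exp b (\<lambda>y. exp (m * f y))"
    using exp_parisi_step[OF assms(1,3) False] by (simp add: fun_eq_iff)
  with False show ?thesis
    using gauss_exp_semigroup[OF nonexpansive_exp_growth_exp[OF assms(1)] assms(2,3)]
    by (simp add: parisi_step_eq[of m a] parisi_step_eq[of m "a + b"])
qed

subsection \<open>Derivatives of a step\<close>

abbreviation (input) derivs :: "(real \<Rightarrow> real) \<Rightarrow> real \<Rightarrow> nat \<Rightarrow> real" where
  "derivs f x \<equiv> \<lambda>i. (deriv ^^ Suc i) f x"

lemma smooth_bounded_exp_growth: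
  assumes "nonexpansive f" "smooth_bounded K f"
  shows "exp_growth ((deriv ^^ n) f)"
proof (cases n)
  case 0
  then show ?thesis using nonexpansive_exp_growth[OF assms(1)] by simp
next
  case (Suc k)
  show ?thesis unfolding Suc
    by (rule exp_growth_bounded[OF smooth_continuous_higher smooth_bounded_le])
      (use assms smooth_bounded_smooth in auto)
qed

lemma smooth_bounded_exp_growth_exp:
  assumes "nonexpansive f" "smooth_bounded K f" "0 \<le> m" "m \<le> 1"
  shows "exp_growth ((deriv ^^ n) (\<lambda>x. exp (m * f x)))"
proof (cases n)
  case 0
  then show ?thesis using nonexpansive_exp_growth_exp[OF assms(1)] by simp
next
  case (Suc k)
  have sm: "smooth f" using assms smooth_bounded_smooth by blast
  obtain C c where C: "0 \<le> C" "0 \<le> c" "\<And>y. \<bar>exp (m * f y)\<bar> \<le> C * exp (c * \<bar>y\<bar>)"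
    using exp_growthE[OF nonexpansive_exp_growth_exp[OF assms(1)]] by blast
  show ?thesis unfolding Suc
  proof (rule exp_growthI)
    show "continuous_on UNIV ((deriv ^^ Suc k) (\<lambda>x. exp (m * f x)))"
      by (intro smooth_continuous_higher smooth_exp smooth_cmult sm)
    fix y
    have b: "\<bar>exp_bell m (derivs f y) k\<bar> \<le> exp_bell 1 K k"
      by (intro exp_bell_abs_le smooth_bounded_le assms)
    have "\<bar>(deriv ^^ Suc k) (\<lambda>x. exp (m * f x)) y\<bar> = m * \<bar>exp_bell m (derivs f y) k\<bar> * \<bar>exp (m * f y)\<bar>"
      unfolding higher_deriv_exp[OF sm] abs_mult using assms by (simp add: mult_ac)
    also have "\<dots> \<le> (1 * exp_bell 1 K k) * (C * exp (c * \<bar>y\<bar>))"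
      by (intro mult_mono C(3) b) (use assms b in auto)
    finally show "\<bar>(deriv ^^ Suc k) (\<lambda>x. exp (m * f x)) y\<bar> \<le> (exp_bell 1 K k * C) * exp (c * \<bar>y\<bar>)"
      by (simp add: mult_ac)
  qed
qed

lemma smooth_parisi_step:
  assumes "nonexpansive f" "smooth_bounded K f" "0 \<le> m" "m \<le> 1" "0 \<le> v"
  shows "smooth (parisi_step m v f)"
proof (cases "m = 0")
  case True
  then have "parisi_step m v f = gauss_exp v f" by (simp add: parisi_step_eq fun_eq_iff)
  with smooth_gauss_exp(1)[OF smooth_bounded_smooth[OF assms(2)] smooth_bounded_exp_growth assms(5)] assms
  show ?thesis by simp
next
  case False
  have "smooth (gauss_exp v (\<lambda>x. exp (m * f x)))"
    by (rule smooth_gauss_exp(1)[OF _ smooth_bounded_exp_growth_exp assms(5)])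
      (use assms smooth_bounded_smooth in \<open>auto intro!: smooth_exp smooth_cmult\<close>)
  then have "smooth (\<lambda>x. (1 / m) * ln (gauss_exp v (\<lambda>x. exp (m * f x)) x))"
    by (intro smooth_cmult smooth_ln gauss_exp_exp_pos assms)
  moreover have "parisi_step m v f = (\<lambda>x. (1 / m) * ln (gauss_exp v (\<lambda>x. exp (m * f x)) x))"
    using False by (simp add: parisi_step_eq fun_eq_iff)
  ultimately show ?thesis by simp
qed

text \<open>The tilted Gaussian average at \<open>parisi_step m v f\<close> maps \<open>exp_bell m\<close> of \<open>f\<close> to \<open>exp_bell m\<close> of
  the step, so sup-norm bounds on \<open>exp_bell m\<close> survive arbitrarily many steps.\<close>

lemma exp_bell_parisi_step_bound:
  assumes "nonexpansive f" "smooth_bounded K f" "0 \<le> m" "m \<le> 1" "0 \<le> v"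
    and B: "\<And>y. \<bar>exp_bell m (derivs f y) n\<bar> \<le> B"
  shows "\<bar>exp_bell m (derivs (parisi_step m v f) x) n\<bar> \<le> B"
proof (cases "m = 0")
  case True
  then have "parisi_step m v f = gauss_exp v f" by (simp add: parisi_step_eq fun_eq_iff)
  then have "exp_bell m (derivs (parisi_step m v f) x) n = gauss_exp v ((deriv ^^ Suc n) f) x"
    using True smooth_gauss_exp(2)[OF smooth_bounded_smooth[OF assms(2)] smooth_bounded_exp_growth[OF assms(1,2)] assms(5), of "Suc n"]
    by (simp only: exp_bell_0_left)
  moreover have B': "\<bar>(deriv ^^ Suc n) f y\<bar> \<le> B" for y
    using B[of y] True by (simp only: exp_bell_0_left)
  then have "gauss_exp v ((deriv ^^ Suc n) f) x \<le> gauss_exp v (\<lambda>y. B) x"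
      "gauss_exp v (\<lambda>y. - B) x \<le> gauss_exp v ((deriv ^^ Suc n) f) x"
    by (intro gauss_exp_mono smooth_bounded_exp_growth[OF assms(1,2)] exp_growth_const assms;
      smt (verit, ccfv_threshold))+
  ultimately show ?thesis by (simp add: gauss_exp_const abs_le_iff)
next
  case False
  let ?E = "\<lambda>y. exp (m * f y)" and ?b = "\<lambda>y. exp_bell m (derivs f y) n"
  let ?h = "parisi_step m v f"
  have sm: "smooth f" using assms smooth_bounded_smooth by blast
  have eg: "exp_growth ((deriv ^^ n) ?E)" for n
    by (rule smooth_bounded_exp_growth_exp[OF assms(1-4)])
  have eh: "(\<lambda>y. exp (m * ?h y)) = gauss_exp v ?E"
    using exp_parisi_step[OF assms(1,5) False] by (simp add: fun_eq_iff)
  \<comment> \<open>The same derivative is computed twice: through \<open>exp_bell\<close> of the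
    step, and by moving the derivatives under the Gaussian average.\<close>
  have "m * exp (m * ?h x) * exp_bell m (derivs ?h x) n = (deriv ^^ Suc n) (gauss_exp v ?E) x"
    using higher_deriv_exp[OF smooth_parisi_step[OF assms(1-5)], of n m x] eh by simp
  also have "\<dots> = gauss_exp v ((deriv ^^ Suc n) ?E) x"
    by (subst smooth_gauss_exp(2)) (use eg assms(5) sm in \<open>auto intro!: smooth_exp smooth_cmult\<close>)
  finally have eq: "m * exp (m * ?h x) * exp_bell m (derivs ?h x) n = gauss_exp v ((deriv ^^ Suc n) ?E) x" .
  have DE: "(deriv ^^ Suc n) ?E y = m * ?E y * ?b y" for y
    by (rule higher_deriv_exp[OF sm])
  have le: "\<bar>(deriv ^^ Suc n) ?E y\<bar> \<le> (m * B) * ?E y" for y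
    using assms(3) B[of y] mult_mono[OF order.refl B[of y], of "m * ?E y"]
    unfolding DE by (simp add: abs_mult mult_ac)
  have egB: "exp_growth (\<lambda>y. (m * B) * ?E y)" "exp_growth (\<lambda>y. (- m * B) * ?E y)"
    by (intro exp_growth_cmult nonexpansive_exp_growth_exp assms)+
  have "gauss_exp v ((deriv ^^ Suc n) ?E) x \<le> gauss_exp v (\<lambda>y. (m * B) * ?E y) x"
    by (rule gauss_exp_mono[OF eg egB(1) assms(5)]) (use le abs_le_D1 in blast)
  moreover have "gauss_exp v (\<lambda>y. (- m * B) * ?E y) x \<le> gauss_exp v ((deriv ^^ Suc n) ?E) x"
  proof (rule gauss_exp_mono[OF egB(2) eg assms(5)])
    show "- m * B * ?E y \<le> (deriv ^^ Suc n) ?E y" for y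
      using abs_le_D2[OF le[of y]] unfolding mult_minus_left by linarith
  qed
  ultimately have "\<bar>gauss_exp v ((deriv ^^ Suc n) ?E) x\<bar> \<le> m * B * exp (m * ?h x)"
    unfolding gauss_exp_cmult exp_parisi_step[OF assms(1,5) False] by (simp add: abs_le_iff)
  then have "(m * exp (m * ?h x)) * \<bar>exp_bell m (derivs ?h x) n\<bar> \<le> (m * exp (m * ?h x)) * B"
    unfolding eq[symmetric] abs_mult using assms(3) by (simp add: mult_ac)
  moreover have "0 < m * exp (m * ?h x)" using assms(3) False by simp
  ultimately show ?thesis by (simp only: mult_le_cancel_left_pos)
qed

text \<open>Induction on the order: bounds below \<open>n\<close> and a bound on the quotient of
  order \<open>n\<close> give a bound on the derivative by
  \<open>exp_bell_inverse_bound\<close>.\<close>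

lemma smooth_bounded_from_exp_bell:
  assumes "smooth f" "0 \<le> m" "m \<le> 1" and "\<And>n. \<exists>B. \<forall>x. \<bar>exp_bell m (derivs f x) n\<bar> \<le> B"
  shows "\<exists>K. smooth_bounded K f"
proof -
  have "\<exists>b. \<forall>x. \<bar>(deriv ^^ Suc n) f x\<bar> \<le> b" for n
  proof (induction n rule: less_induct)
    case (less n)
    then obtain K where K: "\<And>i x. i < n \<Longrightarrow> \<bar>(deriv ^^ Suc i) f x\<bar> \<le> K i" by metis
    obtain B where B: "\<And>x. \<bar>exp_bell m (derivs f x) n\<bar> \<le> B" using assms(4) by blast
    have "\<bar>(deriv ^^ Suc n) f x\<bar> \<le> B + exp_bell_lip K n" for x
      using exp_bell_inverse_bound[of m n "derivs f x" K] assms K B[of x] by fastforce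
    then show ?case by blast
  qed
  then obtain K where "\<And>n x. \<bar>(deriv ^^ Suc n) f x\<bar> \<le> K n" by metis
  with assms(1) show ?thesis unfolding smooth_bounded_def by blast
qed

text \<open>Purely qualitative: \<open>K'\<close> may deteriorate from step to step. It supplies the
  regularity under which the sharper, uniform induction over the atoms can be run.\<close>

lemma smooth_bounded_parisi_step:
  assumes "nonexpansive f" "smooth_bounded K f" "0 \<le> m" "m \<le> 1" "0 \<le> v"
  shows "\<exists>K'. smooth_bounded K' (parisi_step m v f)"
proof (rule smooth_bounded_from_exp_bell[OF smooth_parisi_step[OF assms] assms(3,4)])
  fix n
  have "\<bar>exp_bell m (derivs f y) n\<bar> \<le> exp_bell 1 K n" for y
    by (intro exp_bell_abs_le smooth_bounded_le assms)
  then show "\<exists>B. \<forall>x. \<bar>exp_bell m (derivs (parisi_step m v f) x) n\<bar> \<le> B"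
    using exp_bell_parisi_step_bound[OF assms] by blast
qed

subsection \<open>Dependence of a step on its mass and variance\<close>

text \<open>With \<open>Y\<close> the increment of \<open>f\<close>, the numerator bounds the
  average of \<open>exp (m * Y) * Y^2 * exp \<bar>Y\<bar>\<close> divided by \<open>v\<close>: the
  summand 2 absorbs the square, and \<open>2 * sqrt V\<close> the two exponentials. The denominator
  is a lower bound for the average of \<open>exp (m * Y)\<close>.\<close>

definition step_const :: "real \<Rightarrow> real" where
  "step_const V = gmgf (2 + 2 * sqrt V) / gmgf (- sqrt V)"

lemma step_const_nonneg: "0 \<le> step_const V"
  unfolding step_const_def using gmgf_nonneg by (intro divide_nonneg_nonneg) auto

lemma exp_le_quadratic: "exp s \<le> 1 + s + s\<^sup>2 * exp \<bar>s\<bar>" for s :: real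
proof -
  obtain t where t: "\<bar>t\<bar> \<le> \<bar>s\<bar>" "exp s = (\<Sum>m<2. s ^ m / fact m) + exp t / fact 2 * s ^ 2"
    using Maclaurin_exp_le[of s 2] by blast
  have "exp t / 2 * s\<^sup>2 \<le> exp \<bar>s\<bar> * s\<^sup>2"
  proof (rule mult_right_mono)
    have "exp t \<le> exp \<bar>s\<bar>" using t(1) by auto
    then show "exp t / 2 \<le> exp \<bar>s\<bar>" using exp_gt_zero[of t] by linarith
  qed simp
  with t(2) show ?thesis by (simp add: numeral_2_eq_2 mult.commute)
qed

lemma abs_le_exp_abs: "\<bar>z\<bar> \<le> exp \<bar>z\<bar>" for z :: real
  using exp_ge_add_one_self[of "\<bar>z\<bar>"] by linarith

lemma power_abs_le_exp: "\<bar>z\<bar> ^ k \<le> exp (real k * \<bar>z\<bar>)" for z :: real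
  using power_mono[OF abs_le_exp_abs[of z], of k] by (simp add: exp_of_nat_mult)

text \<open>Write \<open>Y = f (x + z * sqrt v) - f x\<close> and let \<open>Q\<close> be the law tilted by \<open>exp (m * Y)\<close>. Both
  logarithms in the two steps are of the form \<open>ln E\<^sub>Q exp (t * Y)\<close>, which lies between \<open>t * E\<^sub>Q Y\<close>
  and \<open>t * E\<^sub>Q Y + t\<^sup>2 * A\<close>, and the linear terms cancel.\<close>

lemma parisi_step_mono_parameter:
  assumes f: "nonexpansive f" and v: "0 \<le> v" "v \<le> V" and m: "0 \<le> m" "m \<le> m'" "m' \<le> 1"
  shows "parisi_step m v f x \<le> parisi_step m' v f x"
    and "parisi_step m' v f x \<le> parisi_step m v f x + (m' - m) * (step_const V * v)"
proof -
  define Y where "Y y = f y - f x" for y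
  define w where "w = gauss_exp v (\<lambda>y. exp (m * Y y)) x"
  define Q where "Q g = gauss_exp v (\<lambda>y. exp (m * Y y) * g y) x / w" for g
  define A where "A = step_const V * v"
  have Y: "nonexpansive Y"
    using f by (simp add: Y_def nonexpansive_def)
  note eg = nonexpansive_exp_growth_exp[OF Y]
  have Yz: "\<bar>Y (x + z * sqrt v)\<bar> \<le> sqrt v * \<bar>z\<bar>" for z
    using nonexpansiveD[OF f, of "x + z * sqrt v" x] v by (simp add: Y_def abs_mult mult.commute)
  have w: "w > 0"
    unfolding w_def by (rule gauss_exp_pos[OF eg v(1)]) auto
  have Qmono: "Q g \<le> Q h" if "exp_growth g" "exp_growth h" "\<And>y. g y \<le> h y" for g h
    unfolding Q_def using that w v(1)
    by (intro divide_right_mono gauss_exp_mono exp_growth_mult eg) auto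
  have Qadd: "Q (\<lambda>y. g y + h y) = Q g + Q h" if "exp_growth g" "exp_growth h" for g h
    unfolding Q_def distrib_left using that v(1)
    by (subst gauss_exp_add) (auto intro!: exp_growth_mult eg simp: add_divide_distrib)
  have Qc: "Q (\<lambda>y. c * g y) = c * Q g" for c g
    unfolding Q_def by (subst mult.left_commute) (simp add: gauss_exp_cmult)
  have Q1: "Q (\<lambda>y. c) = c" for c
    unfolding Q_def using w gauss_exp_cmult[of v c "\<lambda>y. exp (m * Y y)" x]
    by (simp add: w_def mult.commute)
  have egY: "exp_growth Y" by (rule nonexpansive_exp_growth[OF Y])
  have egA: "exp_growth (\<lambda>y. (Y y)\<^sup>2 * exp \<bar>Y y\<bar>)"
  proof -
    have "exp_growth (\<lambda>y. exp \<bar>Y y\<bar>)"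
      using nonexpansive_exp_growth_exp[of "\<lambda>y. \<bar>Y y\<bar>" 1] Y
      by (force simp: nonexpansive_def intro: order.trans[OF abs_triangle_ineq3])
    then show ?thesis
      unfolding power2_eq_square by (intro exp_growth_mult egY)
  qed
  have A: "Q (\<lambda>y. (Y y)\<^sup>2 * exp \<bar>Y y\<bar>) \<le> A"
  proof -
    have num_le: "exp (m * Y y) * ((Y y)\<^sup>2 * exp \<bar>Y y\<bar>) \<le> v * exp ((2 + 2 * sqrt V) * \<bar>z\<bar>)"
      if y: "\<bar>Y y\<bar> \<le> sqrt v * \<bar>z\<bar>" for y z
    proof -
      have sV: "sqrt v * \<bar>z\<bar> \<le> sqrt V * \<bar>z\<bar>" using v by (intro mult_right_mono) auto
      have "\<bar>m * Y y\<bar> \<le> 1 * \<bar>Y y\<bar>" using m unfolding abs_mult by (intro mult_right_mono) auto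
      then have "m * Y y + \<bar>Y y\<bar> \<le> 2 * sqrt V * \<bar>z\<bar>" using y sV by linarith
      then have 1: "exp (m * Y y) * exp \<bar>Y y\<bar> \<le> exp (2 * sqrt V * \<bar>z\<bar>)"
        by (simp add: exp_add[symmetric])
      have "(Y y)\<^sup>2 \<le> (sqrt v * \<bar>z\<bar>)\<^sup>2"
        using power_mono[OF y abs_ge_zero, of 2] by simp
      also have "\<dots> = v * \<bar>z\<bar> ^ 2" using v by (simp add: power_mult_distrib)
      also have "\<dots> \<le> v * exp (2 * \<bar>z\<bar>)"
        using power_abs_le_exp[of z 2] v by (intro mult_left_mono) auto
      finally have 2: "(Y y)\<^sup>2 \<le> v * exp (2 * \<bar>z\<bar>)" .
      have 3: "exp (m * Y y) * exp \<bar>Y y\<bar> * (Y y)\<^sup>2 \<le> exp (2 * sqrt V * \<bar>z\<bar>) * (v * exp (2 * \<bar>z\<bar>))"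
        by (rule mult_mono[OF 1 2]) auto
      have 4: "(2 + 2 * sqrt V) * \<bar>z\<bar> = 2 * sqrt V * \<bar>z\<bar> + 2 * \<bar>z\<bar>"
        by (simp add: algebra_simps)
      show ?thesis
        using 3 unfolding 4 exp_add by (simp only: mult_ac)
    qed
    have "gauss_exp v (\<lambda>y. exp (m * Y y) * ((Y y)\<^sup>2 * exp \<bar>Y y\<bar>)) x \<le>
        (LINT z|normal01. v * exp ((2 + 2 * sqrt V) * \<bar>z\<bar>))"
      unfolding gauss_exp_def
      by (rule integral_mono[OF exp_growth_integrable[OF exp_growth_mult[OF eg egA] v(1)]
            integrable_mult_right[OF integrable_normal01_exp_abs] num_le[OF Yz]])
    then have num: "gauss_exp v (\<lambda>y. exp (m * Y y) * ((Y y)\<^sup>2 * exp \<bar>Y y\<bar>)) x \<le> v * gmgf (2 + 2 * sqrt V)"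
      by (simp add: gmgf_def)
    have den_le: "exp (- sqrt V * \<bar>z\<bar>) \<le> exp (m * Y y)" if y: "\<bar>Y y\<bar> \<le> sqrt v * \<bar>z\<bar>" for y z
    proof -
      have sV: "sqrt v * \<bar>z\<bar> \<le> sqrt V * \<bar>z\<bar>" using v by (intro mult_right_mono) auto
      have "\<bar>m * Y y\<bar> \<le> 1 * \<bar>Y y\<bar>" using m unfolding abs_mult by (intro mult_right_mono) auto
      then have "- (sqrt V * \<bar>z\<bar>) \<le> m * Y y" using y sV by linarith
      then show ?thesis by simp
    qed
    have den: "gmgf (- sqrt V) \<le> w"
      unfolding w_def gmgf_def gauss_exp_def
      by (rule integral_mono[OF integrable_normal01_exp_abs exp_growth_integrable[OF eg v(1)] den_le[OF Yz]])
    show ?thesis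
      unfolding Q_def A_def step_const_def
      using frac_le[OF _ num gmgf_pos den] v gmgf_nonneg by (simp add: mult_ac)
  qed
  have A0: "0 \<le> A"
    using v step_const_nonneg by (auto simp: A_def)
  have R: "t * Q Y \<le> ln (Q (\<lambda>y. exp (t * Y y)))" "ln (Q (\<lambda>y. exp (t * Y y))) \<le> t * Q Y + t\<^sup>2 * A" 
      "0 < Q (\<lambda>y. exp (t * Y y))" if t: "\<bar>t\<bar> \<le> 1" for t
  proof -
    let ?a = "t * Q Y"
    \<comment> \<open>Jensen's inequality for the tilted law, by integrating the tangent line of
      \<open>exp\<close> at \<open>?a\<close>.\<close>
    have "Q (\<lambda>y. exp ?a * (1 - ?a) + (exp ?a * t) * Y y) \<le> Q (\<lambda>y. exp (t * Y y))"
    proof (intro Qmono exp_growth_add exp_growth_const exp_growth_cmult egY eg)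
      fix y
      have "exp ?a * (1 + (t * Y y - ?a)) \<le> exp ?a * exp (t * Y y - ?a)"
        by (intro mult_left_mono exp_ge_add_one_self) auto
      then show "exp ?a * (1 - ?a) + (exp ?a * t) * Y y \<le> exp (t * Y y)"
        by (simp add: exp_add[symmetric] algebra_simps)
    qed
    also have "Q (\<lambda>y. exp ?a * (1 - ?a) + (exp ?a * t) * Y y) = exp ?a * (1 - ?a) + (exp ?a * t) * Q Y"
      by (subst Qadd) (auto intro!: exp_growth_const exp_growth_cmult egY simp: Q1 Qc)
    also have "\<dots> = exp ?a" by (simp add: algebra_simps)
    finally have ge: "exp ?a \<le> Q (\<lambda>y. exp (t * Y y))" .
    then show pos: "0 < Q (\<lambda>y. exp (t * Y y))" using exp_gt_zero order.strict_trans2 by blast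
    show "?a \<le> ln (Q (\<lambda>y. exp (t * Y y)))"
      using ge pos by (simp add: ln_ge_iff)
    \<comment> \<open>For the upper bound, \<open>exp\<close> is replaced by a quadratic majorant,
      and the logarithm by its tangent at 1.\<close>
    have "Q (\<lambda>y. exp (t * Y y)) \<le> Q (\<lambda>y. (1 + t * Y y) + t\<^sup>2 * ((Y y)\<^sup>2 * exp \<bar>Y y\<bar>))"
    proof (intro Qmono exp_growth_add exp_growth_const exp_growth_cmult egY eg egA)
      fix y
      have "\<bar>t * Y y\<bar> \<le> 1 * \<bar>Y y\<bar>" using t unfolding abs_mult by (intro mult_right_mono) auto
      then have "(t * Y y)\<^sup>2 * exp \<bar>t * Y y\<bar> \<le> (t * Y y)\<^sup>2 * exp \<bar>Y y\<bar>"
        by (intro mult_left_mono) auto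
      with exp_le_quadratic[of "t * Y y"]
      show "exp (t * Y y) \<le> (1 + t * Y y) + t\<^sup>2 * ((Y y)\<^sup>2 * exp \<bar>Y y\<bar>)"
        by (simp add: power_mult_distrib mult_ac)
    qed
    also have "\<dots> = (1 + t * Q Y) + t\<^sup>2 * Q (\<lambda>y. (Y y)\<^sup>2 * exp \<bar>Y y\<bar>)"
      by (subst Qadd, (intro exp_growth_add exp_growth_const exp_growth_cmult egY egA)+,
          subst Qadd, (intro exp_growth_add exp_growth_const exp_growth_cmult egY egA)+) (simp add: Q1 Qc)
    also have "\<dots> \<le> (1 + t * Q Y) + t\<^sup>2 * A"
      by (intro add_left_mono mult_left_mono A) auto
    finally show "ln (Q (\<lambda>y. exp (t * Y y))) \<le> t * Q Y + t\<^sup>2 * A"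
      using ln_le_minus_one[OF pos] by linarith
  qed
  have Qexp: "Q (\<lambda>y. exp (t * Y y)) = gauss_exp v (\<lambda>y. exp ((m + t) * Y y)) x / w" for t
    unfolding Q_def by (simp add: exp_add[symmetric] distrib_right)
  have step: "parisi_step k v f x = f x + (if k = 0 then gauss_exp v Y x else ln (gauss_exp v (\<lambda>y. exp (k * Y y)) x) / k)" for k
    using parisi_step_add_const[OF Y v(1), of k "f x" x] by (simp add: parisi_step_eq Y_def)
  let ?\<delta> = "m' - m"
  have lnd: "ln (gauss_exp v (\<lambda>y. exp (m' * Y y)) x) = ln w + ln (Q (\<lambda>y. exp (?\<delta> * Y y)))"
    using R(3)[of ?\<delta>] m w unfolding Qexp[of ?\<delta>] by (simp add: ln_div zero_less_divide_iff)
  have d: "\<bar>?\<delta>\<bar> \<le> 1" "\<bar>- m\<bar> \<le> 1" using m by auto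
  have "parisi_step m v f x \<le> parisi_step m' v f x \<and>
    parisi_step m' v f x \<le> parisi_step m v f x + ?\<delta> * A"
  proof (cases "m = m'")
    case True then show ?thesis by simp
  next
    case False
    then have m': "0 < m'" "0 < ?\<delta>" using m by auto
    show ?thesis
    proof (cases "m = 0")
      case True
      have w1: "w = 1" by (simp add: w_def True gauss_exp_const)
      have QY: "Q Y = gauss_exp v Y x" by (simp add: Q_def w1 True)
      have "parisi_step m' v f x - parisi_step m v f x = (ln (Q (\<lambda>y. exp (?\<delta> * Y y))) - m' * Q Y) / m'"
        unfolding step using m' True lnd w1 QY by (simp add: field_simps)
      moreover have "0 \<le> ln (Q (\<lambda>y. exp (?\<delta> * Y y))) - m' * Q Y" "ln (Q (\<lambda>y. exp (?\<delta> * Y y))) - m' * Q Y \<le> m' * (m' * A)"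
        using R(1,2)[OF d(1)] True by (auto simp: power2_eq_square mult_ac)
      ultimately have "0 \<le> parisi_step m' v f x - parisi_step m v f x"
          "parisi_step m' v f x - parisi_step m v f x \<le> m' * (m' * A) / m'"
        using m' by (simp_all only: divide_right_mono divide_nonneg_pos less_imp_le)
      then show ?thesis using m' True by simp
    next
      case False
      then have mp: "0 < m" using m by simp
      \<comment> \<open>Tilting back by \<open>- m\<close> returns to the original law, so the
        average is \<open>1 / w\<close>. This is how two-sided bounds on the logarithm in the first
        step are obtained from \<open>R\<close>.\<close>
      have "ln (Q (\<lambda>y. exp (- m * Y y))) = - ln w"
        unfolding Qexp[of "- m"] using w by (simp add: gauss_exp_const ln_div)
      then have lw: "m * Q Y - m\<^sup>2 * A \<le> ln w" "ln w \<le> m * Q Y"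
        using R(1,2)[OF d(2)] by auto
      \<comment> \<open>Over the common denominator \<open>m * m'\<close> the linear terms
        \<open>m * ?\<delta> * Q Y\<close> cancel. What remains is \<open>m * ?\<delta>^2 * A +
        ?\<delta> * m^2 * A = m * m' * ?\<delta> * A\<close>, so that the division leaves no
        singularity as \<open>m\<close> tends to 0.\<close>
      define D where "D = m * ln (Q (\<lambda>y. exp (?\<delta> * Y y))) - ?\<delta> * ln w"
      have eq: "parisi_step m' v f x - parisi_step m v f x = D / (m * m')"
        unfolding step D_def using mp m' lnd by (simp add: field_simps w_def[symmetric])
      have "m * (?\<delta> * Q Y) \<le> m * ln (Q (\<lambda>y. exp (?\<delta> * Y y)))"
        using R(1)[OF d(1)] mp by (intro mult_left_mono) auto
      moreover have "m * ln (Q (\<lambda>y. exp (?\<delta> * Y y))) \<le> m * (?\<delta> * Q Y + ?\<delta>\<^sup>2 * A)"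
        using R(2)[OF d(1)] mp by (intro mult_left_mono) auto
      moreover have "?\<delta> * ln w \<le> ?\<delta> * (m * Q Y)" "?\<delta> * (m * Q Y - m\<^sup>2 * A) \<le> ?\<delta> * ln w"
        using lw m' by (auto intro!: mult_left_mono)
      ultimately have "0 \<le> D" "D \<le> m * (?\<delta> * Q Y + ?\<delta>\<^sup>2 * A) - ?\<delta> * (m * Q Y - m\<^sup>2 * A)"
        unfolding D_def by (auto simp: mult_ac)
      moreover have "m * (?\<delta> * Q Y + ?\<delta>\<^sup>2 * A) - ?\<delta> * (m * Q Y - m\<^sup>2 * A) = (m * m') * (?\<delta> * A)"
        by (simp add: algebra_simps power2_eq_square)
      ultimately have "0 \<le> D / (m * m')" "D / (m * m') \<le> ?\<delta> * A"
        using mp m' by (auto simp: field_simps)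
      with eq show ?thesis by linarith
    qed
  qed
  then show "parisi_step m v f x \<le> parisi_step m' v f x"
    "parisi_step m' v f x \<le> parisi_step m v f x + (m' - m) * (step_const V * v)"
    unfolding A_def by auto
qed

lemma parisi_step_lipschitz_parameter:
  assumes "nonexpansive f" "0 \<le> v" "v \<le> V" "0 \<le> m" "m \<le> 1" "0 \<le> m'" "m' \<le> 1"
  shows "\<bar>parisi_step m v f x - parisi_step m' v f x\<bar> \<le> \<bar>m - m'\<bar> * (step_const V * v)"
proof (cases "m \<le> m'")
  case True
  then show ?thesis
    using parisi_step_mono_parameter[OF assms(1-4) True assms(7), of x] by (simp add: abs_le_iff)
next
  case False
  then have "m' \<le> m" by simp
  then show ?thesis
    using parisi_step_mono_parameter[OF assms(1-3,6) _ assms(5), of x] by (simp add: abs_le_iff)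
qed

section \<open>Expansion of a step for small variance\<close>

lemma taylor_remainder_bound:
  assumes "smooth f" "\<And>y. \<bar>(deriv ^^ n) f y\<bar> \<le> B" "0 < n"
  shows "\<bar>f (x + h) - (\<Sum>i<n. (deriv ^^ i) f x / fact i * h ^ i)\<bar> \<le> B * \<bar>h\<bar> ^ n"
proof (cases "h = 0")
  case True
  have "(\<Sum>i<n. (deriv ^^ i) f x / fact i * 0 ^ i) = f x"
    using assms(3) by (cases n) (simp_all add: sum.lessThan_Suc_shift del: sum.lessThan_Suc)
  with True assms(3) show ?thesis by (simp add: power_0_left)
next
  case False
  have "\<exists>t. (if x + h < x then x + h < t \<and> t < x else x < t \<and> t < x + h) \<and>
      f (x + h) = (\<Sum>i<n. (deriv ^^ i) f x / fact i * (x + h - x) ^ i) + (deriv ^^ n) f t / fact n * (x + h - x) ^ n"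
    by (rule Taylor[where a = "min x (x + h)" and b = "max x (x + h)"])
      (use False assms smoothD in \<open>auto simp del: funpow.simps\<close>)
  then obtain t where t: "f (x + h) = (\<Sum>i<n. (deriv ^^ i) f x / fact i * h ^ i) + (deriv ^^ n) f t / fact n * h ^ n"
    by auto
  have "\<bar>(deriv ^^ n) f t\<bar> / fact n \<le> B / 1"
    using assms(2)[of t] by (intro frac_le) (auto intro: order.trans[OF abs_ge_zero])
  then have "\<bar>(deriv ^^ n) f t\<bar> / fact n * \<bar>h\<bar> ^ n \<le> B * \<bar>h\<bar> ^ n"
    by (intro mult_right_mono) auto
  then have "\<bar>(deriv ^^ n) f t / fact n * h ^ n\<bar> \<le> B * \<bar>h\<bar> ^ n"
    by (simp only: abs_mult abs_divide power_abs abs_of_pos[OF fact_gt_zero])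
  with t show ?thesis by simp
qed

lemma
  shows integrable_normal01_power: "integrable normal01 (\<lambda>z. z ^ k)"
    and integral_normal01_id: "(LINT z|normal01. z) = 0"
    and integral_normal01_square: "(LINT z|normal01. z\<^sup>2) = 1"
  using integrable_std_normal_distribution_moment[of k]
    integral_std_normal_distribution_moment_odd[of 1] std_normal_distribution_even_moments(1)[of 1]
  by auto

text \<open>The linear Taylor term has mean 0, which is why the error is of order \<open>v\<close>
  and not \<open>sqrt v\<close>. The factor \<open>gmgf 2\<close> comes from estimating the square
  of \<open>z\<close> by \<open>exp (2 * \<bar>z\<bar>)\<close>.\<close>

lemma gauss_exp_close:
  assumes f: "nonexpansive f" "smooth_bounded K f" and v: "0 \<le> v"
  shows "\<bar>gauss_exp v f x - f x\<bar> \<le> K 1 * gmgf 2 * v"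
proof -
  have sm: "smooth f" by (rule smooth_bounded_smooth[OF f(2)])
  have K: "0 \<le> K 1" by (rule smooth_bounded_nonneg[OF f(2)])
  note int = exp_growth_integrable[OF nonexpansive_exp_growth[OF f(1)] v]
  have pw: "\<bar>f (x + z * sqrt v) - (f x + deriv f x * sqrt v * z)\<bar> \<le> K 1 * v * exp (2 * \<bar>z\<bar>)" for z
  proof -
    have K1: "\<bar>(deriv ^^ 2) f y\<bar> \<le> K 1" for y
      using smooth_bounded_le[OF f(2), of 1 y] by (simp add: numeral_2_eq_2)
    have "\<bar>f (x + z * sqrt v) - (\<Sum>i<2. (deriv ^^ i) f x / fact i * (z * sqrt v) ^ i)\<bar> \<le> K 1 * \<bar>z * sqrt v\<bar> ^ 2"
      by (rule taylor_remainder_bound[OF sm K1]) simp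
    also have "\<dots> = K 1 * v * \<bar>z\<bar> ^ 2" using v by (simp add: power_mult_distrib abs_mult mult_ac)
    also have "\<dots> \<le> K 1 * v * exp (2 * \<bar>z\<bar>)"
      using power_abs_le_exp[of z 2] K v by (intro mult_left_mono) auto
    finally show ?thesis by (simp add: numeral_2_eq_2 mult_ac)
  qed
  have id: "integrable normal01 (\<lambda>z. deriv f x * sqrt v * z)"
    using integrable_normal01_power[of 1] by (intro integrable_mult_right) simp
  have i1: "integrable normal01 (\<lambda>z. f x + deriv f x * sqrt v * z)"
    by (rule Bochner_Integration.integrable_add[OF _ id]) simp
  have "(LINT z|normal01. f x + deriv f x * sqrt v * z) = f x"
    by (subst Bochner_Integration.integral_add[OF _ id]) (simp_all add: integral_normal01_id)
  then have "gauss_exp v f x - f x = (LINT z|normal01. f (x + z * sqrt v) - (f x + deriv f x * sqrt v * z))"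
    unfolding gauss_exp_def by (subst Bochner_Integration.integral_diff[OF int i1]) simp
  then have "\<bar>gauss_exp v f x - f x\<bar> \<le> (LINT z|normal01. \<bar>f (x + z * sqrt v) - (f x + deriv f x * sqrt v * z)\<bar>)"
    by (simp add: integral_abs_bound)
  also have "\<dots> \<le> (LINT z|normal01. K 1 * v * exp (2 * \<bar>z\<bar>))"
    by (rule integral_mono[OF integrable_abs[OF Bochner_Integration.integrable_diff[OF int i1]]
          integrable_mult_right[OF integrable_normal01_exp_abs] pw])
  also have "\<dots> = K 1 * gmgf 2 * v" by (simp add: gmgf_def)
  finally show ?thesis .
qed

text \<open>The mass is first moved to 0, at the cost of \<open>step_const V * v\<close>; the
  remaining step is a plain Gaussian average.\<close>

lemma parisi_step_close:
  assumes f: "nonexpansive f" "smooth_bounded K f" and v: "0 \<le> v" "v \<le> V" and m: "0 \<le> m" "m \<le> 1"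
  shows "\<bar>parisi_step m v f x - f x\<bar> \<le> (K 1 * gmgf 2 + step_const V) * v"
proof -
  have "\<bar>parisi_step m v f x - parisi_step 0 v f x\<bar> \<le> \<bar>m - 0\<bar> * (step_const V * v)"
    using assms by (intro parisi_step_lipschitz_parameter) auto
  also have "\<dots> \<le> 1 * (step_const V * v)"
    using m v step_const_nonneg by (intro mult_right_mono) auto
  finally have "\<bar>parisi_step m v f x - gauss_exp v f x\<bar> \<le> step_const V * v"
    by (simp add: parisi_step_eq)
  with gauss_exp_close[OF f v(1), of x] show ?thesis unfolding distrib_right by linarith
qed

lemma exp_taylor2: "\<bar>exp r - (1 + r + r\<^sup>2 / 2)\<bar> \<le> \<bar>r\<bar> ^ 3 * exp \<bar>r\<bar>" for r :: real
proof -
  obtain t where t: "\<bar>t\<bar> \<le> \<bar>r\<bar>" "exp r = (\<Sum>m<3. r ^ m / fact m) + exp t / fact 3 * r ^ 3"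
    using Maclaurin_exp_le[of r 3] by blast
  have "exp t / fact 3 \<le> exp \<bar>r\<bar> / 1"
    using t(1) by (intro frac_le) (auto simp: fact_numeral)
  then have "\<bar>exp t / fact 3 * r ^ 3\<bar> \<le> exp \<bar>r\<bar> * \<bar>r\<bar> ^ 3"
    unfolding abs_mult power_abs by (intro mult_right_mono) auto
  moreover have "exp r - (1 + r + r\<^sup>2 / 2) = exp t / fact 3 * r ^ 3"
    using t(2) by (simp add: numeral_3_eq_3 numeral_2_eq_2)
  ultimately show ?thesis by (simp only: mult.commute)
qed

text \<open>The bracket is the nonlinearity of the Parisi equation. \<open>C\<close> and
  \<open>v0\<close> depend on \<open>K\<close> only, so the remainder is uniform in
  \<open>f\<close>, \<open>x\<close> and in particular in \<open>m\<close>; for this the error of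
  the exponential average must carry a factor \<open>m\<close> before its logarithm is divided by
  \<open>m\<close>.\<close>

lemma parisi_step_expansion:
  fixes K :: "nat \<Rightarrow> real"
  shows "\<exists>C v0. 0 < v0 \<and>
    (\<forall>f m x v. nonexpansive f \<and> smooth_bounded K f \<and> 0 \<le> m \<and> m \<le> 1 \<and> 0 \<le> v \<and> v \<le> v0 \<longrightarrow>
      \<bar>parisi_step m v f x - f x - v / 2 * ((deriv ^^ 2) f x + m * (deriv f x)\<^sup>2)\<bar> \<le> C * v * sqrt v)"
proof -
  \<comment> \<open>The summands 1, \<open>K 1\<close> and \<open>K 2\<close> correspond to three
    errors: the Taylor remainder of \<open>exp\<close>, replacing the square of the increment by
    that of its linear part, and the Taylor remainder of \<open>f\<close>. In \<open>gmgf 4\<close>,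
    three units absorb a cube and one the exponential. \<open>C2\<close> will bound
    \<open>\<bar>a\<bar> / (m * v)\<close>, and \<open>v0\<close> forces
    \<open>\<bar>a\<bar> \<le> 1 / 2\<close>, where the logarithm can be expanded.\<close>
  define C1 where "C1 = (1 + \<bar>K 1\<bar> + \<bar>K 2\<bar>) * gmgf 4"
  define C2 where "C2 = \<bar>K 1\<bar> + 1 + C1"
  define v0 where "v0 = min 1 (1 / (2 * C2))"
  have C1: "0 \<le> C1" unfolding C1_def by (intro mult_nonneg_nonneg gmgf_nonneg) auto
  have C2: "1 \<le> C2" using C1 by (simp add: C2_def)
  have v0: "0 < v0" "v0 \<le> 1" "C2 * v0 \<le> 1 / 2"
    using C2 by (auto simp: v0_def min_def field_simps)
  have "\<bar>parisi_step m v f x - f x - v / 2 * ((deriv ^^ 2) f x + m * (deriv f x)\<^sup>2)\<bar> \<le> (C1 + 2 * C2\<^sup>2) * v * sqrt v"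
    if f: "nonexpansive f" "smooth_bounded K f" and m: "0 \<le> m" "m \<le> 1" and v: "0 \<le> v" "v \<le> v0" for f m x v
  proof -
    have sm: "smooth f" by (rule smooth_bounded_smooth[OF f(2)])
    have v1: "v \<le> 1" "sqrt v \<le> 1" using v v0 by auto
    define d1 d2 where "d1 = deriv f x" and "d2 = (deriv ^^ 2) f x"
    have d1: "\<bar>d1\<bar> \<le> 1"
      unfolding d1_def by (rule nonexpansive_deriv[OF f(1) smoothD0[OF sm]])
    have K1: "\<bar>(deriv ^^ 2) f y\<bar> \<le> K 1" for y
      using smooth_bounded_le[OF f(2), of 1 y] by (simp add: numeral_2_eq_2)
    have K2: "\<bar>(deriv ^^ 3) f y\<bar> \<le> K 2" for y
      using smooth_bounded_le[OF f(2), of 2 y] by (simp add: numeral_2_eq_2 numeral_3_eq_3)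
    have K0: "0 \<le> K 1" "0 \<le> K 2"
      by (rule smooth_bounded_nonneg[OF f(2)])+
    define Y where "Y z = f (x + z * sqrt v) - f x" for z
    define J where "J z = (1 + K 1 + K 2) * (v * sqrt v) * exp (4 * \<bar>z\<bar>)" for z
    have Y1: "\<bar>Y z\<bar> \<le> \<bar>z * sqrt v\<bar>" for z
      using nonexpansiveD[OF f(1), of "x + z * sqrt v" x] by (simp add: Y_def)
    have Y2: "\<bar>Y z - d1 * (z * sqrt v)\<bar> \<le> K 1 * \<bar>z * sqrt v\<bar> ^ 2" for z
      using taylor_remainder_bound[OF sm K1, of x "z * sqrt v"] by (simp add: Y_def d1_def numeral_2_eq_2 algebra_simps)
    have Y3: "\<bar>Y z - (d1 * (z * sqrt v) + d2 / 2 * (z * sqrt v)\<^sup>2)\<bar> \<le> K 2 * \<bar>z * sqrt v\<bar> ^ 3" for z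
    proof -
      have "(\<Sum>i<3. (deriv ^^ i) f x / fact i * (z * sqrt v) ^ i) = f x + d1 * (z * sqrt v) + d2 / 2 * (z * sqrt v)\<^sup>2"
        by (simp add: d1_def d2_def eval_nat_numeral)
      with taylor_remainder_bound[OF sm K2, of x "z * sqrt v"] show ?thesis
        by (simp add: Y_def algebra_simps)
    qed
    have cube: "\<bar>z * sqrt v\<bar> ^ 3 * exp \<bar>z * sqrt v\<bar> \<le> (v * sqrt v) * exp (4 * \<bar>z\<bar>)" for z
    proof -
      have "\<bar>z * sqrt v\<bar> \<le> \<bar>z\<bar> * 1"
        using v v1 unfolding abs_mult by (intro mult_left_mono) auto
      then have e: "exp \<bar>z * sqrt v\<bar> \<le> exp \<bar>z\<bar>" by simp
      have "\<bar>z * sqrt v\<bar> ^ 3 = (v * sqrt v) * \<bar>z\<bar> ^ 3"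
      proof -
        have "\<bar>z * sqrt v\<bar> ^ 3 = (sqrt v) ^ 3 * \<bar>z\<bar> ^ 3"
          using v by (simp add: abs_mult power_mult_distrib)
        also have "(sqrt v) ^ 3 = v * sqrt v"
          using v by (simp add: power3_eq_cube)
        finally show ?thesis .
      qed
      also have "\<dots> \<le> (v * sqrt v) * exp (3 * \<bar>z\<bar>)"
        using power_abs_le_exp[of z 3] v by (intro mult_left_mono) auto
      finally have "\<bar>z * sqrt v\<bar> ^ 3 * exp \<bar>z * sqrt v\<bar> \<le> (v * sqrt v) * exp (3 * \<bar>z\<bar>) * exp \<bar>z\<bar>"
        using v by (intro mult_mono e) auto
      also have "\<dots> = (v * sqrt v) * exp (4 * \<bar>z\<bar>)"
        by (simp add: mult.assoc exp_add[symmetric])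
      finally show ?thesis .
    qed
    have cube': "\<bar>z * sqrt v\<bar> ^ 3 \<le> (v * sqrt v) * exp (4 * \<bar>z\<bar>)" for z
      by (rule order.trans[OF _ cube]) (simp add: mult_le_cancel_left1)
    have i2: "integrable normal01 (\<lambda>z. a * (z * sqrt v) + b * (z * sqrt v)\<^sup>2)" for a b
    proof (rule Bochner_Integration.integrable_add)
      show "integrable normal01 (\<lambda>z. a * (z * sqrt v))"
        using integrable_normal01_power[of 1] by simp
      show "integrable normal01 (\<lambda>z. b * (z * sqrt v)\<^sup>2)"
        using integrable_normal01_power[of 2] by (simp add: power_mult_distrib)
    qed
    have int2: "(LINT z|normal01. a * (z * sqrt v) + b * (z * sqrt v)\<^sup>2) = b * v" for a b
    proof (subst Bochner_Integration.integral_add)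
      show "integrable normal01 (\<lambda>z. a * (z * sqrt v))"
        using integrable_normal01_power[of 1] by simp
      show "integrable normal01 (\<lambda>z. b * (z * sqrt v)\<^sup>2)"
        using integrable_normal01_power[of 2] by (simp add: power_mult_distrib)
      show "(LINT z|normal01. a * (z * sqrt v)) + (LINT z|normal01. b * (z * sqrt v)\<^sup>2) = b * v"
        using v by (simp add: power_mult_distrib integral_normal01_id integral_normal01_square)
    qed
    have iJ: "integrable normal01 J"
      unfolding J_def by (intro integrable_mult_right integrable_normal01_exp_abs)
    have intJ: "(LINT z|normal01. J z) = C1 * (v * sqrt v)"
      using K0 by (simp add: J_def gmgf_def C1_def)
    \<comment> \<open>Any integrand within \<open>c * J\<close> of a quadratic polynomial in
      \<open>z * sqrt v\<close> has mean \<open>b * v\<close> up to order \<open>v * sqrt v\<close>,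
      whatever the linear coefficient is.\<close>
    have E: "\<bar>(LINT z|normal01. g z) - b * v\<bar> \<le> c * (C1 * (v * sqrt v))"
      if g: "integrable normal01 g" and le: "\<And>z. \<bar>g z - (a * (z * sqrt v) + b * (z * sqrt v)\<^sup>2)\<bar> \<le> c * J z" for g a b c
    proof -
      have "(LINT z|normal01. g z) - b * v = (LINT z|normal01. g z - (a * (z * sqrt v) + b * (z * sqrt v)\<^sup>2))"
        by (subst Bochner_Integration.integral_diff[OF g i2]) (simp add: int2)
      then have "\<bar>(LINT z|normal01. g z) - b * v\<bar> \<le> (LINT z|normal01. \<bar>g z - (a * (z * sqrt v) + b * (z * sqrt v)\<^sup>2)\<bar>)"
        by (simp add: integral_abs_bound)
      also have "\<dots> \<le> (LINT z|normal01. c * J z)"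
        by (rule integral_mono[OF integrable_abs[OF Bochner_Integration.integrable_diff[OF g i2]] integrable_mult_right[OF iJ] le])
      finally show ?thesis by (simp add: intJ)
    qed
    have nY: "nonexpansive (\<lambda>y. f y - f x)" using f(1) by (simp add: nonexpansive_def)
    have iY: "integrable normal01 Y"
      unfolding Y_def by (rule exp_growth_integrable[OF nonexpansive_exp_growth[OF nY] v(1)])
    have ieY: "integrable normal01 (\<lambda>z. exp (m * Y z))"
      unfolding Y_def by (rule exp_growth_integrable[OF nonexpansive_exp_growth_exp[OF nY] v(1)])
    have step: "parisi_step m v f x - f x = (if m = 0 then LINT z|normal01. Y z else ln (LINT z|normal01. exp (m * Y z)) / m)"
      using parisi_step_add_const[OF nY v(1), of m "f x" x] by (simp add: parisi_step_def Y_def)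
    show ?thesis
    proof (cases "m = 0")
      case True
      have "\<bar>(LINT z|normal01. Y z) - d2 / 2 * v\<bar> \<le> 1 * (C1 * (v * sqrt v))"
      proof (rule E[OF iY])
        fix z
        have "\<bar>Y z - (d1 * (z * sqrt v) + d2 / 2 * (z * sqrt v)\<^sup>2)\<bar> \<le> K 2 * ((v * sqrt v) * exp (4 * \<bar>z\<bar>))"
          by (rule order.trans[OF Y3 mult_left_mono[OF cube' K0(2)]])
        also have "\<dots> \<le> (1 + K 1 + K 2) * ((v * sqrt v) * exp (4 * \<bar>z\<bar>))"
          using K0 v by (intro mult_right_mono) auto
        finally show "\<bar>Y z - (d1 * (z * sqrt v) + d2 / 2 * (z * sqrt v)\<^sup>2)\<bar> \<le> 1 * J z"
          by (simp add: J_def mult.assoc)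
      qed
      also have "\<dots> \<le> (C1 + 2 * C2\<^sup>2) * v * sqrt v"
        using v by (simp add: mult.assoc distrib_right)
      finally show ?thesis
        unfolding step using True by (simp add: d2_def mult.commute)
    next
      case False
      then have mp: "0 < m" using m by simp
      define G where "G = d2 + m * d1\<^sup>2"
      define a where "a = (LINT z|normal01. exp (m * Y z)) - 1"
      \<comment> \<open>Since \<open>m \<le> 1\<close>, powers of \<open>m\<close> are reduced to a
        single factor \<open>m\<close>, which each of the three errors keeps.\<close>
      have pw: "\<bar>exp (m * Y z) - 1 - (m * d1 * (z * sqrt v) + m * G / 2 * (z * sqrt v)\<^sup>2)\<bar> \<le> m * J z" for z
      proof -
        define s where "s = z * sqrt v"
        have mY: "\<bar>m * Y z\<bar> \<le> m * \<bar>s\<bar>" "\<bar>m * Y z\<bar> \<le> \<bar>s\<bar>"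
          using Y1[of z] mp m mult_mono[of m 1 "\<bar>Y z\<bar>" "\<bar>s\<bar>"] by (auto simp: abs_mult s_def)
        have "\<bar>m * Y z\<bar> ^ 3 * exp \<bar>m * Y z\<bar> \<le> (m * \<bar>s\<bar>) ^ 3 * exp \<bar>s\<bar>"
          by (intro mult_mono power_mono mY) (use mY mp in auto)
        also have "\<dots> = m ^ 3 * (\<bar>s\<bar> ^ 3 * exp \<bar>s\<bar>)" by (simp add: power_mult_distrib)
        also have "\<dots> \<le> m * (\<bar>s\<bar> ^ 3 * exp \<bar>s\<bar>)"
          using power_decreasing[of 1 3 m] m by (intro mult_right_mono) auto
        finally have 1: "\<bar>exp (m * Y z) - (1 + m * Y z + (m * Y z)\<^sup>2 / 2)\<bar> \<le> m * (\<bar>s\<bar> ^ 3 * exp \<bar>s\<bar>)"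
          using exp_taylor2[of "m * Y z"] by linarith
        have 2: "\<bar>m * (Y z - (d1 * s + d2 / 2 * s\<^sup>2))\<bar> \<le> m * (K 2 * \<bar>s\<bar> ^ 3)"
          using Y3[of z] mp by (simp add: abs_mult s_def)
        have "\<bar>d1 * s\<bar> \<le> 1 * \<bar>s\<bar>" using d1 unfolding abs_mult by (intro mult_right_mono) auto
        then have "\<bar>Y z + d1 * s\<bar> \<le> 2 * \<bar>s\<bar>" using Y1[of z] unfolding s_def by linarith
        then have "\<bar>Y z - d1 * s\<bar> * \<bar>Y z + d1 * s\<bar> \<le> (K 1 * \<bar>s\<bar> ^ 2) * (2 * \<bar>s\<bar>)"
          using Y2[of z] K0 unfolding s_def by (intro mult_mono) auto
        moreover have "(Y z)\<^sup>2 - (d1 * s)\<^sup>2 = (Y z - d1 * s) * (Y z + d1 * s)"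
          by (simp add: power2_eq_square algebra_simps)
        moreover have "(K 1 * \<bar>s\<bar> ^ 2) * (2 * \<bar>s\<bar>) = 2 * (K 1 * \<bar>s\<bar> ^ 3)"
          by (simp only: power2_eq_square power3_eq_cube mult_ac)
        ultimately have "\<bar>(Y z)\<^sup>2 - (d1 * s)\<^sup>2\<bar> \<le> 2 * (K 1 * \<bar>s\<bar> ^ 3)"
          by (simp only: abs_mult)
        then have "m\<^sup>2 / 2 * \<bar>(Y z)\<^sup>2 - (d1 * s)\<^sup>2\<bar> \<le> m\<^sup>2 / 2 * (2 * (K 1 * \<bar>s\<bar> ^ 3))"
          by (intro mult_left_mono) auto
        also have "\<dots> \<le> m * (K 1 * \<bar>s\<bar> ^ 3)"
          using K0 m power_decreasing[of 1 2 m] by (simp add: mult_right_mono)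
        finally have 3: "\<bar>m\<^sup>2 / 2 * ((Y z)\<^sup>2 - (d1 * s)\<^sup>2)\<bar> \<le> m * (K 1 * \<bar>s\<bar> ^ 3)"
          by (simp add: abs_mult)
        have eq: "exp (m * Y z) - 1 - (m * d1 * s + m * G / 2 * s\<^sup>2) =
          (exp (m * Y z) - (1 + m * Y z + (m * Y z)\<^sup>2 / 2)) + m * (Y z - (d1 * s + d2 / 2 * s\<^sup>2)) +
            m\<^sup>2 / 2 * ((Y z)\<^sup>2 - (d1 * s)\<^sup>2)"
          by (simp add: G_def power2_eq_square field_simps)
        have "\<bar>exp (m * Y z) - 1 - (m * d1 * s + m * G / 2 * s\<^sup>2)\<bar> \<le>
            m * (\<bar>s\<bar> ^ 3 * exp \<bar>s\<bar>) + m * (K 2 * \<bar>s\<bar> ^ 3) + m * (K 1 * \<bar>s\<bar> ^ 3)"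
          unfolding eq using 1 2 3 by linarith
        also have "\<dots> \<le> m * ((v * sqrt v) * exp (4 * \<bar>z\<bar>)) + m * (K 2 * ((v * sqrt v) * exp (4 * \<bar>z\<bar>))) +
            m * (K 1 * ((v * sqrt v) * exp (4 * \<bar>z\<bar>)))"
          unfolding s_def by (intro add_mono mult_left_mono cube cube' K0 m)
        also have "\<dots> = m * J z" by (simp add: J_def algebra_simps)
        finally show ?thesis by (simp add: s_def)
      qed
      have ig: "integrable normal01 (\<lambda>z. exp (m * Y z) - 1)"
        using ieY by (rule Bochner_Integration.integrable_diff) simp
      have "a = (LINT z|normal01. exp (m * Y z) - 1)"
        unfolding a_def by (subst Bochner_Integration.integral_diff[OF ieY]) simp_all
      then have a: "\<bar>a - m * G / 2 * v\<bar> \<le> m * (C1 * (v * sqrt v))"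
        using E[OF ig pw] by simp
      have "\<bar>G\<bar> \<le> K 1 + 1"
      proof -
        have "m * d1\<^sup>2 \<le> 1 * 1" using d1 m by (intro mult_mono) (auto simp: abs_square_le_1)
        moreover have "0 \<le> m * d1\<^sup>2" using m by simp
        ultimately show ?thesis using K1[of x] unfolding G_def d2_def by linarith
      qed
      then have "(m * v) * \<bar>G / 2\<bar> \<le> (m * v) * (K 1 + 1)"
        using mp v by (intro mult_left_mono) auto
      moreover have "\<bar>m * G / 2 * v\<bar> = (m * v) * \<bar>G / 2\<bar>"
        using mp v by (simp add: abs_mult)
      ultimately have "\<bar>m * G / 2 * v\<bar> \<le> m * v * (K 1 + 1)" by simp
      moreover have "m * (C1 * (v * sqrt v)) \<le> m * (C1 * (v * 1))"
        using mp C1 v v1 by (intro mult_left_mono) auto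
      ultimately have aC: "\<bar>a\<bar> \<le> m * v * C2"
        using a K0 unfolding C2_def by (simp add: algebra_simps)
      have "m * (v * C2) \<le> 1 * (v0 * C2)"
        using m v C2 v0 by (intro mult_mono) auto
      then have "\<bar>a\<bar> \<le> 1 / 2" using aC v0(3) by (simp add: mult_ac)
      then have "\<bar>ln (1 + a) - a\<bar> \<le> 2 * a\<^sup>2"
        by (rule abs_ln_one_plus_x_minus_x_bound)
      \<comment> \<open>From \<open>aC\<close> the square carries the square of
        \<open>m * v\<close>; one factor \<open>m\<close> is kept for the division and
        \<open>v * v\<close> is relaxed to \<open>v * sqrt v\<close>.\<close>
      moreover have "a\<^sup>2 \<le> m * (C2\<^sup>2 * (v * sqrt v))"
      proof -
        have "a\<^sup>2 \<le> (m * v * C2)\<^sup>2"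
          using power_mono[OF aC abs_ge_zero, of 2] by simp
        also have "\<dots> = (m * m) * (C2\<^sup>2 * (v * v))" by (simp add: power2_eq_square)
        also have "\<dots> \<le> (m * 1) * (C2\<^sup>2 * (v * sqrt v))"
        proof (intro mult_mono)
          have "sqrt v * sqrt v \<le> sqrt v * 1" using v v1 by (intro mult_left_mono) auto
          then show "v \<le> sqrt v" using v by simp
        qed (use m v in auto)
        finally show ?thesis by simp
      qed
      ultimately have l: "\<bar>ln (1 + a) - a\<bar> \<le> m * (2 * C2\<^sup>2 * (v * sqrt v))" by simp
      have "\<bar>ln (1 + a) - m * G / 2 * v\<bar> \<le> m * ((C1 + 2 * C2\<^sup>2) * v * sqrt v)"
        using a l by (simp add: algebra_simps)
      then have "\<bar>ln (1 + a) - m * G / 2 * v\<bar> / m \<le> (C1 + 2 * C2\<^sup>2) * v * sqrt v"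
        using mp by (simp add: divide_le_eq mult_ac)
      moreover have "\<bar>ln (1 + a) - m * G / 2 * v\<bar> / m = \<bar>ln (1 + a) / m - v / 2 * G\<bar>"
      proof -
        have "ln (1 + a) / m - v / 2 * G = (ln (1 + a) - m * G / 2 * v) / m"
          using mp by (simp add: field_simps)
        then show ?thesis using mp by (simp add: abs_divide)
      qed
      ultimately show ?thesis
        unfolding step using False by (simp add: a_def G_def d1_def d2_def)
    qed
  qed
  with v0(1) show ?thesis by blast
qed

subsection \<open>Discrete measures\<close>

text \<open>\<open>d2\<close> is the second derivative of \<xi>. \<open>L\<close> bounds at once the
  rate at which variance accumulates and the total variance, since the time interval has length
  1.\<close>

locale parisi_covariance =
  fixes \<beta> :: "nat \<Rightarrow> real" and d2 :: "real \<Rightarrow> real" and L :: real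
  assumes DERIV_dxi: "u \<in> {0..1} \<Longrightarrow> (dxi \<beta> has_real_derivative d2 u) (at u)"
    and d2_continuous: "continuous_on {0..1} d2"
    and d2_nonneg: "u \<in> {0..1} \<Longrightarrow> 0 \<le> d2 u"
    and d2_le: "u \<in> {0..1} \<Longrightarrow> d2 u \<le> L"
    and dxi_0: "dxi \<beta> 0 = 0"

text \<open>Convergence at 2 gives a power series on a neighbourhood of [0,1], so termwise
  differentiation yields two-sided derivatives at both end points. The coefficients are nonnegative,
  and the first derivative vanishes at 0 because the series starts with the square.\<close>

lemma parisi_covariance_exists:
  assumes "(\<lambda>p. 2 ^ p * (\<beta> p)\<^sup>2) summable_on {2..}"
  shows "\<exists>d2 L. parisi_covariance \<beta> d2 L"
proof -
  define c where "c p = (if p \<ge> 2 then (\<beta> p)\<^sup>2 else 0)" for p :: nat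
  have "(\<lambda>p. 2 ^ p * (\<beta> p)\<^sup>2) summable_on {2..} \<longleftrightarrow> (\<lambda>p. c p * 2 ^ p) summable_on UNIV"
    by (rule summable_on_cong_neutral) (auto simp: c_def)
  with assms have s2: "summable (\<lambda>p. c p * 2 ^ p)"
    using summable_on_imp_summable by blast
  have sm: "summable (\<lambda>p. c p * u ^ p)" if "\<bar>u\<bar> < 2" for u :: real
    by (rule powser_inside[OF s2]) (use that in simp)
  have sm1: "summable (\<lambda>p. diffs c p * u ^ p)" if "\<bar>u\<bar> < 2" for u :: real
    using termdiff_converges[of u 2 c] that sm by auto
  have sm2: "summable (\<lambda>p. diffs (diffs c) p * u ^ p)" if "\<bar>u\<bar> < 2" for u :: real
    using termdiff_converges[of u 2 "diffs c"] that sm1 by auto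
  \<comment> \<open>\<open>xi\<close> is an unordered sum; absolute convergence strictly inside the
    radius identifies it with \<open>suminf\<close>, to which termwise differentiation
    applies.\<close>
  have xi: "xi \<beta> u = (suminf (\<lambda>p. c p * u ^ p))" if u: "\<bar>u\<bar> < 2" for u
  proof -
    have "summable (\<lambda>p. norm (c p * u ^ p))"
      by (rule powser_insidea[OF s2]) (use u in simp)
    then have "((\<lambda>p. c p * u ^ p) has_sum (suminf (\<lambda>p. c p * u ^ p))) UNIV"
      by (rule norm_summable_imp_has_sum) (use sm[OF u] in \<open>simp add: summable_sums\<close>)
    then have "infsum (\<lambda>p. c p * u ^ p) UNIV = (suminf (\<lambda>p. c p * u ^ p))" by (rule infsumI)
    moreover have "xi \<beta> u = infsum (\<lambda>p. c p * u ^ p) UNIV"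
      unfolding xi_def by (rule infsum_cong_neutral) (auto simp: c_def)
    ultimately show ?thesis by simp
  qed
  have near: "\<forall>\<^sub>F w in nhds u. \<bar>w\<bar> < 2" if "\<bar>u\<bar> < 2" for u :: real
  proof -
    have "\<forall>\<^sub>F w in nhds u. w \<in> {-2<..<2}"
      by (rule eventually_nhds_in_open) (use that in auto)
    then show ?thesis by eventually_elim auto
  qed
  have dxi: "dxi \<beta> u = (suminf (\<lambda>p. diffs c p * u ^ p))" if u: "\<bar>u\<bar> < 2" for u
  proof -
    have "((\<lambda>u. suminf (\<lambda>p. c p * u ^ p)) has_real_derivative (suminf (\<lambda>p. diffs c p * u ^ p))) (at u)"
      using termdiffs_strong'[of 2 c u] sm u by auto
    moreover have "\<forall>\<^sub>F w in nhds u. xi \<beta> w = (suminf (\<lambda>p. c p * w ^ p))"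
      using near[OF u] by eventually_elim (rule xi)
    ultimately have "(xi \<beta> has_real_derivative (suminf (\<lambda>p. diffs c p * u ^ p))) (at u)"
      by (subst DERIV_cong_ev[OF refl _ refl])
    then show ?thesis unfolding dxi_def by (rule DERIV_imp_deriv)
  qed
  define d2 where "d2 u = (suminf (\<lambda>p. diffs (diffs c) p * u ^ p))" for u :: real
  have D: "(dxi \<beta> has_real_derivative d2 u) (at u)" if u: "\<bar>u\<bar> < 2" for u
  proof -
    have "((\<lambda>u. suminf (\<lambda>p. diffs c p * u ^ p)) has_real_derivative d2 u) (at u)"
      unfolding d2_def using termdiffs_strong'[of 2 "diffs c" u] sm1 u by auto
    moreover have "\<forall>\<^sub>F w in nhds u. dxi \<beta> w = (suminf (\<lambda>p. diffs c p * w ^ p))"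
      using near[OF u] by eventually_elim (rule dxi)
    ultimately show ?thesis by (subst DERIV_cong_ev[OF refl _ refl])
  qed
  have D2: "(d2 has_real_derivative (suminf (\<lambda>p. diffs (diffs (diffs c)) p * u ^ p))) (at u)" if u: "\<bar>u\<bar> < 2" for u
    unfolding d2_def using termdiffs_strong'[of 2 "diffs (diffs c)" u] sm2 u by auto
  have cont: "continuous_on {0..1} d2"
    using DERIV_isCont[OF D2] by (intro continuous_at_imp_continuous_on ballI) auto
  have "bounded (d2 ` {0..1})"
    by (intro compact_imp_bounded compact_continuous_image cont) auto
  then obtain L where "\<forall>x\<in>d2 ` {0..1}. norm x \<le> L"
    unfolding bounded_iff by blast
  then have L: "d2 u \<le> L" if "u \<in> {0..1}" for u
    using that abs_le_D1[of "d2 u" L] by simp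
  have c0: "0 \<le> c p" for p by (simp add: c_def)
  have "0 \<le> diffs (diffs c) p" for p unfolding diffs_def using c0 by simp
  then have d0: "0 \<le> d2 u" if "u \<in> {0..1}" for u
    unfolding d2_def using that sm2[of u] by (intro suminf_nonneg) auto
  have "dxi \<beta> 0 = 0"
    using dxi[of 0] by (simp add: powser_zero diffs_def c_def)
  then have "parisi_covariance \<beta> d2 L"
    using D cont L d0 by unfold_locales auto
  then show ?thesis by blast
qed

context parisi_covariance
begin

lemma dxi_mono:
  assumes "0 \<le> u" "u \<le> s" "s \<le> 1"
  shows "dxi \<beta> u \<le> dxi \<beta> s"
proof (rule DERIV_nonneg_imp_nondecreasing[OF assms(2)])
  fix x assume "u \<le> x" "x \<le> s"
  then have "x \<in> {0..1}" using assms by auto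
  then show "\<exists>y. (dxi \<beta> has_real_derivative y) (at x) \<and> 0 \<le> y"
    using DERIV_dxi d2_nonneg by blast
qed

lemma L_nonneg: "0 \<le> L"
  using d2_nonneg[of 0] d2_le[of 0] by simp

lemma dxi_lipschitz: 
  assumes "0 \<le> u" "u \<le> s" "s \<le> 1"
  shows "dxi \<beta> s - dxi \<beta> u \<le> L * (s - u)"
proof (cases "u = s")
  case False
  then obtain z where z: "u < z" "z < s" "dxi \<beta> s - dxi \<beta> u = (s - u) * d2 z"
    using MVT2[of u s "dxi \<beta>" d2] DERIV_dxi assms by force
  then show ?thesis
    using d2_le[of z] assms mult_left_mono[of "d2 z" L "s - u"] by (simp add: mult.commute)
qed simp

lemma dxi_diff_le_L:
  assumes "0 \<le> u" "u \<le> s" "s \<le> 1"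
  shows "dxi \<beta> s - dxi \<beta> u \<le> L"
proof -
  have "L * (s - u) \<le> L * 1" using assms L_nonneg by (intro mult_left_mono) auto
  with dxi_lipschitz[OF assms] show ?thesis by linarith
qed

lemma dxi_nonneg: "u \<in> {0..1} \<Longrightarrow> 0 \<le> dxi \<beta> u"
  using dxi_mono[of 0 u] dxi_0 by simp

end

section \<open>Distribution functions of measures on [0,1] and of measures with finitely many
  atoms\<close>

lemma M01_space:
  assumes "\<mu> \<in> M01"
  shows "space \<mu> = {0..1}"
proof -
  have "sets \<mu> = sets (restrict_space borel {0..1})" using assms unfolding M01_def by blast
  then have "space \<mu> = space (restrict_space borel {0..1})" by (rule sets_eq_imp_space_eq)
  then show ?thesis by (simp add: space_restrict_space)
qed

lemma M01_prob_space: "\<mu> \<in> M01 \<Longrightarrow> prob_space \<mu>"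
  unfolding M01_def by blast

lemma M01_sets:
  assumes "\<mu> \<in> M01" "A \<in> sets borel" "A \<subseteq> {0..1}"
  shows "A \<in> sets \<mu>"
proof -
  have "A = {0..1} \<inter> A" using assms(3) by blast
  then show ?thesis using assms(1,2) unfolding M01_def sets_restrict_space by blast
qed

lemma M01_measure_mono:
  assumes "\<mu> \<in> M01" "s \<le> t" "t \<le> 1"
  shows "measure \<mu> {0..s} \<le> measure \<mu> {0..t}"
proof -
  interpret prob_space \<mu> by (rule M01_prob_space[OF assms(1)])
  show ?thesis
    using assms by (intro finite_measure_mono M01_sets[OF assms(1)]) auto
qed

lemma M01_measure_1: "\<mu> \<in> M01 \<Longrightarrow> measure \<mu> {0..1} = 1"
  by (metis M01_prob_space M01_space prob_space.prob_space)

lemma M01_measure_le_1: "\<mu> \<in> M01 \<Longrightarrow> measure \<mu> A \<le> 1"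
  by (rule prob_space.prob_le_1[OF M01_prob_space])

lemma M01_measurable_cdf:
  assumes "\<mu> \<in> M01"
  shows "(\<lambda>u. measure \<mu> {0..u}) \<in> borel_measurable (restrict_space borel {0..1})"
proof (rule borel_measurable_mono_on_fnc)
  show "mono_on {0..1} (\<lambda>u. measure \<mu> {0..u})"
    unfolding mono_on_def using M01_measure_mono[OF assms] by auto
qed

lemma set_integrable_bounded_unit:
  fixes F :: "real \<Rightarrow> real"
  assumes "F \<in> borel_measurable (restrict_space borel {0..1})" "\<And>u. u \<in> {0..1} \<Longrightarrow> \<bar>F u\<bar> \<le> C" 
    "A \<in> sets borel" "A \<subseteq> {0..1}"
  shows "set_integrable lborel A F"
proof -
  have "set_integrable lborel {0..1} F"
    unfolding set_integrable_def
  proof (rule Bochner_Integration.integrable_bound)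
    show "integrable lborel (\<lambda>x. indicator {0..1::real} x *\<^sub>R C)"
      by (intro integrable_scaleR_left) auto
    show "(\<lambda>x. indicator {0..1} x *\<^sub>R F x) \<in> borel_measurable lborel"
      using assms(1) by (subst (asm) borel_measurable_restrict_space_iff) auto
    show "AE x in lborel. norm (indicator {0..1} x *\<^sub>R F x) \<le> norm (indicator {0..1::real} x *\<^sub>R C)"
      using assms(2) by (intro AE_I2) (fastforce simp: indicator_def)
  qed
  then show ?thesis
    by (rule set_integrable_subset) (use assms in auto)
qed

lemma M01_set_integrable_cdf_diff:
  assumes "\<mu> \<in> M01" "\<nu> \<in> M01" "A \<in> sets borel" "A \<subseteq> {0..1}"
  shows "set_integrable lborel A (\<lambda>u. \<bar>measure \<mu> {0..u} - measure \<nu> {0..u}\<bar>)"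
proof (rule set_integrable_bounded_unit[where C = 1])
  show "(\<lambda>u. \<bar>measure \<mu> {0..u} - measure \<nu> {0..u}\<bar>) \<in> borel_measurable (restrict_space borel {0..1})"
    using M01_measurable_cdf assms by (intro borel_measurable_abs borel_measurable_diff) auto
  show "\<bar>\<bar>measure \<mu> {0..u} - measure \<nu> {0..u}\<bar>\<bar> \<le> 1" for u
    using M01_measure_le_1[OF assms(1), of "{0..u}"] M01_measure_le_1[OF assms(2), of "{0..u}"]
      measure_nonneg[of \<mu> "{0..u}"] measure_nonneg[of \<nu> "{0..u}"] by linarith
qed (use assms in auto)

lemma Md01_M01: "\<nu> \<in> Md01 \<Longrightarrow> \<nu> \<in> M01"
  by (simp add: Md01_def)

lemma Md01_finite: "\<nu> \<in> Md01 \<Longrightarrow> finite (atoms \<nu>)"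
  by (simp add: Md01_def)

lemma Md01_set_atoms:
  assumes "\<nu> \<in> Md01"
  shows "set (sorted_list_of_set (atoms \<nu>)) = atoms \<nu>" "atoms \<nu> \<subseteq> {0..1}"
  using Md01_finite[OF assms] by (auto simp: atoms_def)

lemma Md01_measure_no_atoms:
  assumes "\<nu> \<in> Md01" "A \<in> sets borel" "A \<subseteq> {0..1}" "A \<inter> atoms \<nu> = {}"
  shows "measure \<nu> A = 0"
proof -
  have M: "\<nu> \<in> M01" by (rule Md01_M01[OF assms(1)])
  interpret prob_space \<nu> by (rule M01_prob_space[OF M])
  have "atoms \<nu> \<in> sets borel"
    using Md01_finite[OF assms(1)] finite_imp_closed borel_closed by blast
  then have "atoms \<nu> \<in> sets \<nu>" by (intro M01_sets[OF M]) (auto simp: atoms_def)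
  then have "measure \<nu> (atoms \<nu> \<union> A) = measure \<nu> (atoms \<nu>) + measure \<nu> A"
    using assms M01_sets[OF M] by (intro finite_measure_Union) auto
  moreover have "measure \<nu> (atoms \<nu>) = 1" using assms(1) by (simp add: Md01_def)
  ultimately show ?thesis using M01_measure_le_1[OF M, of "atoms \<nu> \<union> A"] measure_nonneg[of \<nu> A] by linarith
qed

lemma Md01_cdf_const:
  assumes "\<nu> \<in> Md01" "0 \<le> s" "s \<le> t" "t \<le> 1" "{s<..t} \<inter> atoms \<nu> = {}"
  shows "measure \<nu> {0..t} = measure \<nu> {0..s}"
proof -
  have M: "\<nu> \<in> M01" by (rule Md01_M01[OF assms(1)])
  interpret prob_space \<nu> by (rule M01_prob_space[OF M])
  have "{0..t} = {0..s} \<union> {s<..t}" using assms by auto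
  then have "measure \<nu> {0..t} = measure \<nu> {0..s} + measure \<nu> {s<..t}"
    using assms finite_measure_Union[OF M01_sets[OF M, of "{0..s}"] M01_sets[OF M, of "{s<..t}"]]
    by (auto simp: disjoint_iff subset_iff)
  then show ?thesis using Md01_measure_no_atoms[OF assms(1) _ _ assms(5)] assms by (auto simp: subset_iff)
qed

text \<open>For \<open>m = 1\<close> the quotients are those of the derivatives of
  \<open>cosh\<close>, which alternate between \<open>sinh\<close> and \<open>cosh\<close>, by
  \<open>cosh\<close>. The mass 1 is the value of the distribution function at time 1, so this
  starts the backward induction with a constant independent of the order.\<close>

lemma smooth_ln_cosh: "smooth (\<lambda>x. ln (cosh x))"
  and exp_bell_ln_cosh: "\<bar>exp_bell 1 (derivs (\<lambda>x. ln (cosh x)) x) n\<bar> \<le> 1"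
proof -
  define C where "C n = (if even n then cosh else sinh :: real \<Rightarrow> real)" for n :: nat
  have D: "(C n has_real_derivative C (Suc n) x) (at x)" for n x
    by (auto simp: C_def intro!: derivative_eq_intros)
  have "smooth cosh" by (rule smoothI[of C, OF _ D]) (simp add: C_def)
  then show sm: "smooth (\<lambda>x. ln (cosh x))" by (rule smooth_ln) (rule cosh_real_pos)
  have "exp (ln (cosh x)) = cosh x" for x :: real by (simp add: cosh_real_pos)
  then have "C (Suc n) x = cosh x * exp_bell 1 (derivs (\<lambda>x. ln (cosh x)) x) n"
    using higher_deriv_exp[OF sm, of n 1 x] higher_deriv_eqI[of C cosh, OF _ D, of "Suc n"]
    by (simp add: C_def[of 0])
  moreover have "\<bar>C (Suc n) x\<bar> \<le> cosh x"
    using sinh_le_cosh_real[of x] sinh_le_cosh_real[of "- x"] by (auto simp: C_def abs_le_iff)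
  ultimately have "cosh x * \<bar>exp_bell 1 (derivs (\<lambda>x. ln (cosh x)) x) n\<bar> \<le> cosh x * 1"
    using cosh_real_pos[of x] by (simp add: abs_mult)
  then show "\<bar>exp_bell 1 (derivs (\<lambda>x. ln (cosh x)) x) n\<bar> \<le> 1"
    using cosh_real_pos[of x] by (simp only: mult_le_cancel_left_pos)
qed

lemma nonexpansive_ln_cosh: "nonexpansive (\<lambda>x. ln (cosh x))"
  unfolding nonexpansive_def
proof (intro allI)
  fix x y :: real
  have "norm (ln (cosh x) - ln (cosh y)) \<le> 1 * norm (x - y)"
  proof (rule field_differentiable_bound[where S = UNIV and f' = "deriv (\<lambda>x. ln (cosh x))"])
    show "((\<lambda>x. ln (cosh x)) has_real_derivative deriv (\<lambda>x. ln (cosh x)) z) (at z within UNIV)" for z :: real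
      by (rule smoothD0[OF smooth_ln_cosh])
    show "norm (deriv (\<lambda>x. ln (cosh x)) z) \<le> 1" for z :: real
      using exp_bell_ln_cosh[of z 0] by (simp add: exp_bell.simps[of 1 _ 0])
  qed auto
  then show "\<bar>ln (cosh x) - ln (cosh y)\<bar> \<le> \<bar>x - y\<bar>" by simp
qed

text \<open>Gaussian averaging multiplies \<open>cosh\<close> by \<open>exp (v / 2)\<close>. Hence
  the closed formula of \<open>parisi_rec\<close> beyond the last atom is a step of mass 1, in
  agreement with the distribution function there.\<close>

lemma parisi_step_ln_cosh:
  assumes "0 \<le> v"
  shows "parisi_step 1 v (\<lambda>x. ln (cosh x)) x = ln (cosh x) + v / 2"
proof -
  have "gauss_exp v cosh x = exp (v / 2) * cosh x"
  proof -
    have i: "integrable normal01 (\<lambda>z. exp (c * (x + z * sqrt v)) / 2)"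
      and e: "(LINT z|normal01. exp (c * (x + z * sqrt v)) / 2) = exp (c * x) / 2 * exp ((c * sqrt v)\<^sup>2 / 2)" for c
    proof -
      have "(\<lambda>z. exp (c * (x + z * sqrt v)) / 2) = (\<lambda>z. exp (c * x) / 2 * exp (c * sqrt v * z))"
        by (simp add: distrib_left exp_add mult_ac)
      then show "integrable normal01 (\<lambda>z. exp (c * (x + z * sqrt v)) / 2)"
        "(LINT z|normal01. exp (c * (x + z * sqrt v)) / 2) = exp (c * x) / 2 * exp ((c * sqrt v)\<^sup>2 / 2)"
        using integrable_normal01_exp[of "c * sqrt v"] integral_normal01_exp[of "c * sqrt v"] by simp_all
    qed
    have "gauss_exp v cosh x = (LINT z|normal01. exp (1 * (x + z * sqrt v)) / 2 + exp (- 1 * (x + z * sqrt v)) / 2)"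
      by (simp add: gauss_exp_def cosh_field_def add_divide_distrib)
    also have "\<dots> = exp (1 * x) / 2 * exp ((1 * sqrt v)\<^sup>2 / 2) + exp (- 1 * x) / 2 * exp ((- 1 * sqrt v)\<^sup>2 / 2)"
      unfolding e[symmetric] by (rule Bochner_Integration.integral_add[OF i i])
    also have "\<dots> = exp (v / 2) * cosh x"
      using assms by (simp add: cosh_field_def algebra_simps add_divide_distrib)
    finally show ?thesis .
  qed
  moreover have "exp (ln (cosh y)) = cosh y" for y :: real by (simp add: cosh_real_pos)
  ultimately show ?thesis
    by (simp add: parisi_step_eq ln_mult cosh_real_pos less_imp_neq[symmetric])
qed

text \<open>Induction on the number of points of \<open>A\<close> strictly between \<open>u\<close>
  and \<open>b\<close>, moving each time to the nearest one. The step only asks for an open interval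
  free of \<open>A\<close>; its end points may or may not lie in \<open>A\<close>.\<close>

lemma backward_induct:
  fixes A :: "real set"
  assumes "finite A" "P b" "0 \<le> u" "u \<le> b"
    and step: "\<And>u s. \<lbrakk>0 \<le> u; u < s; s \<le> b; A \<inter> {u<..<s} = {}; P s\<rbrakk> \<Longrightarrow> P u"
  shows "P u"
  using assms(3,4)
proof (induction "card (A \<inter> {u<..<b})" arbitrary: u rule: less_induct)
  case less
  show ?case
  proof (cases "A \<inter> {u<..<b} = {}")
    case True
    then show ?thesis
      using step[of u b] less.prems assms(2) by (cases "u = b") auto
  next
    case False
    define s where "s = Min (A \<inter> {u<..<b})"
    have fin: "finite (A \<inter> {u<..<b})" using assms(1) by simp
    have s: "s \<in> A \<inter> {u<..<b}" unfolding s_def by (rule Min_in[OF fin False])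
    have ge: "s \<le> t" if "t \<in> A \<inter> {u<..<b}" for t unfolding s_def using Min_le[OF fin that] .
    have "A \<inter> {s<..<b} \<subset> A \<inter> {u<..<b}" using s by auto
    then have "P s" using psubset_card_mono[OF fin] s less by auto
    moreover have "A \<inter> {u<..<s} = {}" using s ge by fastforce
    ultimately show ?thesis using step[of u s] s less.prems by auto
  qed
qed

section \<open>The recursion as a step over any interval free of atoms\<close>

context parisi_covariance
begin

lemma nonexpansive_parisi_rec:
  assumes "0 \<le> m" "u \<in> {0..1}" "set qs \<subseteq> {0..1}"
  shows "nonexpansive (\<lambda>x. parisi_rec \<beta> \<nu> m qs x u)"
  using assms
proof (induction qs arbitrary: m u)
  case Nil
  then show ?case using nonexpansive_add_const[OF nonexpansive_ln_cosh] by simp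
next
  case (Cons q qs)
  show ?case
  proof (cases "q \<le> u")
    case True
    then show ?thesis using Cons by simp
  next
    case False
    have "nonexpansive (parisi_step m (dxi \<beta> q - dxi \<beta> u) (\<lambda>y. parisi_rec \<beta> \<nu> (measure \<nu> {0..q}) qs y q))"
      by (intro nonexpansive_parisi_step Cons.IH) (use Cons.prems False dxi_mono[of u q] in auto)
    with False show ?thesis by simp
  qed
qed

lemma parisi_rec_1: "set qs \<subseteq> {0..1} \<Longrightarrow> parisi_rec \<beta> \<nu> m qs x 1 = ln (cosh x)"
proof (induction qs arbitrary: m)
  case (Cons q qs)
  then have "q \<le> 1" "set qs \<subseteq> {0..1}" by auto
  then show ?case by (simp add: Cons.IH)
qed simp

text \<open>\<open>parisi_rec\<close> jumps from \<open>u\<close> to the next atom \<open>q\<close>;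
  stopping at an intermediate \<open>s\<close> splits this jump by the semigroup property, and
  beyond all atoms the \<open>cosh\<close> computation takes over. The last two hypotheses say that
  \<nu> has no mass besides the listed atoms, in a form that survives dropping the head of the list,
  with \<open>q\<close> as the new \<open>a\<close>.\<close>

lemma parisi_rec_step:
  assumes F: "measure \<nu> {0..1} = 1"
    and qs: "sorted qs" "set qs \<subseteq> {a..1}" and a: "0 \<le> a" "a \<le> u" "u < s" "s \<le> 1"
    and free: "set qs \<inter> {u<..<s} = {}"
    and const: "\<And>s t. \<lbrakk>a \<le> s; s \<le> t; t \<le> 1; set qs \<inter> {s<..t} = {}\<rbrakk> \<Longrightarrow> measure \<nu> {0..t} = measure \<nu> {0..s}"
    and m: "\<And>t. \<lbrakk>a \<le> t; t \<le> 1; \<And>q. q \<in> set qs \<Longrightarrow> t < q\<rbrakk> \<Longrightarrow> measure \<nu> {0..t} = m"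
  shows "parisi_rec \<beta> \<nu> m qs x u = parisi_step (measure \<nu> {0..u}) (dxi \<beta> s - dxi \<beta> u) (\<lambda>y. parisi_rec \<beta> \<nu> m qs y s) x"
  using qs a free const m
proof (induction qs arbitrary: m a)
  case Nil
  have v: "0 \<le> dxi \<beta> s - dxi \<beta> u" using dxi_mono[of u s] Nil.prems(3-6) by simp
  have "measure \<nu> {0..u} = m" "measure \<nu> {0..1} = m"
    using Nil.prems(3-6) by (auto intro!: Nil.prems(9))
  then have "measure \<nu> {0..u} = 1" using F by simp
  then show ?case
    using parisi_step_add_const[OF nonexpansive_ln_cosh v, of 1 "1 / 2 * (dxi \<beta> 1 - dxi \<beta> s)" x]
      parisi_step_ln_cosh[OF v, of x]
    by (simp add: diff_divide_distrib)
next
  case (Cons q qs)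
  have q: "q \<in> {a..1}" using Cons.prems(2) by auto
  have qle: "q \<le> r" if "r \<in> set qs" for r using Cons.prems(1) that by auto
  show ?case
  proof (cases "q \<le> u")
    case True
    have "parisi_rec \<beta> \<nu> (measure \<nu> {0..q}) qs x u =
        parisi_step (measure \<nu> {0..u}) (dxi \<beta> s - dxi \<beta> u) (\<lambda>y. parisi_rec \<beta> \<nu> (measure \<nu> {0..q}) qs y s) x"
    proof (rule Cons.IH[of q])
      show "sorted qs" "set qs \<subseteq> {q..1}" "set qs \<inter> {u<..<s} = {}"
        using Cons.prems(1,2,7) by auto
      show "0 \<le> q" "q \<le> u" "u < s" "s \<le> 1" using True q Cons.prems(3-6) by auto
      fix s t assume "q \<le> s" "s \<le> t" "t \<le> 1" "set qs \<inter> {s<..t} = {}"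
      then show "measure \<nu> {0..t} = measure \<nu> {0..s}"
        using q by (intro Cons.prems(8)) auto
    next
      fix t assume t: "q \<le> t" "t \<le> 1" "\<And>r. r \<in> set qs \<Longrightarrow> t < r"
      then have "set (q # qs) \<inter> {q<..t} = {}" by force
      then show "measure \<nu> {0..t} = measure \<nu> {0..q}"
        using q t by (intro Cons.prems(8)) auto
    qed
    then show ?thesis using True Cons.prems(5) by simp
  next
    case False
    then have m: "measure \<nu> {0..u} = m"
      using Cons.prems(3-6) qle by (intro Cons.prems(9)) force+
    have sq: "s \<le> q" using Cons.prems(7) False by auto
    have m0: "0 \<le> m" using m measure_nonneg by metis
    have sub: "set qs \<subseteq> {0..1}" using Cons.prems(2,3) by auto
    have "parisi_rec \<beta> \<nu> m (q # qs) y s = parisi_step m (dxi \<beta> q - dxi \<beta> s) (\<lambda>y. parisi_rec \<beta> \<nu> (measure \<nu> {0..q}) qs y q) y" for y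
    proof (cases "s = q")
      case True
      then show ?thesis using parisi_step_0[of m "\<lambda>y. parisi_rec \<beta> \<nu> (measure \<nu> {0..q}) qs y q"] by simp
    next
      case False
      then show ?thesis using sq by simp
    qed
    moreover have "nonexpansive (\<lambda>y. parisi_rec \<beta> \<nu> (measure \<nu> {0..q}) qs y q)"
      by (rule nonexpansive_parisi_rec[OF measure_nonneg _ sub]) (use q Cons.prems(3) in auto)
    then have "parisi_step m (dxi \<beta> s - dxi \<beta> u) (parisi_step m (dxi \<beta> q - dxi \<beta> s)
        (\<lambda>y. parisi_rec \<beta> \<nu> (measure \<nu> {0..q}) qs y q)) x =
        parisi_step m ((dxi \<beta> s - dxi \<beta> u) + (dxi \<beta> q - dxi \<beta> s))
        (\<lambda>y. parisi_rec \<beta> \<nu> (measure \<nu> {0..q}) qs y q) x"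
      using dxi_mono[of u s] dxi_mono[of s q] Cons.prems(3-6) q sq m0
      by (intro parisi_step_semigroup) auto
    ultimately show ?thesis
      using False m by simp
  qed
qed

lemma Phi_d_1: "\<nu> \<in> Md01 \<Longrightarrow> Phi_d \<beta> \<nu> x 1 = ln (cosh x)"
  unfolding Phi_d_def by (rule parisi_rec_1) (simp add: Md01_set_atoms)

lemma nonexpansive_Phi_d: "\<nu> \<in> Md01 \<Longrightarrow> u \<in> {0..1} \<Longrightarrow> nonexpansive (\<lambda>x. Phi_d \<beta> \<nu> x u)"
  unfolding Phi_d_def by (rule nonexpansive_parisi_rec) (simp_all add: Md01_set_atoms)

lemma Phi_d_step:
  assumes \<nu>: "\<nu> \<in> Md01" and u: "0 \<le> u" "u < s" "s \<le> 1" "atoms \<nu> \<inter> {u<..<s} = {}"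
  shows "Phi_d \<beta> \<nu> x u = parisi_step (measure \<nu> {0..u}) (dxi \<beta> s - dxi \<beta> u) (\<lambda>y. Phi_d \<beta> \<nu> y s) x"
  unfolding Phi_d_def
proof (rule parisi_rec_step[where a = 0])
  note set = Md01_set_atoms(1)[OF \<nu>]
  show "measure \<nu> {0..1} = 1" by (rule M01_measure_1[OF Md01_M01[OF \<nu>]])
  show "set (sorted_list_of_set (atoms \<nu>)) \<subseteq> {0..1}" unfolding set by (rule Md01_set_atoms(2)[OF \<nu>])
  show "set (sorted_list_of_set (atoms \<nu>)) \<inter> {u<..<s} = {}" unfolding set by (rule u(4))
  show "measure \<nu> {0..t} = measure \<nu> {0..s}" if "0 \<le> s" "s \<le> t" "t \<le> 1" "set (sorted_list_of_set (atoms \<nu>)) \<inter> {s<..t} = {}" for s t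
    using Md01_cdf_const[OF \<nu> that(1-3)] that(4) unfolding set by blast
  \<comment> \<open>Before the first atom the distribution function is 0, the initial mass in
    \<open>Phi_d\<close>.\<close>
  show "measure \<nu> {0..t} = 0" if "0 \<le> t" "t \<le> 1" "\<And>q. q \<in> set (sorted_list_of_set (atoms \<nu>)) \<Longrightarrow> t < q" for t
  proof (rule Md01_measure_no_atoms[OF \<nu>])
    show "{0..t} \<inter> atoms \<nu> = {}" using that(3) unfolding set by force
  qed (use that in auto)
qed (use u in auto)

end

section \<open>Estimates for finitely many atoms with constants independent of the measure\<close>

context parisi_covariance
begin

lemma Phi_d_step_fun:
  assumes "\<nu> \<in> Md01" "0 \<le> u" "u < s" "s \<le> 1" "atoms \<nu> \<inter> {u<..<s} = {}"
  shows "(\<lambda>x. Phi_d \<beta> \<nu> x u) = parisi_step (measure \<nu> {0..u}) (dxi \<beta> s - dxi \<beta> u) (\<lambda>y. Phi_d \<beta> \<nu> y s)"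
  using Phi_d_step[OF assms] by (rule ext)

lemma Phi_d_1_fun: "\<nu> \<in> Md01 \<Longrightarrow> (\<lambda>x. Phi_d \<beta> \<nu> x 1) = (\<lambda>x. ln (cosh x))"
  using Phi_d_1 by (intro ext)

text \<open>The bounds here depend on \<nu> and \<open>u\<close>. They only provide the smoothness
  that \<open>exp_bell_parisi_step_bound\<close> asks for in the quantitative induction.\<close>

lemma smooth_bounded_Phi_d_each:
  assumes \<nu>: "\<nu> \<in> Md01" and u: "u \<in> {0..1}"
  shows "\<exists>K. smooth_bounded K (\<lambda>x. Phi_d \<beta> \<nu> x u)"
proof (rule backward_induct[where b = 1 and P = "\<lambda>u. \<exists>K. smooth_bounded K (\<lambda>x. Phi_d \<beta> \<nu> x u)", OF Md01_finite[OF \<nu>]])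
  show "\<exists>K. smooth_bounded K (\<lambda>x. Phi_d \<beta> \<nu> x 1)"
    unfolding Phi_d_1_fun[OF \<nu>]
    by (rule smooth_bounded_from_exp_bell[OF smooth_ln_cosh, of 1]) (use exp_bell_ln_cosh in auto)
next
  fix u s assume us: "0 \<le> u" "u < s" "s \<le> 1" "atoms \<nu> \<inter> {u<..<s} = {}" "\<exists>K. smooth_bounded K (\<lambda>x. Phi_d \<beta> \<nu> x s)"
  then obtain K where K: "smooth_bounded K (\<lambda>x. Phi_d \<beta> \<nu> x s)" by blast
  show "\<exists>K. smooth_bounded K (\<lambda>x. Phi_d \<beta> \<nu> x u)"
    unfolding Phi_d_step_fun[OF \<nu> us(1-4)]
  proof (rule smooth_bounded_parisi_step[OF _ K])
    show "nonexpansive (\<lambda>x. Phi_d \<beta> \<nu> x s)" using us by (intro nonexpansive_Phi_d[OF \<nu>]) auto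
    show "0 \<le> dxi \<beta> s - dxi \<beta> u" using dxi_mono[of u s] us by simp
  qed (auto intro: M01_measure_le_1[OF Md01_M01[OF \<nu>]])
qed (use u in auto)

text \<open>The induction over the atoms carries the bound \<open>1 + (1 - \<nu>[0,u]) * exp_bell_lip K n\<close>: a Gaussian
  step preserves a bound on \<open>exp_bell m\<close>, and passing an atom changes \<open>m\<close> by the mass of the atom.\<close>

lemma exp_bell_Phi_d_bound:
  assumes \<nu>: "\<nu> \<in> Md01" and u: "u \<in> {0..1}"
    and K: "\<And>i x u. i < n \<Longrightarrow> u \<in> {0..1} \<Longrightarrow> \<bar>(deriv ^^ Suc i) (\<lambda>x. Phi_d \<beta> \<nu> x u) x\<bar> \<le> K i"
  shows "\<bar>exp_bell (measure \<nu> {0..u}) (derivs (\<lambda>x. Phi_d \<beta> \<nu> x u) x) n\<bar> \<le>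
    1 + (1 - measure \<nu> {0..u}) * exp_bell_lip K n"
proof -
  have M: "\<nu> \<in> M01" by (rule Md01_M01[OF \<nu>])
  let ?F = "\<lambda>u. measure \<nu> {0..u}"
  let ?P = "\<lambda>u. \<forall>x. \<bar>exp_bell (?F u) (derivs (\<lambda>x. Phi_d \<beta> \<nu> x u) x) n\<bar> \<le> 1 + (1 - ?F u) * exp_bell_lip K n"
  have "?P u"
  proof (rule backward_induct[where b = 1 and P = ?P, OF Md01_finite[OF \<nu>]])
    show "?P 1"
      unfolding Phi_d_1_fun[OF \<nu>] M01_measure_1[OF M] using exp_bell_ln_cosh by simp
  next
    fix u s assume us: "0 \<le> u" "u < s" "s \<le> 1" "atoms \<nu> \<inter> {u<..<s} = {}" "?P s"
    have F: "0 \<le> ?F u" "?F u \<le> ?F s" "?F s \<le> 1" "0 \<le> ?F s"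
      using us M01_measure_mono[OF M, of u s] M01_measure_le_1[OF M] by auto
    have s01: "s \<in> {0..1}" using us by auto
    obtain K' where K': "smooth_bounded K' (\<lambda>x. Phi_d \<beta> \<nu> x s)"
      using smooth_bounded_Phi_d_each[OF \<nu> s01] by blast
    \<comment> \<open>The change of mass from time \<open>s\<close> to \<open>u\<close> costs
      exactly the increment of the distribution function, so the costs telescope and the number of
      atoms does not enter.\<close>
    have B: "\<bar>exp_bell (?F u) (derivs (\<lambda>x. Phi_d \<beta> \<nu> x s) y) n\<bar> \<le> 1 + (1 - ?F u) * exp_bell_lip K n" for y
    proof -
      have "\<bar>exp_bell (?F u) (derivs (\<lambda>x. Phi_d \<beta> \<nu> x s) y) n - exp_bell (?F s) (derivs (\<lambda>x. Phi_d \<beta> \<nu> x s) y) n\<bar>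
          \<le> \<bar>?F u - ?F s\<bar> * exp_bell_lip K n"
        using F by (intro exp_bell_lipschitz K s01) auto
      also have "\<dots> = (?F s - ?F u) * exp_bell_lip K n" using F by simp
      finally have "\<bar>exp_bell (?F u) (derivs (\<lambda>x. Phi_d \<beta> \<nu> x s) y) n\<bar> \<le>
          (1 + (1 - ?F s) * exp_bell_lip K n) + (?F s - ?F u) * exp_bell_lip K n"
        using spec[OF us(5), of y] by linarith
      then show ?thesis by (simp add: algebra_simps)
    qed
    show "?P u"
      unfolding Phi_d_step_fun[OF \<nu> us(1-4)]
    proof
      fix x
      show "\<bar>exp_bell (?F u) (derivs (parisi_step (?F u) (dxi \<beta> s - dxi \<beta> u) (\<lambda>y. Phi_d \<beta> \<nu> y s)) x) n\<bar> \<le>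
          1 + (1 - ?F u) * exp_bell_lip K n"
        by (rule exp_bell_parisi_step_bound[OF nonexpansive_Phi_d[OF \<nu> s01] K' F(1) _ _ B])
          (use F dxi_mono[of u s] us in auto)
    qed
  qed (use u in auto)
  then show ?thesis by blast
qed

text \<open>The outer induction is on the order: bounds on all lower orders, valid at all times and
  for all discrete measures, make \<open>exp_bell_lip K n\<close> a uniform constant.\<close>

lemma smooth_bounded_Phi_d_uniform:
  "\<exists>K. \<forall>\<nu>\<in>Md01. \<forall>u\<in>{0..1}. smooth_bounded K (\<lambda>x. Phi_d \<beta> \<nu> x u)"
proof -
  have "\<exists>k. \<forall>\<nu>\<in>Md01. \<forall>u\<in>{0..1}. \<forall>x. \<bar>(deriv ^^ Suc n) (\<lambda>x. Phi_d \<beta> \<nu> x u) x\<bar> \<le> k" for n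
  proof (induction n rule: less_induct)
    case (less n)
    then obtain K where K: "\<And>i \<nu> u x. i < n \<Longrightarrow> \<nu> \<in> Md01 \<Longrightarrow> u \<in> {0..1} \<Longrightarrow>
        \<bar>(deriv ^^ Suc i) (\<lambda>x. Phi_d \<beta> \<nu> x u) x\<bar> \<le> K i"
      by metis
    \<comment> \<open>The first \<open>exp_bell_lip K n\<close> pays for all changes of mass, the
      second for returning from the quotient to the derivative.\<close>
    show ?case
    proof (intro exI[of _ "1 + exp_bell_lip K n + exp_bell_lip K n"] ballI allI)
      fix \<nu> :: "real measure" and u x :: real assume \<nu>: "\<nu> \<in> Md01" and u: "u \<in> {0..1}"
      have K0: "0 \<le> K i" if "i < n" for i
        using K[OF that \<nu> u, of 0] by linarith
      let ?F = "measure \<nu> {0..u}"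
      have F: "0 \<le> ?F" "?F \<le> 1" using M01_measure_le_1[OF Md01_M01[OF \<nu>]] by auto
      have "(1 - ?F) * exp_bell_lip K n \<le> 1 * exp_bell_lip K n"
        using F K0 by (intro mult_right_mono exp_bell_lip_nonneg) auto
      then have "\<bar>exp_bell ?F (derivs (\<lambda>x. Phi_d \<beta> \<nu> x u) x) n\<bar> \<le> 1 + exp_bell_lip K n"
        using exp_bell_Phi_d_bound[OF \<nu> u, of n K x] K[OF _ \<nu>] by fastforce
      moreover have "\<bar>(deriv ^^ Suc n) (\<lambda>x. Phi_d \<beta> \<nu> x u) x\<bar> \<le>
          \<bar>exp_bell ?F (derivs (\<lambda>x. Phi_d \<beta> \<nu> x u) x) n\<bar> + exp_bell_lip K n"
        by (rule exp_bell_inverse_bound[OF F K[OF _ \<nu> u]])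
      ultimately show "\<bar>(deriv ^^ Suc n) (\<lambda>x. Phi_d \<beta> \<nu> x u) x\<bar> \<le> 1 + exp_bell_lip K n + exp_bell_lip K n"
        by linarith
    qed
  qed
  then obtain K where "\<And>n \<nu> u x. \<nu> \<in> Md01 \<Longrightarrow> u \<in> {0..1} \<Longrightarrow> \<bar>(deriv ^^ Suc n) (\<lambda>x. Phi_d \<beta> \<nu> x u) x\<bar> \<le> K n"
    by metis
  moreover have "smooth (\<lambda>x. Phi_d \<beta> \<nu> x u)" if "\<nu> \<in> Md01" "u \<in> {0..1}" for \<nu> u
    using smooth_bounded_Phi_d_each[OF that] smooth_bounded_smooth by blast
  ultimately show ?thesis
    unfolding smooth_bounded_def by blast
qed

text \<open>Fixed once, so that limits over approximating measures share the same bounds and all of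
  \<open>M01\<close> inherits them.\<close>

definition deriv_bound :: "nat \<Rightarrow> real" where
  "deriv_bound = (SOME K. \<forall>\<nu>\<in>Md01. \<forall>u\<in>{0..1}. smooth_bounded K (\<lambda>x. Phi_d \<beta> \<nu> x u))"

lemma smooth_bounded_Phi_d:
  assumes "\<nu> \<in> Md01" "u \<in> {0..1}"
  shows "smooth_bounded deriv_bound (\<lambda>x. Phi_d \<beta> \<nu> x u)"
  using someI_ex[OF smooth_bounded_Phi_d_uniform] assms unfolding deriv_bound_def by blast

text \<open>The constant of \<open>parisi_step_close\<close> for the largest variance
  \<open>L\<close>; the last factor \<open>L\<close> converts variance into time.\<close>

definition time_lip :: real where
  "time_lip = (\<bar>deriv_bound 1\<bar> * gmgf 2 + step_const L) * L"

lemma time_lip_nonneg: "0 \<le> time_lip"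
  unfolding time_lip_def
  by (intro mult_nonneg_nonneg add_nonneg_nonneg gmgf_nonneg step_const_nonneg L_nonneg abs_ge_zero)

lemma Phi_d_lipschitz_time:
  assumes \<nu>: "\<nu> \<in> Md01" and us: "0 \<le> u" "u \<le> s" "s \<le> 1"
  shows "\<bar>Phi_d \<beta> \<nu> x u - Phi_d \<beta> \<nu> x s\<bar> \<le> time_lip * (s - u)"
proof -
  let ?P = "\<lambda>u. \<forall>x. \<bar>Phi_d \<beta> \<nu> x u - Phi_d \<beta> \<nu> x s\<bar> \<le> time_lip * (s - u)"
  have "?P u"
  proof (rule backward_induct[where b = s and P = ?P, OF Md01_finite[OF \<nu>]])
    fix u t assume ut: "0 \<le> u" "u < t" "t \<le> s" "atoms \<nu> \<inter> {u<..<t} = {}" "?P t"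
    have t: "t \<in> {0..1}" using ut us by auto
    have t1: "t \<le> 1" using t by simp
    let ?f = "\<lambda>x. Phi_d \<beta> \<nu> x t" and ?v = "dxi \<beta> t - dxi \<beta> u"
    have v: "0 \<le> ?v" "?v \<le> L" "?v \<le> L * (t - u)"
      using dxi_mono[of u t] dxi_diff_le_L[of u t] dxi_lipschitz[of u t] ut t1 by auto
    have "\<bar>Phi_d \<beta> \<nu> x u - Phi_d \<beta> \<nu> x t\<bar> \<le> time_lip * (t - u)" for x
    proof -
      have "\<bar>parisi_step (measure \<nu> {0..u}) ?v ?f x - ?f x\<bar> \<le> (deriv_bound 1 * gmgf 2 + step_const L) * ?v"
        by (rule parisi_step_close[OF nonexpansive_Phi_d[OF \<nu> t] smooth_bounded_Phi_d[OF \<nu> t] v(1,2)])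
          (auto intro: M01_measure_le_1[OF Md01_M01[OF \<nu>]])
      also have "\<dots> \<le> (\<bar>deriv_bound 1\<bar> * gmgf 2 + step_const L) * (L * (t - u))"
        by (intro mult_mono v add_mono mult_right_mono gmgf_nonneg) (use v gmgf_nonneg step_const_nonneg in auto)
      finally show ?thesis
        unfolding Phi_d_step[OF \<nu> ut(1,2) t1 ut(4)] time_lip_def by (simp only: mult.assoc)
    qed
    then have "\<bar>Phi_d \<beta> \<nu> x u - Phi_d \<beta> \<nu> x s\<bar> \<le> time_lip * (t - u) + time_lip * (s - t)" for x
      using spec[OF ut(5), of x] by (smt (verit))
    then show "?P u" by (simp add: algebra_simps)
  qed (use us in auto)
  then show ?thesis by blast
qed

text \<open>\<open>A\<close> holds the possible jumps of the mass function \<open>F\<close>. The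
  notion unites \<Phi> of a discrete measure with a single step of constant mass started from an
  arbitrary function at time \<open>b\<close>; comparing the first with the second is what leads to
  the Parisi equation.\<close>

definition parisi_chain :: "real set \<Rightarrow> (real \<Rightarrow> real) \<Rightarrow> real \<Rightarrow> (real \<Rightarrow> real \<Rightarrow> real) \<Rightarrow> bool" where
  "parisi_chain A F b \<Psi> \<longleftrightarrow> finite A \<and> (\<forall>u\<in>{0..b}. 0 \<le> F u \<and> F u \<le> 1) \<and> (\<forall>u\<in>{0..b}. nonexpansive (\<Psi> u)) \<and>
    (\<forall>u s. 0 \<le> u \<longrightarrow> u < s \<longrightarrow> s \<le> b \<longrightarrow> A \<inter> {u<..<s} = {} \<longrightarrow>
      (\<forall>t\<in>{u..<s}. F t = F u) \<and> \<Psi> u = parisi_step (F u) (dxi \<beta> s - dxi \<beta> u) (\<Psi> s))"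

lemma parisi_chain_Phi_d:
  assumes \<nu>: "\<nu> \<in> Md01" and b: "b \<le> 1"
  shows "parisi_chain (atoms \<nu>) (\<lambda>u. measure \<nu> {0..u}) b (\<lambda>u x. Phi_d \<beta> \<nu> x u)"
  unfolding parisi_chain_def
proof (intro conjI ballI allI impI)
  show "finite (atoms \<nu>)" by (rule Md01_finite[OF \<nu>])
  show "measure \<nu> {0..u} \<le> 1" for u by (rule M01_measure_le_1[OF Md01_M01[OF \<nu>]])
  show "nonexpansive (\<lambda>x. Phi_d \<beta> \<nu> x u)" if "u \<in> {0..b}" for u
    using that b by (intro nonexpansive_Phi_d[OF \<nu>]) auto
  fix u s assume us: "0 \<le> u" "u < s" "s \<le> b" "atoms \<nu> \<inter> {u<..<s} = {}"
  then have s1: "s \<le> 1" using b by simp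
  show "(\<lambda>x. Phi_d \<beta> \<nu> x u) = parisi_step (measure \<nu> {0..u}) (dxi \<beta> s - dxi \<beta> u) (\<lambda>x. Phi_d \<beta> \<nu> x s)"
    by (rule Phi_d_step_fun[OF \<nu> us(1,2) s1 us(4)])
  fix t assume t: "t \<in> {u..<s}"
  show "measure \<nu> {0..t} = measure \<nu> {0..u}"
    by (rule Md01_cdf_const[OF \<nu> us(1)]) (use t s1 us(4) in \<open>auto simp: disjoint_iff\<close>)
qed auto

lemma parisi_chain_const:
  assumes g: "nonexpansive g" and m: "0 \<le> m" "m \<le> 1" and b: "b \<le> 1"
  shows "parisi_chain {} (\<lambda>_. m) b (\<lambda>u. parisi_step m (dxi \<beta> b - dxi \<beta> u) g)"
  unfolding parisi_chain_def
proof (intro conjI ballI allI impI)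
  show "nonexpansive (parisi_step m (dxi \<beta> b - dxi \<beta> u) g)" if "u \<in> {0..b}" for u
    using that b dxi_mono[of u b] by (intro nonexpansive_parisi_step g m) auto
  fix u s assume us: "0 \<le> u" "u < s" "s \<le> b" "{} \<inter> {u<..<s} = {}"
  have "parisi_step m (dxi \<beta> s - dxi \<beta> u) (parisi_step m (dxi \<beta> b - dxi \<beta> s) g) x =
      parisi_step m ((dxi \<beta> s - dxi \<beta> u) + (dxi \<beta> b - dxi \<beta> s)) g x" for x
    using us b dxi_mono[of u s] dxi_mono[of s b] by (intro parisi_step_semigroup g m) auto
  then show "parisi_step m (dxi \<beta> b - dxi \<beta> u) g = parisi_step m (dxi \<beta> s - dxi \<beta> u) (parisi_step m (dxi \<beta> b - dxi \<beta> s) g)"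
    by (intro ext) simp
qed (use m in auto)

text \<open>Cost of a unit change of mass per unit of time: \<open>step_const L\<close> per unit of
  variance, and variance grows at rate at most \<open>L\<close>.\<close>

definition measure_lip :: real where
  "measure_lip = step_const L * L"

lemma measure_lip_nonneg: "0 \<le> measure_lip"
  unfolding measure_lip_def by (intro mult_nonneg_nonneg step_const_nonneg L_nonneg)

text \<open>Between consecutive points of \<open>A1 \<union> A2\<close> both chains are single steps
  with constant masses. Contraction transports the error already made, and Lipschitz dependence on
  the mass adds \<open>\<bar>F1 - F2\<bar>\<close> times the length; these contributions sum to the
  integral.\<close>

lemma parisi_chain_compare:
  assumes c1: "parisi_chain A1 F1 b \<Psi>1" and c2: "parisi_chain A2 F2 b \<Psi>2" and b: "b \<le> 1"
    and int: "set_integrable lborel {0..b} (\<lambda>t. \<bar>F1 t - F2 t\<bar>)"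
    and e: "\<And>x. \<bar>\<Psi>1 b x - \<Psi>2 b x\<bar> \<le> e" and u: "0 \<le> u" "u \<le> b"
  shows "\<bar>\<Psi>1 u x - \<Psi>2 u x\<bar> \<le> e + measure_lip * (LINT t:{u..b}|lborel. \<bar>F1 t - F2 t\<bar>)"
proof -
  let ?I = "\<lambda>A. (LINT t:A|lborel. \<bar>F1 t - F2 t\<bar>)"
  let ?P = "\<lambda>u. \<forall>x. \<bar>\<Psi>1 u x - \<Psi>2 u x\<bar> \<le> e + measure_lip * ?I {u..b}"
  have fin: "finite (A1 \<union> A2)" using c1 c2 unfolding parisi_chain_def by blast
  have "?P u"
  proof (rule backward_induct[where b = b and P = ?P, OF fin _ u])
    have "0 \<le> ?I {b..b}"
      unfolding set_lebesgue_integral_def by (intro integral_nonneg_AE AE_I2) (simp add: indicator_def)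
    then have "0 \<le> measure_lip * ?I {b..b}" by (intro mult_nonneg_nonneg measure_lip_nonneg)
    then show "?P b" using e by (smt (verit))
  next
    fix u s assume us: "0 \<le> u" "u < s" "s \<le> b" "(A1 \<union> A2) \<inter> {u<..<s} = {}" "?P s"
    have d: "A1 \<inter> {u<..<s} = {}" "A2 \<inter> {u<..<s} = {}" using us(4) by auto
    have 1: "\<And>t. t \<in> {u..<s} \<Longrightarrow> F1 t = F1 u" "\<Psi>1 u = parisi_step (F1 u) (dxi \<beta> s - dxi \<beta> u) (\<Psi>1 s)"
      using c1 us(1-3) d(1) unfolding parisi_chain_def by blast+
    have 2: "\<And>t. t \<in> {u..<s} \<Longrightarrow> F2 t = F2 u" "\<Psi>2 u = parisi_step (F2 u) (dxi \<beta> s - dxi \<beta> u) (\<Psi>2 s)"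
      using c2 us(1-3) d(2) unfolding parisi_chain_def by blast+
    have u0: "u \<in> {0..b}" "s \<in> {0..b}" using us by auto
    have F: "0 \<le> F1 u" "F1 u \<le> 1" "0 \<le> F2 u" "F2 u \<le> 1"
      using c1 c2 u0(1) unfolding parisi_chain_def by blast+
    have ne: "nonexpansive (\<Psi>1 s)" "nonexpansive (\<Psi>2 s)"
      using c1 c2 u0(2) unfolding parisi_chain_def by blast+
    let ?v = "dxi \<beta> s - dxi \<beta> u"
    have v: "0 \<le> ?v" "?v \<le> L" "?v \<le> L * (s - u)"
      using dxi_mono[of u s] dxi_diff_le_L[of u s] dxi_lipschitz[of u s] us b by auto
    have split: "?I {u..b} = ?I {u..<s} + ?I {s..b}"
    proof -
      have "{u..b} = {u..<s} \<union> {s..b}" using us by auto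
      moreover have "?I ({u..<s} \<union> {s..b}) = ?I {u..<s} + ?I {s..b}"
      proof (rule set_integral_Un)
        show "set_integrable lborel {u..<s} (\<lambda>t. \<bar>F1 t - F2 t\<bar>)"
          by (rule set_integrable_subset[OF int]) (use us in auto)
        show "set_integrable lborel {s..b} (\<lambda>t. \<bar>F1 t - F2 t\<bar>)"
          by (rule set_integrable_subset[OF int]) (use us in auto)
      qed auto
      ultimately show ?thesis by simp
    qed
    have "?I {u..<s} = (LINT t:{u..<s}|lborel. \<bar>F1 u - F2 u\<bar>)"
    proof (rule set_lebesgue_integral_cong)
      show "\<forall>t. t \<in> {u..<s} \<longrightarrow> \<bar>F1 t - F2 t\<bar> = \<bar>F1 u - F2 u\<bar>"
        using 1(1) 2(1) by (intro allI impI arg_cong[where f = abs] arg_cong2[where f = "(-)"]) blast+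
    qed simp
    also have "\<dots> = \<bar>F1 u - F2 u\<bar> * (s - u)"
      unfolding set_lebesgue_integral_def using us by simp
    finally have I: "?I {u..<s} = \<bar>F1 u - F2 u\<bar> * (s - u)" .
    show "?P u"
    proof
      fix x
      have "\<bar>parisi_step (F1 u) ?v (\<Psi>1 s) x - parisi_step (F1 u) ?v (\<Psi>2 s) x\<bar> \<le> e + measure_lip * ?I {s..b}"
        using us(5) by (intro parisi_step_contraction ne v F) blast
      moreover have "\<bar>parisi_step (F1 u) ?v (\<Psi>2 s) x - parisi_step (F2 u) ?v (\<Psi>2 s) x\<bar> \<le> \<bar>F1 u - F2 u\<bar> * (step_const L * ?v)"
        by (intro parisi_step_lipschitz_parameter ne v F)
      moreover have "\<bar>F1 u - F2 u\<bar> * (step_const L * ?v) \<le> \<bar>F1 u - F2 u\<bar> * (step_const L * (L * (s - u)))"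
        by (intro mult_left_mono v step_const_nonneg abs_ge_zero)
      moreover have "\<bar>F1 u - F2 u\<bar> * (step_const L * (L * (s - u))) = measure_lip * ?I {u..<s}"
        unfolding I measure_lip_def by simp
      ultimately show "\<bar>\<Psi>1 u x - \<Psi>2 u x\<bar> \<le> e + measure_lip * ?I {u..b}"
        unfolding 1(2) 2(2) split distrib_left by linarith
    qed
  qed
  then show ?thesis by blast
qed

end

subsection \<open>Extension to all probability measures\<close>

lemma M01_borel_measurable:
  assumes "\<mu> \<in> M01" "f \<in> borel_measurable borel"
  shows "f \<in> borel_measurable \<mu>"
proof -
  have "f \<in> borel_measurable (restrict_space borel {0..1})"
    by (rule measurable_restrict_space1[OF assms(2)])
  moreover have "sets \<mu> = sets (restrict_space borel {0..1})" using assms(1) unfolding M01_def by blast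
  ultimately show ?thesis by (simp cong: measurable_cong_sets)
qed

lemma continuous_bounded_unit:
  fixes f :: "real \<Rightarrow> real"
  assumes "continuous_on UNIV f"
  obtains C where "\<And>x. x \<in> {0..1} \<Longrightarrow> \<bar>f x\<bar> \<le> C"
proof -
  have "bounded (f ` {0..1})"
    by (intro compact_imp_bounded compact_continuous_image continuous_on_subset[OF assms]) auto
  then obtain C where "\<forall>y\<in>f ` {0..1}. norm y \<le> C"
    unfolding bounded_iff by blast
  then have "\<bar>f x\<bar> \<le> C" if "x \<in> {0..1}" for x
    using that by simp
  then show thesis by (rule that)
qed

lemma M01_integrable_continuous:
  assumes \<mu>: "\<mu> \<in> M01" and f: "continuous_on UNIV f"
  shows "integrable \<mu> (f :: real \<Rightarrow> real)"
proof -
  interpret prob_space \<mu> by (rule M01_prob_space[OF \<mu>])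
  obtain C where C: "\<And>x. x \<in> {0..1} \<Longrightarrow> \<bar>f x\<bar> \<le> C"
    using continuous_bounded_unit[OF f] by blast
  show ?thesis
    by (rule integrable_const_bound[where B = C])
      (use C M01_space[OF \<mu>] in \<open>auto intro!: AE_I2 M01_borel_measurable[OF \<mu>] borel_measurable_continuous_onI f\<close>)
qed

text \<open>Integration by parts: write \<open>g t\<close> as \<open>g 1\<close> minus the integral
  of \<open>g'\<close> over \<open>{t..1}\<close> and apply Fubini. It relates \<open>d01\<close> to
  means, and later to integrals of smooth functions.\<close>

lemma M01_integral_cdf:
  assumes \<mu>: "\<mu> \<in> M01" and g: "\<And>x. (g has_real_derivative g' x) (at x)" and g': "continuous_on UNIV g'"
  shows "(LINT t|\<mu>. g t) = g 1 - (LINT u:{0..1}|lborel. g' u * measure \<mu> {0..u})"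
proof -
  interpret prob_space \<mu> by (rule M01_prob_space[OF \<mu>])
  interpret P: pair_sigma_finite \<mu> lborel ..
  define h where "h t u = (if t \<le> u \<and> 0 \<le> u \<and> u \<le> 1 then g' u else 0)" for t u :: real
  obtain C where C: "\<And>x. x \<in> {0..1} \<Longrightarrow> \<bar>g' x\<bar> \<le> C"
    using continuous_bounded_unit[OF g'] by blast
  have C0: "0 \<le> C" using C[of 0] by simp
  have id[measurable]: "(\<lambda>t. t) \<in> borel_measurable \<mu>"
    by (rule M01_borel_measurable[OF \<mu>]) simp
  have g'm[measurable]: "g' \<in> borel_measurable borel" by (intro borel_measurable_continuous_onI g')
  have hm: "case_prod h \<in> borel_measurable (\<mu> \<Otimes>\<^sub>M lborel)"
  proof -
    have "case_prod h = (\<lambda>p. case_prod h (fst p, snd p))" by simp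
    have [measurable]: "(\<lambda>p. fst p) \<in> borel_measurable (\<mu> \<Otimes>\<^sub>M lborel)"
      using measurable_compose[OF measurable_fst id] by simp
    have [measurable]: "(\<lambda>p. snd p) \<in> borel_measurable (\<mu> \<Otimes>\<^sub>M lborel)" by simp
    have "(\<lambda>p. if fst p \<le> snd p \<and> 0 \<le> snd p \<and> snd p \<le> 1 then g' (snd p) else 0) \<in> borel_measurable (\<mu> \<Otimes>\<^sub>M lborel)"
      by measurable
    then show ?thesis by (simp add: h_def case_prod_beta')
  qed
  have int: "integrable (\<mu> \<Otimes>\<^sub>M lborel) (case_prod h)"
  proof (rule Bochner_Integration.integrable_bound[OF _ hm])
    have "emeasure (\<mu> \<Otimes>\<^sub>M lborel) (space \<mu> \<times> {0..1::real}) = emeasure \<mu> (space \<mu>) * emeasure lborel {0..1::real}"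
      by (rule lborel.emeasure_pair_measure_Times) auto
    then have "integrable (\<mu> \<Otimes>\<^sub>M lborel) (indicator (space \<mu> \<times> {0..1::real}) :: _ \<Rightarrow> real)"
      by (intro integrable_real_indicator) (auto simp: emeasure_space_1)
    then show "integrable (\<mu> \<Otimes>\<^sub>M lborel) (\<lambda>p. C * indicator (space \<mu> \<times> {0..1::real}) p)"
      by simp
    show "AE p in \<mu> \<Otimes>\<^sub>M lborel. norm (case_prod h p) \<le> norm (C * indicator (space \<mu> \<times> {0..1::real}) p)"
    proof (rule AE_I2)
      fix p :: "real \<times> real" assume "p \<in> space (\<mu> \<Otimes>\<^sub>M lborel)"
      then obtain t u where p: "p = (t, u)" "t \<in> space \<mu>" by (auto simp: space_pair_measure)
      show "norm (case_prod h p) \<le> norm (C * indicator (space \<mu> \<times> {0..1::real}) p :: real)"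
        using C[of u] C0 p by (cases "u \<in> {0..1}") (auto simp: h_def)
    qed
  qed
  have "(LINT t|\<mu>. (LINT u|lborel. h t u)) = (LINT t|\<mu>. g 1 - g t)"
  proof (rule Bochner_Integration.integral_cong[OF refl])
    fix t assume "t \<in> space \<mu>"
    then have t: "0 \<le> t" "t \<le> 1" using M01_space[OF \<mu>] by auto
    have "(LINT u|lborel. h t u) = (LINT u|lborel. g' u * indicator {t..1} u)"
      by (rule Bochner_Integration.integral_cong) (use t in \<open>auto simp: h_def indicator_def\<close>)
    also have "\<dots> = g 1 - g t"
      using g' by (intro integral_FTC_Icc_real t g) (simp add: continuous_on_eq_continuous_at)
    finally show "(LINT u|lborel. h t u) = g 1 - g t" .
  qed
  also have "\<dots> = g 1 - (LINT t|\<mu>. g t)"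
  proof (subst Bochner_Integration.integral_diff)
    show "integrable \<mu> g"
      using g by (intro M01_integrable_continuous[OF \<mu>] DERIV_continuous_on) auto
  qed (simp_all add: prob_space)
  finally have 1: "(LINT t|\<mu>. (LINT u|lborel. h t u)) = g 1 - (LINT t|\<mu>. g t)" .
  have "(LINT u|lborel. (LINT t|\<mu>. h t u)) = (LINT u:{0..1}|lborel. g' u * measure \<mu> {0..u})"
    unfolding set_lebesgue_integral_def
  proof (rule Bochner_Integration.integral_cong[OF refl])
    fix u :: real
    have "(LINT t|\<mu>. h t u) = (LINT t|\<mu>. (indicator {0..1} u * g' u) * indicator {0..u} t)"
      by (rule Bochner_Integration.integral_cong) (auto simp: h_def indicator_def M01_space[OF \<mu>])
    also have "\<dots> = (indicator {0..1} u * g' u) * measure \<mu> ({0..u} \<inter> space \<mu>)"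
      by simp
    also have "\<dots> = indicator {0..1} u *\<^sub>R (g' u * measure \<mu> {0..u})"
    proof (cases "u \<in> {0..1}")
      case True
      then have "{0..u} \<inter> space \<mu> = {0..u}" using M01_space[OF \<mu>] by auto
      then show ?thesis by simp
    qed simp
    finally show "(LINT t|\<mu>. h t u) = indicator {0..1} u *\<^sub>R (g' u * measure \<mu> {0..u})" .
  qed
  with 1 P.Fubini_integral[OF int] show ?thesis by simp
qed

lemma M01_mean: "\<mu> \<in> M01 \<Longrightarrow> (LINT t|\<mu>. t) = 1 - (LINT u:{0..1}|lborel. measure \<mu> {0..u})"
  using M01_integral_cdf[of \<mu> "\<lambda>x. x" "\<lambda>x. 1"] by simp

lemma M01_set_integrable_cdf: "\<mu> \<in> M01 \<Longrightarrow> set_integrable lborel {0..1} (\<lambda>u. measure \<mu> {0..u})"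
  by (rule set_integrable_bounded_unit[where C = 1]) (auto intro: M01_measurable_cdf M01_measure_le_1)

section \<open>Density of the measures with finitely many atoms\<close>

lemma d01_nonneg: "0 \<le> d01 \<mu> \<nu>"
  unfolding d01_def set_lebesgue_integral_def by (intro integral_nonneg_AE AE_I2) (simp add: indicator_def)

lemma d01_commute: "d01 \<mu> \<nu> = d01 \<nu> \<mu>"
  unfolding d01_def by (simp add: abs_minus_commute)

lemma d01_triangle:
  assumes "\<mu> \<in> M01" "\<nu> \<in> M01" "\<rho> \<in> M01"
  shows "d01 \<mu> \<rho> \<le> d01 \<mu> \<nu> + d01 \<nu> \<rho>"
proof -
  note i = M01_set_integrable_cdf_diff[of _ _ "{0..1}"]
  have "d01 \<mu> \<rho> \<le> (LINT u:{0..1}|lborel. \<bar>measure \<mu> {0..u} - measure \<nu> {0..u}\<bar> + \<bar>measure \<nu> {0..u} - measure \<rho> {0..u}\<bar>)"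
    unfolding d01_def using assms by (intro set_integral_mono i set_integral_add(1)) auto
  also have "\<dots> = d01 \<mu> \<nu> + d01 \<nu> \<rho>"
    unfolding d01_def using assms by (intro set_integral_add(2) i) auto
  finally show ?thesis .
qed

text \<open>Rounding up to multiples of \<open>1 / n\<close> increases the mean by at most \<open>1 / n\<close>, and for two
  measures whose distribution functions are ordered \<open>d01\<close> is the difference of the means.\<close>

lemma Md01_dense:
  assumes \<mu>: "\<mu> \<in> M01" and e: "0 < e"
  shows "\<exists>\<nu>\<in>Md01. d01 \<nu> \<mu> < e"
proof -
  interpret prob_space \<mu> by (rule M01_prob_space[OF \<mu>])
  obtain n :: nat where n: "inverse (real (Suc n)) < e" using reals_Archimedean[OF e] by blast
  define N where "N = real (Suc n)"
  have N: "0 < N" "1 / N < e" using n by (auto simp: N_def inverse_eq_divide)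
  \<comment> \<open>Rounding up, not down, makes the new distribution function smaller everywhere,
    which removes the absolute value in \<open>d01\<close>. As \<open>N\<close> is an integer, [0,1]
    is mapped into itself.\<close>
  define g where "g t = real_of_int \<lceil>N * t\<rceil> / N" for t
  have g: "t \<le> g t" "g t \<le> t + 1 / N" for t
    using N ceiling_correct[of "N * t"] by (auto simp: g_def field_simps)
  define S where "S = (\<lambda>k. real k / N) ` {..Suc n}"
  have gS: "g t \<in> S" if "t \<in> {0..1}" for t
  proof -
    have "N * 0 \<le> N * t" using that N by (intro mult_left_mono) auto
    then have c0: "0 \<le> \<lceil>N * t\<rceil>" by simp
    have "N * t \<le> N * 1" using that N by (intro mult_left_mono) auto
    then have "N * t \<le> of_int (int (Suc n))" by (simp add: N_def)
    then have "\<lceil>N * t\<rceil> \<le> int (Suc n)" by (rule ceiling_le)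
    then have "nat \<lceil>N * t\<rceil> \<le> Suc n" by (simp only: nat_le_iff)
    moreover have "g t = real (nat \<lceil>N * t\<rceil>) / N" using c0 unfolding g_def by simp
    ultimately have "g t = real (nat \<lceil>N * t\<rceil>) / N" "nat \<lceil>N * t\<rceil> \<le> Suc n" by blast+
    then show ?thesis unfolding S_def by blast
  qed
  have S: "finite S" "S \<subseteq> {0..1}"
    using N by (auto simp: S_def N_def field_simps)
  have g01: "g t \<in> {0..1}" if "t \<in> {0..1}" for t using gS[OF that] S by blast
  let ?R = "restrict_space borel {0..1::real}"
  define \<nu> where "\<nu> = distr \<mu> ?R g"
  have gb: "g \<in> borel_measurable borel" unfolding g_def by measurable
  have gm: "g \<in> measurable \<mu> ?R"
    by (rule measurable_restrict_space2[OF _ M01_borel_measurable[OF \<mu> gb]]) (use g01 M01_space[OF \<mu>] in auto)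
  interpret N: prob_space \<nu> unfolding \<nu>_def by (rule prob_space_distr[OF gm])
  have \<nu>: "\<nu> \<in> M01"
    unfolding M01_def using N.prob_space_axioms by (auto simp: \<nu>_def)
  have sets: "A \<in> sets \<nu>" if "A \<in> sets borel" "A \<subseteq> {0..1}" for A
    by (rule M01_sets[OF \<nu> that])
  have m\<nu>: "measure \<nu> A = measure \<mu> (g -` A \<inter> {0..1})" if "A \<in> sets borel" "A \<subseteq> {0..1}" for A
    using sets[OF that] M01_space[OF \<mu>] unfolding \<nu>_def by (subst measure_distr[OF gm]) auto
  have fb: "finite X \<Longrightarrow> X \<in> sets borel" for X :: "real set" using finite_imp_closed borel_closed by blast
  have at: "atoms \<nu> \<subseteq> S"
  proof
    fix q assume q: "q \<in> atoms \<nu>"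
    then have "measure \<nu> {q} > 0" "q \<in> {0..1}" by (auto simp: atoms_def)
    then have "g -` {q} \<inter> {0..1} \<noteq> {}" using m\<nu>[of "{q}"] by (metis borel_singleton empty_subsetI insert_subset less_irrefl measure_empty sets.empty_sets)
    then show "q \<in> S" using gS by blast
  qed
  have fin: "finite (atoms \<nu>)" using at S finite_subset by blast
  \<comment> \<open>The grid carries all the mass, but some of its points may have mass 0 and then
    are not atoms; removing them from the sum changes nothing.\<close>
  have "measure \<nu> S = 1"
  proof -
    have "g -` S \<inter> {0..1} = space \<mu>" using gS M01_space[OF \<mu>] by auto
    then show ?thesis using m\<nu>[OF fb S(2)] S(1) prob_space by simp
  qed
  moreover have "measure \<nu> S = (\<Sum>q\<in>S. measure \<nu> {q})"
    using S by (intro N.finite_measure_eq_sum_singleton sets) auto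
  moreover have "(\<Sum>q\<in>S. measure \<nu> {q}) = (\<Sum>q\<in>atoms \<nu>. measure \<nu> {q})"
  proof (rule sum.mono_neutral_right[OF S(1) at], intro ballI)
    fix q assume "q \<in> S - atoms \<nu>"
    then have "q \<in> {0..1}" "\<not> measure \<nu> {q} > 0" using S(2) unfolding atoms_def by blast+
    then show "measure \<nu> {q} = 0" using measure_nonneg[of \<nu> "{q}"] by linarith
  qed
  moreover have "measure \<nu> (atoms \<nu>) = (\<Sum>q\<in>atoms \<nu>. measure \<nu> {q})"
    using fin by (intro N.finite_measure_eq_sum_singleton sets) (auto simp: atoms_def)
  ultimately have \<nu>d: "\<nu> \<in> Md01"
    unfolding Md01_def using \<nu> fin by simp
  have le: "measure \<nu> {0..u} \<le> measure \<mu> {0..u}" if "u \<in> {0..1}" for u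
  proof -
    have "g -` {0..u} \<inter> {0..1} \<subseteq> {0..u}"
    proof
      fix t assume "t \<in> g -` {0..u} \<inter> {0..1}"
      then show "t \<in> {0..u}" using g(1)[of t] by simp
    qed
    moreover have "{0..u} \<in> sets \<mu>" using that by (intro M01_sets[OF \<mu>]) auto
    ultimately show ?thesis using m\<nu>[of "{0..u}"] that by (simp add: finite_measure_mono)
  qed
  have "d01 \<nu> \<mu> = (LINT u:{0..1}|lborel. measure \<mu> {0..u} - measure \<nu> {0..u})"
    unfolding d01_def by (rule set_lebesgue_integral_cong) (use le in auto)
  also have "\<dots> = (LINT u:{0..1}|lborel. measure \<mu> {0..u}) - (LINT u:{0..1}|lborel. measure \<nu> {0..u})"
    by (intro set_integral_diff M01_set_integrable_cdf \<mu> \<nu>)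
  also have "\<dots> = (LINT t|\<nu>. t) - (LINT t|\<mu>. t)"
    using M01_mean[OF \<mu>] M01_mean[OF \<nu>] by simp
  also have "(LINT t|\<nu>. t) = (LINT t|\<mu>. g t)"
    unfolding \<nu>_def by (rule integral_distr[OF gm]) (auto intro: measurable_restrict_space1)
  also have "(LINT t|\<mu>. g t) \<le> (LINT t|\<mu>. t + 1 / N)"
  proof (rule integral_mono[OF _ _ g(2)])
    show "integrable \<mu> g"
      by (rule integrable_const_bound[where B = 1])
        (use g01 M01_space[OF \<mu>] in \<open>auto intro!: AE_I2 M01_borel_measurable[OF \<mu> gb]\<close>)
    show "integrable \<mu> (\<lambda>t. t + 1 / N)"
      by (intro M01_integrable_continuous[OF \<mu>] continuous_intros)
  qed
  also have "(LINT t|\<mu>. t + 1 / N) = (LINT t|\<mu>. t) + 1 / N"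
    using M01_integrable_continuous[OF \<mu> continuous_on_id] by (subst Bochner_Integration.integral_add) (auto simp: prob_space)
  finally have "d01 \<nu> \<mu> < e" using N by simp
  with \<nu>d show ?thesis by blast
qed

lemma Md01_approx_sequence:
  assumes \<mu>: "\<mu> \<in> M01"
  obtains \<nu>s where "\<And>n. \<nu>s n \<in> Md01" "(\<lambda>n. d01 (\<nu>s n) \<mu>) \<longlonglongrightarrow> 0"
proof -
  have "\<exists>\<nu>. \<nu> \<in> Md01 \<and> d01 \<nu> \<mu> < 1 / real (Suc n)" for n
    using Md01_dense[OF \<mu>, of "1 / real (Suc n)"] by auto
  then obtain \<nu>s where \<nu>s: "\<And>n. \<nu>s n \<in> Md01" "\<And>n. d01 (\<nu>s n) \<mu> < 1 / real (Suc n)"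
    by metis
  have "(\<lambda>n. d01 (\<nu>s n) \<mu>) \<longlonglongrightarrow> 0"
  proof (rule tendsto_sandwich[OF _ _ tendsto_const LIMSEQ_Suc[OF lim_1_over_n]])
    show "\<forall>\<^sub>F n in sequentially. 0 \<le> d01 (\<nu>s n) \<mu>" by (simp add: d01_nonneg)
    show "\<forall>\<^sub>F n in sequentially. d01 (\<nu>s n) \<mu> \<le> 1 / real (Suc n)"
      by (intro always_eventually allI less_imp_le \<nu>s(2))
  qed
  with \<nu>s(1) that show thesis by blast
qed

lemma eventually_Md01_nhds:
  "eventually P (Md01_nhds \<mu>) \<longleftrightarrow> (\<exists>e>0. \<forall>\<nu>\<in>Md01. d01 \<nu> \<mu> < e \<longrightarrow> P \<nu>)"
proof -
  have "eventually P (Md01_nhds \<mu>) \<longleftrightarrow> (\<exists>e\<in>{0<..}. eventually P (principal {\<nu> \<in> Md01. d01 \<nu> \<mu> < e}))"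
    unfolding Md01_nhds_def
  proof (rule eventually_INF_base)
    fix a b :: real assume "a \<in> {0<..}" "b \<in> {0<..}"
    then show "\<exists>x\<in>{0<..}. principal {\<nu> \<in> Md01. d01 \<nu> \<mu> < x} \<le> inf (principal {\<nu> \<in> Md01. d01 \<nu> \<mu> < a}) (principal {\<nu> \<in> Md01. d01 \<nu> \<mu> < b})"
      by (intro bexI[of _ "min a b"]) auto
  qed auto
  then show ?thesis by (auto simp: eventually_principal)
qed

section \<open>Transfer of the estimates from finitely many atoms to all measures\<close>

context parisi_covariance
begin

text \<open>All chains have the same value at time 1, so the comparison runs with terminal error
  0.\<close>

lemma Phi_d_lipschitz_measure:
  assumes \<nu>: "\<nu> \<in> Md01" "\<nu>' \<in> Md01" and u: "u \<in> {0..1}"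
  shows "\<bar>Phi_d \<beta> \<nu> x u - Phi_d \<beta> \<nu>' x u\<bar> \<le> measure_lip * d01 \<nu> \<nu>'"
proof -
  let ?f = "\<lambda>t. \<bar>measure \<nu> {0..t} - measure \<nu>' {0..t}\<bar>"
  note M = Md01_M01[OF \<nu>(1)] Md01_M01[OF \<nu>(2)]
  have "\<bar>Phi_d \<beta> \<nu> x u - Phi_d \<beta> \<nu>' x u\<bar> \<le> 0 + measure_lip * (LINT t:{u..1}|lborel. ?f t)"
    by (rule parisi_chain_compare[OF parisi_chain_Phi_d[OF \<nu>(1)] parisi_chain_Phi_d[OF \<nu>(2)]])
      (use u Phi_d_1 \<nu> in \<open>auto intro: M01_set_integrable_cdf_diff[OF M]\<close>)
  also have "(LINT t:{u..1}|lborel. ?f t) \<le> (LINT t:{0..1}|lborel. ?f t)"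
    unfolding set_lebesgue_integral_def
  proof (rule integral_mono)
    show "integrable lborel (\<lambda>t. indicator {u..1} t *\<^sub>R ?f t)" "integrable lborel (\<lambda>t. indicator {0..1} t *\<^sub>R ?f t)"
      using M01_set_integrable_cdf_diff[OF M, of "{u..1}"] M01_set_integrable_cdf_diff[OF M, of "{0..1}"] u
      unfolding set_integrable_def by auto
    show "indicator {u..1} t *\<^sub>R ?f t \<le> indicator {0..1} t *\<^sub>R ?f t" for t
      using u by (auto simp: indicator_def)
  qed
  finally show ?thesis
    unfolding d01_def using measure_lip_nonneg by (simp add: mult_left_mono)
qed

text \<open>The Lipschitz bound makes approximating sequences Cauchy and forces convergence along
  the whole filter, which is proper by density. Taking \<nu> equal to \<mu> shows that \<Phi>
  extends \<open>Phi_d\<close>; all properties of \<Phi> are drawn from this estimate.\<close>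

lemma Phi_d_close_Phi:
  assumes \<mu>: "\<mu> \<in> M01" and u: "u \<in> {0..1}" and \<nu>: "\<nu> \<in> Md01"
  shows "\<bar>Phi_d \<beta> \<nu> x u - Phi \<beta> \<mu> x u\<bar> \<le> measure_lip * d01 \<nu> \<mu>"
proof -
  let ?C = "measure_lip"
  have lip: "\<bar>Phi_d \<beta> \<nu> x u - Phi_d \<beta> \<nu>' x u\<bar> \<le> ?C * d01 \<nu> \<mu> + ?C * d01 \<nu>' \<mu>" if "\<nu> \<in> Md01" "\<nu>' \<in> Md01" for \<nu> \<nu>'
  proof -
    have "d01 \<nu> \<nu>' \<le> d01 \<nu> \<mu> + d01 \<nu>' \<mu>"
      using d01_triangle[OF Md01_M01[OF that(1)] \<mu> Md01_M01[OF that(2)]] d01_commute[of \<mu> \<nu>'] by simp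
    then have "?C * d01 \<nu> \<nu>' \<le> ?C * (d01 \<nu> \<mu> + d01 \<nu>' \<mu>)" by (intro mult_left_mono measure_lip_nonneg)
    with Phi_d_lipschitz_measure[OF that u, of x] show ?thesis by (simp add: distrib_left)
  qed
  obtain \<nu>s where \<nu>s: "\<And>n. \<nu>s n \<in> Md01" and d0: "(\<lambda>n. d01 (\<nu>s n) \<mu>) \<longlonglongrightarrow> 0"
    using Md01_approx_sequence[OF \<mu>] by blast
  have Cd0: "(\<lambda>n. ?C * d01 (\<nu>s n) \<mu>) \<longlonglongrightarrow> 0"
    using tendsto_mult_left[OF d0, of ?C] by simp
  have "Cauchy (\<lambda>n. Phi_d \<beta> (\<nu>s n) x u)"
  proof (rule CauchyI)
    fix e :: real assume "0 < e"
    then obtain M where M: "\<And>n. n \<ge> M \<Longrightarrow> ?C * d01 (\<nu>s n) \<mu> < e / 2"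
      using order_tendstoD(2)[OF Cd0, of "e / 2"] by (auto simp: eventually_sequentially)
    show "\<exists>M. \<forall>m\<ge>M. \<forall>n\<ge>M. norm (Phi_d \<beta> (\<nu>s m) x u - Phi_d \<beta> (\<nu>s n) x u) < e"
    proof (intro exI[of _ M] allI impI)
      fix m n assume mn: "M \<le> m" "M \<le> n"
      show "norm (Phi_d \<beta> (\<nu>s m) x u - Phi_d \<beta> (\<nu>s n) x u) < e"
        using lip[OF \<nu>s \<nu>s, of m n] M[OF mn(1)] M[OF mn(2)] unfolding real_norm_def by linarith
    qed
  qed
  then obtain l where l: "(\<lambda>n. Phi_d \<beta> (\<nu>s n) x u) \<longlonglongrightarrow> l"
    using Cauchy_convergent_iff convergent_def by blast
  have close: "\<bar>Phi_d \<beta> \<nu> x u - l\<bar> \<le> ?C * d01 \<nu> \<mu>" if "\<nu> \<in> Md01" for \<nu>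
  proof (rule tendsto_le[OF _ _ _ always_eventually])
    show "(\<lambda>n. \<bar>Phi_d \<beta> \<nu> x u - Phi_d \<beta> (\<nu>s n) x u\<bar>) \<longlonglongrightarrow> \<bar>Phi_d \<beta> \<nu> x u - l\<bar>"
      by (intro tendsto_intros l)
    show "(\<lambda>n. ?C * d01 \<nu> \<mu> + ?C * d01 (\<nu>s n) \<mu>) \<longlonglongrightarrow> ?C * d01 \<nu> \<mu>"
      using tendsto_add[OF tendsto_const Cd0] by simp
    show "\<forall>n. \<bar>Phi_d \<beta> \<nu> x u - Phi_d \<beta> (\<nu>s n) x u\<bar> \<le> ?C * d01 \<nu> \<mu> + ?C * d01 (\<nu>s n) \<mu>"
      using lip[OF that \<nu>s] by blast
  qed simp
  have "((\<lambda>\<nu>. Phi_d \<beta> \<nu> x u) \<longlongrightarrow> l) (Md01_nhds \<mu>)"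
  proof (rule tendstoI)
    fix e :: real assume e: "0 < e"
    show "\<forall>\<^sub>F \<nu> in Md01_nhds \<mu>. dist (Phi_d \<beta> \<nu> x u) l < e"
      unfolding eventually_Md01_nhds
    proof (intro exI[of _ "e / (?C + 1)"] conjI ballI impI)
      \<comment> \<open>The summand 1 avoids dividing by \<open>measure_lip\<close>, which may be
        0.\<close>
      have C1: "0 < ?C + 1" using measure_lip_nonneg by linarith
      then show "0 < e / (?C + 1)" using e by simp
      fix \<nu> assume \<nu>: "\<nu> \<in> Md01" "d01 \<nu> \<mu> < e / (?C + 1)"
      have "?C * d01 \<nu> \<mu> \<le> (?C + 1) * d01 \<nu> \<mu>" using d01_nonneg by (intro mult_right_mono) auto
      also have "\<dots> < e" using \<nu>(2) C1 by (simp add: field_simps)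
      finally show "dist (Phi_d \<beta> \<nu> x u) l < e" using close[OF \<nu>(1)] by (simp add: dist_real_def)
    qed
  qed
  moreover have "Md01_nhds \<mu> \<noteq> bot"
    unfolding trivial_limit_def eventually_Md01_nhds using Md01_dense[OF \<mu>] by auto
  ultimately have "Phi \<beta> \<mu> x u = l"
    unfolding Phi_def by (intro tendsto_Lim)
  with close[OF \<nu>] show ?thesis by simp
qed

lemma Phi_approx:
  assumes \<mu>: "\<mu> \<in> M01"
  shows "\<exists>\<nu>s. (\<forall>n. \<nu>s n \<in> Md01) \<and> (\<lambda>n. d01 (\<nu>s n) \<mu>) \<longlonglongrightarrow> 0 \<and>
    (\<forall>x. \<forall>u\<in>{0..1}. (\<lambda>n. Phi_d \<beta> (\<nu>s n) x u) \<longlonglongrightarrow> Phi \<beta> \<mu> x u) \<and>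
    (\<forall>u\<in>{0..1}. \<forall>e>0. \<exists>N. \<forall>n\<ge>N. \<forall>x. \<bar>Phi_d \<beta> (\<nu>s n) x u - Phi \<beta> \<mu> x u\<bar> \<le> e)"
proof -
  obtain \<nu>s where \<nu>s: "\<And>n. \<nu>s n \<in> Md01" and d0: "(\<lambda>n. d01 (\<nu>s n) \<mu>) \<longlonglongrightarrow> 0"
    using Md01_approx_sequence[OF \<mu>] by blast
  have Cd0: "(\<lambda>n. measure_lip * d01 (\<nu>s n) \<mu>) \<longlonglongrightarrow> 0"
    using tendsto_mult_left[OF d0, of measure_lip] by simp
  have unif: "\<exists>N. \<forall>n\<ge>N. \<forall>x. \<bar>Phi_d \<beta> (\<nu>s n) x u - Phi \<beta> \<mu> x u\<bar> \<le> e" if u: "u \<in> {0..1}" and e: "0 < e" for u e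
  proof -
    obtain N where N: "\<And>n. n \<ge> N \<Longrightarrow> measure_lip * d01 (\<nu>s n) \<mu> < e"
      using order_tendstoD(2)[OF Cd0 e] by (auto simp: eventually_sequentially)
    have "\<bar>Phi_d \<beta> (\<nu>s n) x u - Phi \<beta> \<mu> x u\<bar> \<le> e" if "n \<ge> N" for n x
      using Phi_d_close_Phi[OF \<mu> u \<nu>s, of n x] N[OF that] by linarith
    then show ?thesis by blast
  qed
  have "(\<lambda>n. Phi_d \<beta> (\<nu>s n) x u) \<longlonglongrightarrow> Phi \<beta> \<mu> x u" if u: "u \<in> {0..1}" for x u
  proof (rule LIMSEQ_I)
    fix r :: real assume "0 < r"
    then obtain N where N: "\<forall>n\<ge>N. \<forall>x. \<bar>Phi_d \<beta> (\<nu>s n) x u - Phi \<beta> \<mu> x u\<bar> \<le> r / 2"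
      using unif[OF u, of "r / 2"] by auto
    have "norm (Phi_d \<beta> (\<nu>s n) x u - Phi \<beta> \<mu> x u) < r" if "n \<ge> N" for n
    proof -
      have "\<bar>Phi_d \<beta> (\<nu>s n) x u - Phi \<beta> \<mu> x u\<bar> \<le> r / 2" using N that by blast
      with \<open>0 < r\<close> show ?thesis by simp
    qed
    then show "\<exists>no. \<forall>n\<ge>no. norm (Phi_d \<beta> (\<nu>s n) x u - Phi \<beta> \<mu> x u) < r" by blast
  qed
  with \<nu>s d0 unif show ?thesis by blast
qed

lemma smooth_bounded_Phi:
  assumes \<mu>: "\<mu> \<in> M01" and u: "u \<in> {0..1}"
  shows "smooth_bounded deriv_bound (\<lambda>x. Phi \<beta> \<mu> x u)"
proof -
  obtain \<nu>s where \<nu>s: "\<And>n. \<nu>s n \<in> Md01" "(\<lambda>n. d01 (\<nu>s n) \<mu>) \<longlonglongrightarrow> 0"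
      "\<And>x u. u \<in> {0..1} \<Longrightarrow> (\<lambda>n. Phi_d \<beta> (\<nu>s n) x u) \<longlonglongrightarrow> Phi \<beta> \<mu> x u"
      "\<And>u e. u \<in> {0..1} \<Longrightarrow> 0 < e \<Longrightarrow> \<exists>N. \<forall>n\<ge>N. \<forall>x. \<bar>Phi_d \<beta> (\<nu>s n) x u - Phi \<beta> \<mu> x u\<bar> \<le> e"
    using Phi_approx[OF \<mu>] by blast
  show ?thesis
  proof (rule smooth_bounded_limit)
    show "smooth_bounded deriv_bound (\<lambda>x. Phi_d \<beta> (\<nu>s n) x u)" for n
      by (rule smooth_bounded_Phi_d[OF \<nu>s(1) u])
  qed (rule \<nu>s(4)[OF u])
qed

lemma nonexpansive_Phi:
  assumes \<mu>: "\<mu> \<in> M01" and u: "u \<in> {0..1}"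
  shows "nonexpansive (\<lambda>x. Phi \<beta> \<mu> x u)"
  unfolding nonexpansive_def
proof (intro allI)
  fix x y
  obtain \<nu>s where \<nu>s: "\<And>n. \<nu>s n \<in> Md01" "(\<lambda>n. d01 (\<nu>s n) \<mu>) \<longlonglongrightarrow> 0"
      "\<And>x u. u \<in> {0..1} \<Longrightarrow> (\<lambda>n. Phi_d \<beta> (\<nu>s n) x u) \<longlonglongrightarrow> Phi \<beta> \<mu> x u"
      "\<And>u e. u \<in> {0..1} \<Longrightarrow> 0 < e \<Longrightarrow> \<exists>N. \<forall>n\<ge>N. \<forall>x. \<bar>Phi_d \<beta> (\<nu>s n) x u - Phi \<beta> \<mu> x u\<bar> \<le> e"
    using Phi_approx[OF \<mu>] by blast
  show "\<bar>Phi \<beta> \<mu> x u - Phi \<beta> \<mu> y u\<bar> \<le> \<bar>x - y\<bar>"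
  proof (rule tendsto_upperbound)
    show "(\<lambda>n. \<bar>Phi_d \<beta> (\<nu>s n) x u - Phi_d \<beta> (\<nu>s n) y u\<bar>) \<longlonglongrightarrow> \<bar>Phi \<beta> \<mu> x u - Phi \<beta> \<mu> y u\<bar>"
      by (intro tendsto_intros \<nu>s(3) u)
  qed (use nonexpansiveD[OF nonexpansive_Phi_d[OF \<nu>s(1) u]] in auto)
qed

lemma Phi_lipschitz_time:
  assumes \<mu>: "\<mu> \<in> M01" and us: "u \<in> {0..1}" "s \<in> {0..1}"
  shows "\<bar>Phi \<beta> \<mu> x u - Phi \<beta> \<mu> x s\<bar> \<le> time_lip * \<bar>u - s\<bar>"
proof -
  obtain \<nu>s where \<nu>s: "\<And>n. \<nu>s n \<in> Md01" "(\<lambda>n. d01 (\<nu>s n) \<mu>) \<longlonglongrightarrow> 0"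
      "\<And>x u. u \<in> {0..1} \<Longrightarrow> (\<lambda>n. Phi_d \<beta> (\<nu>s n) x u) \<longlonglongrightarrow> Phi \<beta> \<mu> x u"
      "\<And>u e. u \<in> {0..1} \<Longrightarrow> 0 < e \<Longrightarrow> \<exists>N. \<forall>n\<ge>N. \<forall>x. \<bar>Phi_d \<beta> (\<nu>s n) x u - Phi \<beta> \<mu> x u\<bar> \<le> e"
    using Phi_approx[OF \<mu>] by blast
  have le: "\<bar>Phi_d \<beta> (\<nu>s n) x u - Phi_d \<beta> (\<nu>s n) x s\<bar> \<le> time_lip * \<bar>u - s\<bar>" for n
    using Phi_d_lipschitz_time[OF \<nu>s(1), of u s n x] Phi_d_lipschitz_time[OF \<nu>s(1), of s u n x] us
    by (cases "u \<le> s") (auto simp: abs_minus_commute)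
  show ?thesis
  proof (rule tendsto_upperbound)
    show "(\<lambda>n. \<bar>Phi_d \<beta> (\<nu>s n) x u - Phi_d \<beta> (\<nu>s n) x s\<bar>) \<longlonglongrightarrow> \<bar>Phi \<beta> \<mu> x u - Phi \<beta> \<mu> x s\<bar>"
      by (intro tendsto_intros \<nu>s(3) us)
  qed (use le in auto)
qed

lemma Phi_lipschitz_measure:
  assumes \<mu>: "\<mu> \<in> M01" "\<mu>' \<in> M01" and u: "u \<in> {0..1}"
  shows "\<bar>Phi \<beta> \<mu> x u - Phi \<beta> \<mu>' x u\<bar> \<le> measure_lip * d01 \<mu> \<mu>'"
proof -
  obtain \<nu>s where \<nu>s: "\<And>n. \<nu>s n \<in> Md01" "(\<lambda>n. d01 (\<nu>s n) \<mu>) \<longlonglongrightarrow> 0"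
      "\<And>x u. u \<in> {0..1} \<Longrightarrow> (\<lambda>n. Phi_d \<beta> (\<nu>s n) x u) \<longlonglongrightarrow> Phi \<beta> \<mu> x u"
      "\<And>u e. u \<in> {0..1} \<Longrightarrow> 0 < e \<Longrightarrow> \<exists>N. \<forall>n\<ge>N. \<forall>x. \<bar>Phi_d \<beta> (\<nu>s n) x u - Phi \<beta> \<mu> x u\<bar> \<le> e"
    using Phi_approx[OF \<mu>(1)] by blast
  show ?thesis
  proof (rule tendsto_le[OF _ _ _ always_eventually])
    show "(\<lambda>n. \<bar>Phi_d \<beta> (\<nu>s n) x u - Phi \<beta> \<mu>' x u\<bar>) \<longlonglongrightarrow> \<bar>Phi \<beta> \<mu> x u - Phi \<beta> \<mu>' x u\<bar>"
      by (intro tendsto_intros \<nu>s(3) u)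
    show "(\<lambda>n. measure_lip * (d01 (\<nu>s n) \<mu> + d01 \<mu> \<mu>')) \<longlonglongrightarrow> measure_lip * d01 \<mu> \<mu>'"
      using tendsto_mult_left[OF tendsto_add[OF \<nu>s(2) tendsto_const[of "d01 \<mu> \<mu>'"]], of measure_lip] by simp
    show "\<forall>n. \<bar>Phi_d \<beta> (\<nu>s n) x u - Phi \<beta> \<mu>' x u\<bar> \<le> measure_lip * (d01 (\<nu>s n) \<mu> + d01 \<mu> \<mu>')"
    proof
      fix n
      have "measure_lip * d01 (\<nu>s n) \<mu>' \<le> measure_lip * (d01 (\<nu>s n) \<mu> + d01 \<mu> \<mu>')"
        by (intro mult_left_mono measure_lip_nonneg d01_triangle Md01_M01 \<nu>s(1) \<mu>)
      with Phi_d_close_Phi[OF \<mu>(2) u \<nu>s(1), of n x]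
      show "\<bar>Phi_d \<beta> (\<nu>s n) x u - Phi \<beta> \<mu>' x u\<bar> \<le> measure_lip * (d01 (\<nu>s n) \<mu> + d01 \<mu> \<mu>')" by linarith
    qed
  qed simp
qed

end

subsection \<open>The Parisi equation for continuous measures\<close>

context parisi_covariance
begin

lemma smooth_Phi: "\<mu> \<in> M01 \<Longrightarrow> u \<in> {0..1} \<Longrightarrow> smooth (\<lambda>x. Phi \<beta> \<mu> x u)"
  by (rule smooth_bounded_smooth[OF smooth_bounded_Phi])

lemma DERIV_dxPhi:
  assumes "\<mu> \<in> M01" "u \<in> {0..1}"
  shows "((\<lambda>y. dxPhi \<beta> \<mu> j y u) has_real_derivative dxPhi \<beta> \<mu> (Suc j) x u) (at x)"
  using smoothD[OF smooth_Phi[OF assms], of j x] unfolding dxPhi_def by simp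

lemma dxPhi_0: "dxPhi \<beta> \<mu> 0 x u = Phi \<beta> \<mu> x u"
  by (simp add: dxPhi_def)

lemma dxPhi_bound: "\<mu> \<in> M01 \<Longrightarrow> u \<in> {0..1} \<Longrightarrow> \<bar>dxPhi \<beta> \<mu> (Suc j) x u\<bar> \<le> deriv_bound j"
  unfolding dxPhi_def by (rule smooth_bounded_le[OF smooth_bounded_Phi])

lemma dxPhi_exists: "\<mu> \<in> M01 \<Longrightarrow> u \<in> {0..1} \<Longrightarrow> dxPhi_exists \<beta> \<mu> j x u"
  unfolding dxPhi_exists_def field_differentiable_def using smoothD[OF smooth_Phi] by blast

text \<open>A modulus of continuity jointly in measure and time and uniform in \<open>x\<close>,
  from interpolation with the common bounds \<open>deriv_bound\<close>. Continuity and uniform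
  convergence in (i) are both special cases.\<close>

lemma dxPhi_close:
  assumes "0 < \<epsilon>"
  shows "\<exists>\<delta>>0. \<forall>\<mu>\<in>M01. \<forall>\<mu>'\<in>M01. \<forall>u\<in>{0..1}. \<forall>u'\<in>{0..1}. measure_lip * d01 \<mu> \<mu>' + time_lip * \<bar>u - u'\<bar> \<le> \<delta> \<longrightarrow>
    (\<forall>x. \<bar>dxPhi \<beta> \<mu> j x u - dxPhi \<beta> \<mu>' j x u'\<bar> \<le> \<epsilon>)"
proof -
  obtain \<delta> where \<delta>: "\<delta> > 0" "\<And>f g x. smooth_bounded deriv_bound f \<Longrightarrow> smooth_bounded deriv_bound g \<Longrightarrow>
      (\<forall>x. \<bar>f x - g x\<bar> \<le> \<delta>) \<Longrightarrow> \<bar>(deriv ^^ j) f x - (deriv ^^ j) g x\<bar> \<le> \<epsilon>"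
    using smooth_bounded_higher_deriv_close[OF assms, of deriv_bound j] by blast
  have "\<bar>dxPhi \<beta> \<mu> j x u - dxPhi \<beta> \<mu>' j x u'\<bar> \<le> \<epsilon>"
    if M: "\<mu> \<in> M01" "\<mu>' \<in> M01" and u: "u \<in> {0..1}" "u' \<in> {0..1}"
      and le: "measure_lip * d01 \<mu> \<mu>' + time_lip * \<bar>u - u'\<bar> \<le> \<delta>" for \<mu> \<mu>' u u' x
    unfolding dxPhi_def
  proof (rule \<delta>(2)[OF smooth_bounded_Phi[OF M(1) u(1)] smooth_bounded_Phi[OF M(2) u(2)]], intro allI)
    fix y
    show "\<bar>Phi \<beta> \<mu> y u - Phi \<beta> \<mu>' y u'\<bar> \<le> \<delta>"
      using Phi_lipschitz_measure[OF M u(1), of y] Phi_lipschitz_time[OF M(2) u, of y] le by linarith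
  qed
  with \<delta>(1) show ?thesis by blast
qed

text \<open>Uniformity in \<open>x\<close> allows the measure and the time to be moved first, at the
  varying point \<open>xs n\<close>; afterwards continuity in \<open>x\<close> of one fixed function
  is enough.\<close>

lemma dxPhi_tendsto:
  assumes M: "\<And>n. \<mu>s n \<in> M01" "\<mu> \<in> M01" and d: "(\<lambda>n. d01 (\<mu>s n) \<mu>) \<longlonglongrightarrow> 0"
    and u: "\<And>n. us n \<in> {0..1}" "u \<in> {0..1}" "us \<longlonglongrightarrow> u" and x: "xs \<longlonglongrightarrow> x"
  shows "(\<lambda>n. dxPhi \<beta> (\<mu>s n) j (xs n) (us n)) \<longlonglongrightarrow> dxPhi \<beta> \<mu> j x u"
proof -
  have "(\<lambda>n. dxPhi \<beta> (\<mu>s n) j (xs n) (us n) - dxPhi \<beta> \<mu> j (xs n) u) \<longlonglongrightarrow> 0"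
  proof (rule LIMSEQ_I)
    fix r :: real assume "0 < r"
    then obtain \<delta> where \<delta>: "\<delta> > 0" "\<And>\<mu> \<mu>' u u' x. \<lbrakk>\<mu> \<in> M01; \<mu>' \<in> M01; u \<in> {0..1}; u' \<in> {0..1};
        measure_lip * d01 \<mu> \<mu>' + time_lip * \<bar>u - u'\<bar> \<le> \<delta>\<rbrakk> \<Longrightarrow> \<bar>dxPhi \<beta> \<mu> j x u - dxPhi \<beta> \<mu>' j x u'\<bar> \<le> r / 2"
      using dxPhi_close[of "r / 2" j] by (metis half_gt_zero)
    have "(\<lambda>n. measure_lip * d01 (\<mu>s n) \<mu> + time_lip * \<bar>us n - u\<bar>) \<longlonglongrightarrow> measure_lip * 0 + time_lip * \<bar>u - u\<bar>"
      by (intro tendsto_intros d u)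
    then have "\<forall>\<^sub>F n in sequentially. measure_lip * d01 (\<mu>s n) \<mu> + time_lip * \<bar>us n - u\<bar> < \<delta>"
      using \<delta>(1) by (intro order_tendstoD(2)) auto
    then obtain N where N: "\<And>n. n \<ge> N \<Longrightarrow> measure_lip * d01 (\<mu>s n) \<mu> + time_lip * \<bar>us n - u\<bar> < \<delta>"
      unfolding eventually_sequentially by blast
    have "norm (dxPhi \<beta> (\<mu>s n) j (xs n) (us n) - dxPhi \<beta> \<mu> j (xs n) u - 0) < r" if "n \<ge> N" for n
      using \<delta>(2)[OF M(1) M(2) u(1) u(2) less_imp_le[OF N[OF that]], of "xs n"] \<open>0 < r\<close> by simp
    then show "\<exists>no. \<forall>n\<ge>no. norm (dxPhi \<beta> (\<mu>s n) j (xs n) (us n) - dxPhi \<beta> \<mu> j (xs n) u - 0) < r"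
      by blast
  qed
  moreover have "(\<lambda>n. dxPhi \<beta> \<mu> j (xs n) u) \<longlonglongrightarrow> dxPhi \<beta> \<mu> j x u"
    by (rule isCont_tendsto_compose[OF DERIV_isCont[OF DERIV_dxPhi[OF M(2) u(2)]] x])
  ultimately show ?thesis using tendsto_add by fastforce
qed

lemma d01_refl: "d01 \<mu> \<mu> = 0"
  by (simp add: d01_def)

lemma dxPhi_continuous:
  assumes M: "\<mu> \<in> M01"
  shows "continuous_on (UNIV \<times> {0..1}) (\<lambda>(x, u). dxPhi \<beta> \<mu> j x u)"
  unfolding continuous_on_sequentially
proof (intro allI ballI impI, elim conjE)
  fix s :: "nat \<Rightarrow> real \<times> real" and p :: "real \<times> real"
  assume p: "p \<in> UNIV \<times> {0..1}" and s: "\<forall>n. s n \<in> UNIV \<times> {0..1}" "s \<longlonglongrightarrow> p"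
  have "(\<lambda>n. dxPhi \<beta> \<mu> j (fst (s n)) (snd (s n))) \<longlonglongrightarrow> dxPhi \<beta> \<mu> j (fst p) (snd p)"
  proof (rule dxPhi_tendsto[OF M M])
    show "snd (s n) \<in> {0..1}" for n using s(1) by (metis mem_Times_iff)
    show "snd p \<in> {0..1}" using p by auto
    show "(\<lambda>n. fst (s n)) \<longlonglongrightarrow> fst p" "(\<lambda>n. snd (s n)) \<longlonglongrightarrow> snd p"
      by (intro tendsto_fst tendsto_snd s(2))+
  qed (simp add: d01_refl)
  then show "((\<lambda>(x, u). dxPhi \<beta> \<mu> j x u) \<circ> s) \<longlonglongrightarrow> (case p of (x, u) \<Rightarrow> dxPhi \<beta> \<mu> j x u)"
    by (simp add: o_def case_prod_beta)
qed

lemma dxPhi_uniform_limit: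
  assumes M: "\<And>n. n \<ge> 1 \<Longrightarrow> \<mu>s n \<in> M01" "\<mu> \<in> M01" and d: "(\<lambda>n. d01 (\<mu>s n) \<mu>) \<longlonglongrightarrow> 0"
  shows "uniform_limit (UNIV \<times> {0..1}) (\<lambda>n (x, u). dxPhi \<beta> (\<mu>s n) j x u) (\<lambda>(x, u). dxPhi \<beta> \<mu> j x u) sequentially"
proof (rule uniform_limitI)
  fix e :: real assume "0 < e"
  then obtain \<delta> where \<delta>: "\<delta> > 0" "\<And>\<mu> \<mu>' u u' x. \<lbrakk>\<mu> \<in> M01; \<mu>' \<in> M01; u \<in> {0..1}; u' \<in> {0..1};
      measure_lip * d01 \<mu> \<mu>' + time_lip * \<bar>u - u'\<bar> \<le> \<delta>\<rbrakk> \<Longrightarrow> \<bar>dxPhi \<beta> \<mu> j x u - dxPhi \<beta> \<mu>' j x u'\<bar> \<le> e / 2"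
    using dxPhi_close[of "e / 2" j] by (metis half_gt_zero)
  have "(\<lambda>n. measure_lip * d01 (\<mu>s n) \<mu>) \<longlonglongrightarrow> measure_lip * 0"
    by (intro tendsto_intros d)
  then have "\<forall>\<^sub>F n in sequentially. measure_lip * d01 (\<mu>s n) \<mu> < \<delta>"
    using \<delta>(1) by (intro order_tendstoD(2)) auto
  then show "\<forall>\<^sub>F n in sequentially. \<forall>p\<in>UNIV \<times> {0..1}.
      dist (case p of (x, u) \<Rightarrow> dxPhi \<beta> (\<mu>s n) j x u) (case p of (x, u) \<Rightarrow> dxPhi \<beta> \<mu> j x u) < e"
    using eventually_ge_at_top[of 1]
  proof eventually_elim
    case (elim n)
    have "dist (dxPhi \<beta> (\<mu>s n) j x u) (dxPhi \<beta> \<mu> j x u) < e" if "u \<in> {0..1}" for x u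
      using \<delta>(2)[OF M(1)[OF elim(2)] M(2) that that, of x] elim(1) \<open>0 < e\<close> by (simp add: dist_real_def)
    then show ?case by auto
  qed
qed

text \<open>On the interval the distribution function is replaced by its value at the right end
  point, and the comparison of chains integrates the difference. The error is the length times an
  increment of the distribution function, hence of smaller order than the length where that function
  is continuous.\<close>

lemma Phi_step_approx:
  assumes M: "\<mu> \<in> M01" and ub: "0 \<le> u" "u \<le> b" "b \<le> 1"
  shows "\<bar>Phi \<beta> \<mu> x u - parisi_step (measure \<mu> {0..b}) (dxi \<beta> b - dxi \<beta> u) (\<lambda>y. Phi \<beta> \<mu> y b) x\<bar> \<le>
    measure_lip * ((b - u) * (measure \<mu> {0..b} - measure \<mu> {0..u}))"
proof -
  let ?F = "\<lambda>t. measure \<mu> {0..t}" and ?C = measure_lip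
  let ?v = "dxi \<beta> b - dxi \<beta> u"
  have m: "0 \<le> ?F b" "?F b \<le> 1" using M01_measure_le_1[OF M] by auto
  have v: "0 \<le> ?v" using dxi_mono[of u b] ub by simp
  have u01: "u \<in> {0..1}" "b \<in> {0..1}" using ub by auto
  obtain \<nu>s where \<nu>s: "\<And>n. \<nu>s n \<in> Md01" "(\<lambda>n. d01 (\<nu>s n) \<mu>) \<longlonglongrightarrow> 0"
    using Md01_approx_sequence[OF M] by blast
  \<comment> \<open>The three copies of \<open>?C * d01 \<nu> \<mu>\<close> stem from replacing
    \<mu> by \<nu> in \<Phi> at time \<open>u\<close>, at time \<open>b\<close>, and in the mass
    function.\<close>
  have le: "\<bar>Phi \<beta> \<mu> x u - parisi_step (?F b) ?v (\<lambda>y. Phi \<beta> \<mu> y b) x\<bar> \<le>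
      3 * (?C * d01 \<nu> \<mu>) + ?C * ((b - u) * (?F b - ?F u))" if \<nu>: "\<nu> \<in> Md01" for \<nu>
  proof -
    have N: "\<nu> \<in> M01" by (rule Md01_M01[OF \<nu>])
    let ?f = "\<lambda>t. \<bar>measure \<nu> {0..t} - ?F t\<bar>" and ?g = "\<lambda>t. \<bar>measure \<nu> {0..t} - ?F b\<bar>"
    have if0: "set_integrable lborel {u..b} ?f" "set_integrable lborel {0..1} ?f"
      using ub by (intro M01_set_integrable_cdf_diff[OF N M]; auto)+
    have ig0: "set_integrable lborel {u..b} ?g" "set_integrable lborel {0..b} ?g"
    proof -
      have "?g \<in> borel_measurable (restrict_space borel {0..1})"
        using M01_measurable_cdf[OF N] by (intro borel_measurable_abs borel_measurable_diff) auto
      moreover have "\<bar>?g t\<bar> \<le> 1" for t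
        using M01_measure_le_1[OF N, of "{0..t}"] measure_nonneg[of \<nu> "{0..t}"] m by linarith
      ultimately show "set_integrable lborel {u..b} ?g" "set_integrable lborel {0..b} ?g"
        using ub by (intro set_integrable_bounded_unit[where C = 1]; auto)+
    qed
    have ic: "set_integrable lborel {u..b} (\<lambda>t. ?F b - ?F u)"
      using ub by (intro set_integrable_bounded_unit[where C = "\<bar>?F b - ?F u\<bar>"]) auto
    have I1: "(LINT t:{u..b}|lborel. ?g t) \<le> (LINT t:{u..b}|lborel. ?f t + (?F b - ?F u))"
    proof (rule set_integral_mono[OF ig0(1) set_integral_add(1)[OF if0(1) ic]])
      fix t assume t: "t \<in> {u..b}"
      then show "?g t \<le> ?f t + (?F b - ?F u)"
        using M01_measure_mono[OF M, of u t] M01_measure_mono[OF M, of t b] ub by auto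
    qed
    have I2: "(LINT t:{u..b}|lborel. ?f t + (?F b - ?F u)) =
        (LINT t:{u..b}|lborel. ?f t) + (LINT t:{u..b}|lborel. ?F b - ?F u)"
      by (rule set_integral_add(2)[OF if0(1) ic])
    have I3: "(LINT t:{u..b}|lborel. ?F b - ?F u) = (b - u) * (?F b - ?F u)"
      unfolding set_lebesgue_integral_def using ub by simp
    have I4: "(LINT t:{u..b}|lborel. ?f t) \<le> d01 \<nu> \<mu>"
      unfolding d01_def set_lebesgue_integral_def
    proof (rule integral_mono)
      show "integrable lborel (\<lambda>t. indicator {u..b} t *\<^sub>R ?f t)" "integrable lborel (\<lambda>t. indicator {0..1} t *\<^sub>R ?f t)"
        using if0 unfolding set_integrable_def by auto
      show "indicator {u..b} t *\<^sub>R ?f t \<le> indicator {0..1} t *\<^sub>R ?f t" for t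
        using ub by (auto simp: indicator_def)
    qed
    have I: "(LINT t:{u..b}|lborel. ?g t) \<le> d01 \<nu> \<mu> + (b - u) * (?F b - ?F u)"
      using I1 I2 I3 I4 by linarith
    have nb: "nonexpansive (\<lambda>y. Phi_d \<beta> \<nu> y b)" by (rule nonexpansive_Phi_d[OF \<nu> u01(2)])
    have "\<bar>Phi_d \<beta> \<nu> x u - parisi_step (?F b) ?v (\<lambda>y. Phi_d \<beta> \<nu> y b) x\<bar> \<le> 0 + ?C * (LINT t:{u..b}|lborel. ?g t)"
      by (rule parisi_chain_compare[OF parisi_chain_Phi_d[OF \<nu> ub(3)] parisi_chain_const[OF nb m ub(3)] ub(3) ig0(2) _ ub(1,2)])
        (simp add: parisi_step_0)
    also have "\<dots> \<le> ?C * (d01 \<nu> \<mu> + (b - u) * (?F b - ?F u))"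
      using I measure_lip_nonneg by (simp add: mult_left_mono)
    finally have 1: "\<bar>Phi_d \<beta> \<nu> x u - parisi_step (?F b) ?v (\<lambda>y. Phi_d \<beta> \<nu> y b) x\<bar> \<le>
        ?C * d01 \<nu> \<mu> + ?C * ((b - u) * (?F b - ?F u))" by (simp add: distrib_left)
    have 2: "\<bar>parisi_step (?F b) ?v (\<lambda>y. Phi_d \<beta> \<nu> y b) x - parisi_step (?F b) ?v (\<lambda>y. Phi \<beta> \<mu> y b) x\<bar> \<le> ?C * d01 \<nu> \<mu>"
      by (rule parisi_step_contraction[OF nb nonexpansive_Phi[OF M u01(2)] v m(1) Phi_d_close_Phi[OF M u01(2) \<nu>]])
    have 3: "\<bar>Phi_d \<beta> \<nu> x u - Phi \<beta> \<mu> x u\<bar> \<le> ?C * d01 \<nu> \<mu>"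
      by (rule Phi_d_close_Phi[OF M u01(1) \<nu>])
    show ?thesis using 1 2 3 by linarith
  qed
  show ?thesis
  proof (rule tendsto_lowerbound)
    have "(\<lambda>n. 3 * (?C * d01 (\<nu>s n) \<mu>) + ?C * ((b - u) * (?F b - ?F u))) \<longlonglongrightarrow> 3 * (?C * 0) + ?C * ((b - u) * (?F b - ?F u))"
      by (intro tendsto_intros \<nu>s(2))
    then show "(\<lambda>n. 3 * (?C * d01 (\<nu>s n) \<mu>) + ?C * ((b - u) * (?F b - ?F u))) \<longlonglongrightarrow> ?C * ((b - u) * (?F b - ?F u))"
      by simp
    show "\<forall>\<^sub>F n in sequentially. \<bar>Phi \<beta> \<mu> x u - parisi_step (?F b) ?v (\<lambda>y. Phi \<beta> \<mu> y b) x\<bar> \<le>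
        3 * (?C * d01 (\<nu>s n) \<mu>) + ?C * ((b - u) * (?F b - ?F u))"
      by (intro always_eventually allI le \<nu>s(1))
  qed simp
qed

text \<open>The right side of the Parisi equation differentiated \<open>j\<close> times in
  \<open>x\<close>; the sum is the Leibniz rule for the squared gradient.\<close>

definition time_deriv :: "real measure \<Rightarrow> nat \<Rightarrow> real \<Rightarrow> real \<Rightarrow> real" where
  "time_deriv \<mu> j x u = - (d2 u / 2) * (dxPhi \<beta> \<mu> (Suc (Suc j)) x u + measure \<mu> {0..u} *
    (\<Sum>i\<le>j. real (j choose i) * dxPhi \<beta> \<mu> (Suc i) x u * dxPhi \<beta> \<mu> (Suc (j - i)) x u))"

text \<open>A difference quotient is that of a single step up to an increment of the distribution
  function. The expansion of the step leaves an error of order \<open>sqrt v\<close>, and the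
  quotient of the variance by the length tends to \<open>d2\<close>.\<close>

lemma DERIV_Phi_time:
  assumes M: "\<mu> \<in> M01" and F: "continuous_on {0..1} (\<lambda>u. measure \<mu> {0..u})" and s: "s \<in> {0..1}"
  shows "((\<lambda>u. Phi \<beta> \<mu> x u) has_real_derivative time_deriv \<mu> 0 x s) (at s within {0..1})"
proof -
  let ?F = "\<lambda>t. measure \<mu> {0..t}"
  obtain C v0 where v0: "0 < v0" and C: "\<forall>f m x v. nonexpansive f \<and> smooth_bounded deriv_bound f \<and> 0 \<le> m \<and> m \<le> 1 \<and> 0 \<le> v \<and> v \<le> v0 \<longrightarrow>
      \<bar>parisi_step m v f x - f x - v / 2 * ((deriv ^^ 2) f x + m * (deriv f x)\<^sup>2)\<bar> \<le> C * v * sqrt v"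
    using parisi_step_expansion[of deriv_bound] by blast
  define H where "H t = dxPhi \<beta> \<mu> 2 x t + ?F t * (dxPhi \<beta> \<mu> 1 x t)\<^sup>2" for t
  have est: "\<bar>(Phi \<beta> \<mu> x b - Phi \<beta> \<mu> x u) / (b - u) + ((dxi \<beta> b - dxi \<beta> u) / (b - u)) / 2 * H b\<bar> \<le>
      \<bar>C\<bar> * L * sqrt (dxi \<beta> b - dxi \<beta> u) + measure_lip * (?F b - ?F u)"
    if ub: "0 \<le> u" "u < b" "b \<le> 1" "dxi \<beta> b - dxi \<beta> u \<le> v0" for u b
  proof -
    let ?v = "dxi \<beta> b - dxi \<beta> u"
    have b01: "b \<in> {0..1}" using ub by auto
    have v: "0 \<le> ?v" "?v \<le> L * (b - u)" using dxi_mono[of u b] dxi_lipschitz[of u b] ub by auto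
    have "\<bar>parisi_step (?F b) ?v (\<lambda>y. Phi \<beta> \<mu> y b) x - Phi \<beta> \<mu> x b - ?v / 2 * H b\<bar> \<le> C * ?v * sqrt ?v"
      using C[rule_format, of "\<lambda>y. Phi \<beta> \<mu> y b" "?F b" ?v x] nonexpansive_Phi[OF M b01] smooth_bounded_Phi[OF M b01]
        M01_measure_le_1[OF M] v(1) ub(4)
      by (simp add: H_def dxPhi_def)
    also have "\<dots> \<le> \<bar>C\<bar> * (L * (b - u)) * sqrt ?v"
      by (intro mult_mono v abs_ge_self) (use v in auto)
    finally have "\<bar>Phi \<beta> \<mu> x u - Phi \<beta> \<mu> x b - ?v / 2 * H b\<bar> \<le>
        \<bar>C\<bar> * (L * (b - u)) * sqrt ?v + measure_lip * ((b - u) * (?F b - ?F u))"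
      using Phi_step_approx[OF M ub(1) less_imp_le[OF ub(2)] ub(3), of x] by linarith
    then have "\<bar>Phi \<beta> \<mu> x u - Phi \<beta> \<mu> x b - ?v / 2 * H b\<bar> / (b - u) \<le>
        (\<bar>C\<bar> * (L * (b - u)) * sqrt ?v + measure_lip * ((b - u) * (?F b - ?F u))) / (b - u)"
      using ub by (intro divide_right_mono) auto
    also have "\<dots> = \<bar>C\<bar> * L * sqrt ?v + measure_lip * (?F b - ?F u)"
      using ub by (simp add: add_divide_distrib)
    also have "\<bar>Phi \<beta> \<mu> x u - Phi \<beta> \<mu> x b - ?v / 2 * H b\<bar> / (b - u) =
        \<bar>(Phi \<beta> \<mu> x b - Phi \<beta> \<mu> x u) / (b - u) + (?v / (b - u)) / 2 * H b\<bar>"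
    proof -
      have "(B - A) / d + v / d / 2 * h = - ((A - B - v / 2 * h) / d)" for A B d v h :: real
        by (simp add: diff_divide_distrib)
      then show ?thesis using ub by (simp only: abs_minus_cancel abs_divide)
    qed
    finally show ?thesis .
  qed
  have "((\<lambda>y. (Phi \<beta> \<mu> x y - Phi \<beta> \<mu> x s) / (y - s)) \<longlongrightarrow> time_deriv \<mu> 0 x s) (at s within {0..1})"
    unfolding tendsto_at_iff_sequentially
  proof (intro allI impI)
    fix y :: "nat \<Rightarrow> real" assume y: "\<forall>n. y n \<in> {0..1} - {s}" and lim: "y \<longlonglongrightarrow> s"
    \<comment> \<open>Steps run backwards in time, so the expansion is always around the later
      point. Ordering the two points treats left and right difference quotients at once.\<close>
    define b u where "b n = max (y n) s" and "u n = min (y n) s" for n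
    have bu: "0 \<le> u n" "u n < b n" "b n \<le> 1" "u n \<in> {0..1}" "b n \<in> {0..1}" for n
      using spec[OF y, of n] s by (auto simp: b_def u_def max_def min_def)
    have q: "(g (b n) - g (u n)) / (b n - u n) = (g (y n) - g s) / (y n - s)" for g :: "real \<Rightarrow> real" and n
    proof (cases "y n \<ge> s")
      case True
      then show ?thesis by (simp add: b_def u_def)
    next
      case False
      then have "b n = s" "u n = y n" by (simp_all add: b_def u_def)
      then show ?thesis using minus_divide_divide[of "g (y n) - g s" "y n - s"] by simp
    qed
    have bl: "b \<longlonglongrightarrow> s" "u \<longlonglongrightarrow> s"
      using tendsto_max[OF lim tendsto_const[of s]] tendsto_min[OF lim tendsto_const[of s]]
      by (simp_all add: b_def[abs_def] u_def[abs_def])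
    have Fl: "(\<lambda>n. ?F (b n)) \<longlonglongrightarrow> ?F s" "(\<lambda>n. ?F (u n)) \<longlonglongrightarrow> ?F s"
      using continuous_on_tendsto_compose[OF F bl(1) s] continuous_on_tendsto_compose[OF F bl(2) s] bu(4,5) by auto
    have xc: "isCont (dxi \<beta>) s" by (rule DERIV_isCont[OF DERIV_dxi[OF s]])
    have vl: "(\<lambda>n. dxi \<beta> (b n) - dxi \<beta> (u n)) \<longlonglongrightarrow> dxi \<beta> s - dxi \<beta> s"
      by (intro tendsto_diff isCont_tendsto_compose[OF xc] bl)
    have Hl: "(\<lambda>n. H (b n)) \<longlonglongrightarrow> H s"
      unfolding H_def
      by (intro tendsto_intros Fl dxPhi_tendsto[where \<mu>s = "\<lambda>_. \<mu>"] M bu s bl) (simp_all add: d01_refl)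
    have dl: "(\<lambda>n. (dxi \<beta> (b n) - dxi \<beta> (u n)) / (b n - u n)) \<longlonglongrightarrow> d2 s"
    proof -
      have "((\<lambda>y. (dxi \<beta> y - dxi \<beta> s) / (y - s)) \<longlongrightarrow> d2 s) (at s within {0..1})"
        using has_field_derivative_at_within[OF DERIV_dxi[OF s], of "{0..1}"] unfolding has_field_derivative_iff .
      then show ?thesis
        using y lim unfolding tendsto_at_iff_sequentially q by (simp add: o_def)
    qed
    have "(\<lambda>n. \<bar>C\<bar> * L * sqrt (dxi \<beta> (b n) - dxi \<beta> (u n)) + measure_lip * (?F (b n) - ?F (u n))) \<longlonglongrightarrow>
        \<bar>C\<bar> * L * sqrt (dxi \<beta> s - dxi \<beta> s) + measure_lip * (?F s - ?F s)"
      by (intro tendsto_intros vl Fl)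
    then have el: "(\<lambda>n. \<bar>C\<bar> * L * sqrt (dxi \<beta> (b n) - dxi \<beta> (u n)) + measure_lip * (?F (b n) - ?F (u n))) \<longlonglongrightarrow> 0"
      by simp
    have "\<forall>\<^sub>F n in sequentially. dxi \<beta> (b n) - dxi \<beta> (u n) < v0"
      using vl v0 by (intro order_tendstoD(2)) auto
    then have "\<forall>\<^sub>F n in sequentially. norm ((Phi \<beta> \<mu> x (b n) - Phi \<beta> \<mu> x (u n)) / (b n - u n) +
        ((dxi \<beta> (b n) - dxi \<beta> (u n)) / (b n - u n)) / 2 * H (b n)) \<le>
        \<bar>C\<bar> * L * sqrt (dxi \<beta> (b n) - dxi \<beta> (u n)) + measure_lip * (?F (b n) - ?F (u n))"
    proof eventually_elim
      case (elim n)
      then show ?case using est[OF bu(1-3)[of n]] by simp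
    qed
    then have "(\<lambda>n. (Phi \<beta> \<mu> x (b n) - Phi \<beta> \<mu> x (u n)) / (b n - u n) +
        ((dxi \<beta> (b n) - dxi \<beta> (u n)) / (b n - u n)) / 2 * H (b n)) \<longlonglongrightarrow> 0"
      by (rule Lim_null_comparison) (rule el)
    from tendsto_diff[OF this tendsto_mult[OF tendsto_divide[OF dl tendsto_const[of 2]] Hl]]
    have "(\<lambda>n. (Phi \<beta> \<mu> x (b n) - Phi \<beta> \<mu> x (u n)) / (b n - u n)) \<longlonglongrightarrow> - (d2 s / 2 * H s)" by simp
    moreover have "- (d2 s / 2 * H s) = time_deriv \<mu> 0 x s"
      by (simp add: time_deriv_def H_def numeral_2_eq_2 power2_eq_square)
    ultimately show "((\<lambda>y. (Phi \<beta> \<mu> x y - Phi \<beta> \<mu> x s) / (y - s)) \<circ> y) \<longlonglongrightarrow> time_deriv \<mu> 0 x s"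
      unfolding q o_def by simp
  qed
  then show ?thesis by (simp add: has_field_derivative_iff)
qed

lemma time_deriv_continuous:
  assumes M: "\<mu> \<in> M01" and F: "continuous_on {0..1} (\<lambda>u. measure \<mu> {0..u})"
  shows "continuous_on (UNIV \<times> {0..1}) (\<lambda>(x, u). time_deriv \<mu> j x u)"
proof -
  have D: "continuous_on (UNIV \<times> {0..1}) (\<lambda>p. dxPhi \<beta> \<mu> k (fst p) (snd p))" for k
    using dxPhi_continuous[OF M, of k] by (simp add: case_prod_beta')
  have c: "continuous_on (UNIV \<times> {0..1}) (\<lambda>p :: real \<times> real. g (snd p))" if "continuous_on {0..1} g" for g :: "real \<Rightarrow> real"
    by (rule continuous_on_compose2[OF that continuous_on_snd[OF continuous_on_id]]) auto
  show ?thesis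
    unfolding time_deriv_def case_prod_beta' by (intro continuous_intros D c[OF F] c[OF d2_continuous]) auto
qed

lemma DERIV_time_deriv:
  assumes M: "\<mu> \<in> M01" and u: "u \<in> {0..1}"
  shows "((\<lambda>x. time_deriv \<mu> j x u) has_real_derivative time_deriv \<mu> (Suc j) x u) (at x)"
proof -
  define f where "f x = Phi \<beta> \<mu> x u" for x
  define c where "c = - (d2 u / 2)"
  define m where "m = measure \<mu> {0..u}"
  define G where "G x = c * (deriv ^^ 2) f x + (c * m) * (deriv f x * deriv f x)" for x
  have sm: "smooth f" unfolding f_def by (rule smooth_Phi[OF M u])
  have sq: "smooth (\<lambda>x. deriv f x * deriv f x)" by (intro smooth_mult smooth_deriv sm)
  have sG: "smooth G"
    unfolding G_def by (intro smooth_lincomb smooth_higher_deriv sm sq)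
  have "(deriv ^^ k) G y = time_deriv \<mu> k y u" for k y
  proof -
    have "(deriv ^^ k) G y = c * (deriv ^^ k) ((deriv ^^ 2) f) y + (c * m) * (deriv ^^ k) (\<lambda>x. deriv f x * deriv f x) y"
      unfolding G_def by (rule higher_deriv_lincomb[OF smooth_higher_deriv[OF sm] sq])
    also have "(deriv ^^ k) ((deriv ^^ 2) f) y = (deriv ^^ Suc (Suc k)) f y"
      by (simp add: numeral_2_eq_2 funpow_swap1)
    also have "(deriv ^^ k) (\<lambda>x. deriv f x * deriv f x) y =
        (\<Sum>i\<le>k. real (k choose i) * (deriv ^^ Suc i) f y * (deriv ^^ Suc (k - i)) f y)"
      by (subst higher_deriv_mult_real[OF smooth_deriv[OF sm] smooth_deriv[OF sm]]) (simp only: higher_deriv_deriv)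
    finally show ?thesis
      unfolding time_deriv_def dxPhi_def f_def c_def m_def by (simp only: distrib_left mult.assoc)
  qed
  with smoothD[OF sG, of j x] show ?thesis
    by (metis (no_types, lifting) ext)
qed

text \<open>The integrated equation avoids interchanging the two partial derivatives. Its right side
  is differentiated in \<open>x\<close> by the Leibniz rule for parameter integrals, its left side
  by the known smoothness, and uniqueness of the derivative raises the order by one.\<close>

lemma dxPhi_time_integral:
  assumes M: "\<mu> \<in> M01" and F: "continuous_on {0..1} (\<lambda>u. measure \<mu> {0..u})" and s: "s \<in> {0..1}"
  shows "dxPhi \<beta> \<mu> j x s - dxPhi \<beta> \<mu> j x 0 = integral {0..s} (\<lambda>t. time_deriv \<mu> j x t)"
proof (induction j arbitrary: x)
  case 0
  have "((\<lambda>t. time_deriv \<mu> 0 x t) has_integral Phi \<beta> \<mu> x s - Phi \<beta> \<mu> x 0) {0..s}"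
  proof (rule fundamental_theorem_of_calculus)
    fix t assume "t \<in> {0..s}"
    then have "t \<in> {0..1}" using s by auto
    from DERIV_Phi_time[OF M F this, of x]
    have "(Phi \<beta> \<mu> x has_real_derivative time_deriv \<mu> 0 x t) (at t within {0..s})"
      by (rule DERIV_subset) (use s in auto)
    then show "(Phi \<beta> \<mu> x has_vector_derivative time_deriv \<mu> 0 x t) (at t within {0..s})"
      by (simp add: has_real_derivative_iff_has_vector_derivative)
  qed (use s in auto)
  then show ?case by (simp add: dxPhi_0 integral_unique)
next
  case (Suc j)
  have cont: "continuous_on (UNIV \<times> {0..s}) (\<lambda>(x, u). time_deriv \<mu> k x u)" for k
    by (rule continuous_on_subset[OF time_deriv_continuous[OF M F]]) (use s in auto)
  have int: "(\<lambda>t. time_deriv \<mu> k y t) integrable_on {0..s}" for k y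
  proof (rule integrable_continuous_real)
    have "continuous_on {0..s} ((\<lambda>(x, u). time_deriv \<mu> k x u) \<circ> (\<lambda>t. (y, t)))"
      by (rule continuous_on_compose) (auto intro!: continuous_intros continuous_on_subset[OF cont])
    then show "continuous_on {0..s} (\<lambda>t. time_deriv \<mu> k y t)" by (simp add: o_def)
  qed
  have "((\<lambda>x. integral (cbox 0 s) (\<lambda>t. time_deriv \<mu> j x t)) has_real_derivative
      integral (cbox 0 s) (\<lambda>t. time_deriv \<mu> (Suc j) x t)) (at x within UNIV)"
  proof (rule leibniz_rule_field_derivative)
    show "((\<lambda>x. time_deriv \<mu> j x t) has_real_derivative time_deriv \<mu> (Suc j) y t) (at y within UNIV)"
      if "t \<in> cbox 0 s" for y t
      using that s by (intro DERIV_time_deriv[OF M]) auto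
  qed (use int cont in auto)
  then have 1: "((\<lambda>x. dxPhi \<beta> \<mu> j x s - dxPhi \<beta> \<mu> j x 0) has_real_derivative integral {0..s} (\<lambda>t. time_deriv \<mu> (Suc j) x t)) (at x)"
    unfolding Suc.IH by simp
  have 2: "((\<lambda>x. dxPhi \<beta> \<mu> j x s - dxPhi \<beta> \<mu> j x 0) has_real_derivative dxPhi \<beta> \<mu> (Suc j) x s - dxPhi \<beta> \<mu> (Suc j) x 0) (at x)"
    using s by (intro DERIV_diff DERIV_dxPhi[OF M]) auto
  show ?case by (rule DERIV_unique[OF 2 1])
qed

lemma DERIV_dxPhi_time:
  assumes M: "\<mu> \<in> M01" and F: "continuous_on {0..1} (\<lambda>u. measure \<mu> {0..u})" and s: "s \<in> {0..1}"
  shows "((\<lambda>u. dxPhi \<beta> \<mu> j x u) has_real_derivative time_deriv \<mu> j x s) (at s within {0..1})"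
proof -
  have "continuous_on {0..1} ((\<lambda>(x, u). time_deriv \<mu> j x u) \<circ> (\<lambda>t. (x, t)))"
    by (rule continuous_on_compose) (auto intro!: continuous_intros continuous_on_subset[OF time_deriv_continuous[OF M F]])
  then have "continuous_on {0..1} (\<lambda>t. time_deriv \<mu> j x t)" by (simp add: o_def)
  then have "((\<lambda>u. integral {0..u} (\<lambda>t. time_deriv \<mu> j x t)) has_real_derivative time_deriv \<mu> j x s) (at s within {0..1})"
    by (rule integral_has_real_derivative[OF _ s])
  from DERIV_add[OF DERIV_const[of "dxPhi \<beta> \<mu> j x 0"] this]
  have "((\<lambda>u. dxPhi \<beta> \<mu> j x 0 + integral {0..u} (\<lambda>t. time_deriv \<mu> j x t)) has_real_derivative time_deriv \<mu> j x s) (at s within {0..1})"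
    by simp
  then show ?thesis
  proof (rule has_field_derivative_transform_within[OF _ zero_less_one s])
    fix t assume "t \<in> {0..1::real}"
    then show "dxPhi \<beta> \<mu> j x 0 + integral {0..t} (\<lambda>t. time_deriv \<mu> j x t) = dxPhi \<beta> \<mu> j x t"
      using dxPhi_time_integral[OF M F, of t j x] by simp
  qed
qed

end

subsection \<open>Expectations weighted by the exponential of W\<close>

text \<open>For a polynomial \<open>p\<close>, integration by parts bounds the difference of
  integrals by the supremum of the derivative times \<open>d01\<close>. Weierstrass approximation
  then reaches continuous \<open>g\<close>: approximating under each of the two measures and
  changing the measure cost \<open>r / 4\<close> each.\<close>

lemma M01_integral_tendsto:
  assumes M: "\<And>n. \<mu>s n \<in> M01" "\<mu> \<in> M01" and d: "(\<lambda>n. d01 (\<mu>s n) \<mu>) \<longlonglongrightarrow> 0"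
    and g: "continuous_on UNIV (g :: real \<Rightarrow> real)"
  shows "(\<lambda>n. LINT t|\<mu>s n. g t) \<longlonglongrightarrow> (LINT t|\<mu>. g t)"
proof (rule LIMSEQ_I)
  fix r :: real assume r: "0 < r"
  have "compact {0..1::real}" "continuous_on {0..1} g" by (auto intro: continuous_on_subset[OF g])
  from Stone_Weierstrass_real_polynomial_function[OF this, of "r / 4"] r
  obtain p where p: "real_polynomial_function p" "\<And>x. x \<in> {0..1} \<Longrightarrow> \<bar>g x - p x\<bar> < r / 4" by auto
  obtain p' where p': "real_polynomial_function p'" "\<forall>x. (p has_real_derivative p' x) (at x)"
    using has_real_derivative_polynomial_function[OF p(1)] by blast
  have cp: "continuous_on UNIV p" "continuous_on UNIV p'"
    using p(1) p'(1) continuous_on_polymonial_function real_polynomial_function_eq by blast+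
  obtain C where C: "\<And>x. x \<in> {0..1} \<Longrightarrow> \<bar>p' x\<bar> \<le> C"
    using continuous_bounded_unit[OF cp(2)] by blast
  have C0: "0 \<le> C" using C[of 0] by simp
  have gp: "\<bar>(LINT t|\<nu>. g t) - (LINT t|\<nu>. p t)\<bar> \<le> r / 4" if N: "\<nu> \<in> M01" for \<nu>
  proof -
    interpret N: prob_space \<nu> by (rule M01_prob_space[OF N])
    have i: "integrable \<nu> g" "integrable \<nu> p"
      by (intro M01_integrable_continuous[OF N] g cp)+
    have "\<bar>(LINT t|\<nu>. g t) - (LINT t|\<nu>. p t)\<bar> = \<bar>LINT t|\<nu>. g t - p t\<bar>"
      by (simp add: Bochner_Integration.integral_diff[OF i])
    also have "\<dots> \<le> (LINT t|\<nu>. \<bar>g t - p t\<bar>)" by (rule integral_abs_bound)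
    also have "\<dots> \<le> (LINT t|\<nu>. r / 4)"
    proof (rule integral_mono)
      show "integrable \<nu> (\<lambda>t. \<bar>g t - p t\<bar>)" using i by auto
      fix t assume "t \<in> space \<nu>"
      then show "\<bar>g t - p t\<bar> \<le> r / 4" using p(2)[of t] M01_space[OF N] by (simp add: less_imp_le)
    qed simp
    finally show ?thesis by (simp add: N.prob_space)
  qed
  have pp: "\<bar>(LINT t|\<mu>s n. p t) - (LINT t|\<mu>. p t)\<bar> \<le> C * d01 (\<mu>s n) \<mu>" for n
  proof -
    let ?F = "\<lambda>t. measure (\<mu>s n) {0..t}" and ?G = "\<lambda>t. measure \<mu> {0..t}"
    have ip: "set_integrable lborel {0..1} (\<lambda>u. p' u * measure \<nu> {0..u})" if N: "\<nu> \<in> M01" for \<nu>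
    proof (rule set_integrable_bounded_unit[where C = C])
      have "p' \<in> borel_measurable (restrict_space borel {0..1})"
        by (intro measurable_restrict_space1 borel_measurable_continuous_onI cp)
      then show "(\<lambda>u. p' u * measure \<nu> {0..u}) \<in> borel_measurable (restrict_space borel {0..1})"
        by (intro borel_measurable_times M01_measurable_cdf[OF N])
      show "\<bar>p' u * measure \<nu> {0..u}\<bar> \<le> C" if "u \<in> {0..1}" for u
        unfolding abs_mult using mult_mono[OF C[OF that] M01_measure_le_1[OF N, of "{0..u}"] C0] by simp
    qed auto
    have "(LINT t|\<mu>s n. p t) - (LINT t|\<mu>. p t) =
        (LINT u:{0..1}|lborel. p' u * ?G u) - (LINT u:{0..1}|lborel. p' u * ?F u)"
      using M01_integral_cdf[OF M(1) _ cp(2), of p n] M01_integral_cdf[OF M(2) _ cp(2), of p] p'(2) by simp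
    also have "\<dots> = (LINT u:{0..1}|lborel. p' u * ?G u - p' u * ?F u)"
      by (rule set_integral_diff(2)[symmetric]) (intro ip M)+
    finally have "\<bar>(LINT t|\<mu>s n. p t) - (LINT t|\<mu>. p t)\<bar> = \<bar>LINT u:{0..1}|lborel. p' u * ?G u - p' u * ?F u\<bar>"
      by simp
    also have "\<dots> \<le> (LINT u|lborel. \<bar>indicator {0..1} u *\<^sub>R (p' u * ?G u - p' u * ?F u)\<bar>)"
      unfolding set_lebesgue_integral_def by (rule integral_abs_bound)
    also have "\<dots> \<le> (LINT u|lborel. C * (indicator {0..1} u *\<^sub>R \<bar>?F u - ?G u\<bar>))"
    proof (rule integral_mono)
      show "integrable lborel (\<lambda>u. \<bar>indicator {0..1} u *\<^sub>R (p' u * ?G u - p' u * ?F u)\<bar>)"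
        using set_integral_diff(1)[OF ip[OF M(2)] ip[OF M(1)[of n]]] unfolding set_integrable_def by (rule integrable_abs)
      show "integrable lborel (\<lambda>u. C * (indicator {0..1} u *\<^sub>R \<bar>?F u - ?G u\<bar>))"
        using M01_set_integrable_cdf_diff[OF M(1)[of n] M(2), of "{0..1}"] unfolding set_integrable_def
        by (intro integrable_mult_right) auto
      fix u :: real
      show "\<bar>indicator {0..1} u *\<^sub>R (p' u * ?G u - p' u * ?F u)\<bar> \<le> C * (indicator {0..1} u *\<^sub>R \<bar>?F u - ?G u\<bar>)"
      proof (cases "u \<in> {0..1}")
        case True
        have "\<bar>p' u * ?G u - p' u * ?F u\<bar> = \<bar>p' u\<bar> * \<bar>?F u - ?G u\<bar>"
          by (simp add: right_diff_distrib[symmetric] abs_mult abs_minus_commute)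
        also have "\<dots> \<le> C * \<bar>?F u - ?G u\<bar>" by (intro mult_right_mono C True) auto
        finally show ?thesis using True by simp
      qed simp
    qed
    also have "\<dots> = C * d01 (\<mu>s n) \<mu>" unfolding d01_def set_lebesgue_integral_def by simp
    finally show ?thesis .
  qed
  have "(\<lambda>n. C * d01 (\<mu>s n) \<mu>) \<longlonglongrightarrow> C * 0" by (intro tendsto_intros d)
  then have "\<forall>\<^sub>F n in sequentially. C * d01 (\<mu>s n) \<mu> < r / 4"
    using r by (intro order_tendstoD(2)) auto
  then obtain N where N: "\<And>n. n \<ge> N \<Longrightarrow> C * d01 (\<mu>s n) \<mu> < r / 4"
    unfolding eventually_sequentially by blast
  have "norm ((LINT t|\<mu>s n. g t) - (LINT t|\<mu>. g t)) < r" if "n \<ge> N" for n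
    using gp[OF M(1)[of n]] gp[OF M(2)] pp[of n] N[OF that] r unfolding real_norm_def by linarith
  then show "\<exists>no. \<forall>n\<ge>no. norm ((LINT t|\<mu>s n. g t) - (LINT t|\<mu>. g t)) < r" by blast
qed

text \<open>Bounded second moments give uniform integrability. Concretely
  \<open>\<bar>Y\<bar> \<le> min \<bar>Y\<bar> R + Y^2 / R\<close>: the first summand has vanishing
  mean by dominated convergence, the second a mean that is small for large \<open>R\<close>.\<close>

lemma (in prob_space) expectation_tendsto_bounded_second_moment:
  fixes Z :: "'a \<Rightarrow> real" and Zs :: "nat \<Rightarrow> 'a \<Rightarrow> real"
  assumes Zs[measurable]: "\<And>n. Zs n \<in> borel_measurable M" and Z[measurable]: "Z \<in> borel_measurable M"
    and sq: "\<And>n. integrable M (\<lambda>x. (Zs n x)\<^sup>2)" "integrable M (\<lambda>x. (Z x)\<^sup>2)"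
    and K: "\<And>n. expectation (\<lambda>x. (Zs n x)\<^sup>2) \<le> K" "expectation (\<lambda>x. (Z x)\<^sup>2) \<le> K"
    and lim: "\<And>x. x \<in> space M \<Longrightarrow> (\<lambda>n. Zs n x) \<longlonglongrightarrow> Z x"
  shows "(\<lambda>n. expectation (Zs n)) \<longlonglongrightarrow> expectation Z"
proof (rule LIMSEQ_I)
  fix r :: real assume r: "0 < r"
  have "0 \<le> expectation (\<lambda>x. (Z x)\<^sup>2)" by (intro integral_nonneg_AE) auto
  then have K0: "0 \<le> K" using K(2) by linarith
  \<comment> \<open>The difference has second moment at most \<open>4 * K\<close>, and this choice
    makes \<open>4 * K / R\<close> less than \<open>r / 2\<close>, also when
    \<open>K = 0\<close>.\<close>
  define R where "R = 8 * (K + 1) / r"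
  have R: "0 < R" using r K0 by (simp add: R_def)
  have "4 * K / R < r / 2"
  proof -
    have "4 * K / R = (r / 2) * (K / (K + 1))" using r K0 by (simp add: R_def field_simps)
    also have "\<dots> < (r / 2) * 1" using r K0 by (intro mult_strict_left_mono) (auto simp: field_simps)
    finally show ?thesis by simp
  qed
  define Y where "Y n x = Zs n x - Z x" for n x
  have iZ: "integrable M Z" "integrable M (Zs n)" for n
    using sq by (auto intro: square_integrable_imp_integrable)
  have Ym[measurable]: "Y n \<in> borel_measurable M" for n unfolding Y_def by measurable
  have Y2le: "(Y n x)\<^sup>2 \<le> 2 * (Zs n x)\<^sup>2 + 2 * (Z x)\<^sup>2" for n x
    unfolding Y_def using zero_le_power2[of "Zs n x + Z x"] by (simp add: power2_eq_square algebra_simps)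
  have iY2b: "integrable M (\<lambda>x. 2 * (Zs n x)\<^sup>2 + 2 * (Z x)\<^sup>2)" for n
    using sq by auto
  have iY2: "integrable M (\<lambda>x. (Y n x)\<^sup>2)" for n
    by (rule Bochner_Integration.integrable_bound[OF iY2b[of n]]) (use Y2le in auto)
  have eY2: "expectation (\<lambda>x. (Y n x)\<^sup>2) \<le> 4 * K" for n
  proof -
    have "expectation (\<lambda>x. (Y n x)\<^sup>2) \<le> expectation (\<lambda>x. 2 * (Zs n x)\<^sup>2 + 2 * (Z x)\<^sup>2)"
      by (rule integral_mono[OF iY2 iY2b Y2le])
    also have "\<dots> = 2 * expectation (\<lambda>x. (Zs n x)\<^sup>2) + 2 * expectation (\<lambda>x. (Z x)\<^sup>2)"
      using sq by simp
    finally show ?thesis using K(1)[of n] K(2) by linarith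
  qed
  have im: "integrable M (\<lambda>x. min \<bar>Y n x\<bar> R)" for n
    by (rule integrable_const_bound[where B = R]) (use R in auto)
  have "(\<lambda>n. expectation (\<lambda>x. min \<bar>Y n x\<bar> R)) \<longlonglongrightarrow> expectation (\<lambda>x. 0)"
  proof (rule integral_dominated_convergence[where w = "\<lambda>_. R"])
    show "AE x in M. (\<lambda>n. min \<bar>Y n x\<bar> R) \<longlonglongrightarrow> 0"
    proof (rule AE_I2)
      fix x assume "x \<in> space M"
      then have "(\<lambda>n. min \<bar>Zs n x - Z x\<bar> R) \<longlonglongrightarrow> min \<bar>Z x - Z x\<bar> R"
        by (intro tendsto_intros lim)
      then show "(\<lambda>n. min \<bar>Y n x\<bar> R) \<longlonglongrightarrow> 0" using R by (simp add: Y_def)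
    qed
  qed (use R in auto)
  then have "\<forall>\<^sub>F n in sequentially. expectation (\<lambda>x. min \<bar>Y n x\<bar> R) < r / 2"
    using r by (intro order_tendstoD(2)) auto
  then obtain N where N: "\<And>n. n \<ge> N \<Longrightarrow> expectation (\<lambda>x. min \<bar>Y n x\<bar> R) < r / 2"
    unfolding eventually_sequentially by blast
  have "norm (expectation (Zs n) - expectation Z) < r" if "n \<ge> N" for n
  proof -
    have iY: "integrable M (Y n)" unfolding Y_def using iZ by auto
    have "\<bar>expectation (Zs n) - expectation Z\<bar> = \<bar>expectation (Y n)\<bar>"
      unfolding Y_def by (subst Bochner_Integration.integral_diff[OF iZ(2,1)]) simp
    also have "\<dots> \<le> expectation (\<lambda>x. \<bar>Y n x\<bar>)" by (rule integral_abs_bound)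
    also have "\<dots> \<le> expectation (\<lambda>x. min \<bar>Y n x\<bar> R + (Y n x)\<^sup>2 / R)"
    proof (rule integral_mono)
      show "integrable M (\<lambda>x. min \<bar>Y n x\<bar> R + (Y n x)\<^sup>2 / R)"
        using im[of n] iY2[of n] by auto
      fix x
      show "\<bar>Y n x\<bar> \<le> min \<bar>Y n x\<bar> R + (Y n x)\<^sup>2 / R"
      proof (cases "\<bar>Y n x\<bar> \<le> R")
        case False
        then have "R * \<bar>Y n x\<bar> \<le> \<bar>Y n x\<bar> * \<bar>Y n x\<bar>" by (intro mult_right_mono) auto
        then have "\<bar>Y n x\<bar> \<le> (Y n x)\<^sup>2 / R" using R by (simp add: field_simps power2_eq_square)
        then show ?thesis using R by (simp add: min_def)
      qed (use R in simp)
    qed (use iY in auto)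
    also have "\<dots> = expectation (\<lambda>x. min \<bar>Y n x\<bar> R) + expectation (\<lambda>x. (Y n x)\<^sup>2) / R"
      using im[of n] iY2[of n] by simp
    also have "\<dots> \<le> expectation (\<lambda>x. min \<bar>Y n x\<bar> R) + 4 * K / R"
      using eY2[of n] R by (intro add_left_mono divide_right_mono) auto
    finally show ?thesis using N[OF that] \<open>4 * K / R < r / 2\<close> by simp
  qed
  then show "\<exists>no. \<forall>n\<ge>no. norm (expectation (Zs n) - expectation Z) < r" by blast
qed

lemma nn_integral_normal_distributed:
  assumes "distributed \<Omega> lborel X (normal_density 0 (sqrt v))" "0 < v" and [measurable]: "f \<in> borel_measurable borel"
  shows "(\<integral>\<^sup>+ \<omega>. f (X \<omega>) \<partial>\<Omega>) = (\<integral>\<^sup>+ z. f (z * sqrt v) \<partial>normal01)"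
  using distributed_nn_integral[OF assms(1), of f] distributed_nn_integral[OF normal01_scaled_distributed[OF assms(2)], of f]
  by simp

section \<open>Polynomials in the derivatives, and measurability jointly in path and time\<close>

lemma mpoly_eval_tendsto:
  assumes "\<And>i. i \<in> mpoly_vars P \<Longrightarrow> (\<lambda>n. ys n i) \<longlonglongrightarrow> y i"
  shows "(\<lambda>n. mpoly_eval P (ys n)) \<longlonglongrightarrow> mpoly_eval P y"
  unfolding mpoly_eval_def
proof (intro tendsto_sum tendsto_mult tendsto_const tendsto_prod tendsto_power)
  fix m i assume "m \<in> Poly_Mapping.keys P" "i \<in> Poly_Mapping.keys m"
  then show "(\<lambda>n. ys n i) \<longlonglongrightarrow> y i" by (intro assms) (auto simp: mpoly_vars_def)
qed

lemma mpoly_eval_measurable: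
  assumes "\<And>i. i \<in> mpoly_vars P \<Longrightarrow> (\<lambda>\<omega>. y \<omega> i) \<in> borel_measurable M"
  shows "(\<lambda>\<omega>. mpoly_eval P (y \<omega>)) \<in> borel_measurable M"
  unfolding mpoly_eval_def
proof (intro borel_measurable_sum borel_measurable_times borel_measurable_const borel_measurable_prod borel_measurable_power)
  fix m i assume "m \<in> Poly_Mapping.keys P" "i \<in> Poly_Mapping.keys m"
  then show "(\<lambda>\<omega>. y \<omega> i) \<in> borel_measurable M" by (intro assms) (auto simp: mpoly_vars_def)
qed

lemma mpoly_eval_bounded:
  "\<exists>C\<ge>0. \<forall>y. (\<forall>i\<in>mpoly_vars P. \<bar>y i\<bar> \<le> k i) \<longrightarrow> \<bar>mpoly_eval P y\<bar> \<le> C"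
proof -
  define C where "C = (\<Sum>m\<in>Poly_Mapping.keys P. \<bar>Poly_Mapping.lookup P m\<bar> * (\<Prod>i\<in>Poly_Mapping.keys m. \<bar>k i\<bar> ^ Poly_Mapping.lookup m i))"
  have "\<bar>mpoly_eval P y\<bar> \<le> C" if y: "\<forall>i\<in>mpoly_vars P. \<bar>y i\<bar> \<le> k i" for y
    unfolding mpoly_eval_def C_def
  proof (rule order.trans[OF sum_abs], rule sum_mono)
    fix m assume m: "m \<in> Poly_Mapping.keys P"
    have "(\<Prod>i\<in>Poly_Mapping.keys m. \<bar>y i ^ Poly_Mapping.lookup m i\<bar>) \<le> (\<Prod>i\<in>Poly_Mapping.keys m. \<bar>k i\<bar> ^ Poly_Mapping.lookup m i)"
    proof (rule prod_mono)
      fix i assume "i \<in> Poly_Mapping.keys m"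
      then have "i \<in> mpoly_vars P" using m by (auto simp: mpoly_vars_def)
      then have "\<bar>y i\<bar> \<le> \<bar>k i\<bar>" using y by force
      then show "0 \<le> \<bar>y i ^ Poly_Mapping.lookup m i\<bar> \<and> \<bar>y i ^ Poly_Mapping.lookup m i\<bar> \<le> \<bar>k i\<bar> ^ Poly_Mapping.lookup m i"
        by (simp add: power_abs power_mono)
    qed
    then show "\<bar>Poly_Mapping.lookup P m * (\<Prod>i\<in>Poly_Mapping.keys m. y i ^ Poly_Mapping.lookup m i)\<bar> \<le>
        \<bar>Poly_Mapping.lookup P m\<bar> * (\<Prod>i\<in>Poly_Mapping.keys m. \<bar>k i\<bar> ^ Poly_Mapping.lookup m i)"
      unfolding abs_mult abs_prod by (intro mult_left_mono) auto
  qed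
  moreover have "0 \<le> C" unfolding C_def by (intro sum_nonneg mult_nonneg_nonneg prod_nonneg) auto
  ultimately show ?thesis by blast
qed

text \<open>Extends functions of a time in [0,1] to the whole line, so that continuity and joint
  measurability can be stated without restricting spaces.\<close>

definition clamp01 :: "real \<Rightarrow> real" where
  "clamp01 t = max 0 (min 1 t)"

lemma clamp01_bounds [simp]: "0 \<le> clamp01 t" "clamp01 t \<le> 1"
  by (simp_all add: clamp01_def)

lemma clamp01_id: "t \<in> {0..1} \<Longrightarrow> clamp01 t = t"
  by (simp add: clamp01_def)

lemma continuous_clamp01: "continuous_on S clamp01"
  unfolding clamp01_def by (intro continuous_intros)

lemma tendsto_floor_div: "(\<lambda>n. of_int \<lfloor>real n * t\<rfloor> / real n) \<longlonglongrightarrow> t"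
proof (rule tendsto_sandwich[of "\<lambda>n. t - 1 / real n" _ _ "\<lambda>n. t"])
  show "\<forall>\<^sub>F n in sequentially. t - 1 / real n \<le> of_int \<lfloor>real n * t\<rfloor> / real n"
    using eventually_gt_at_top[of 0]
  proof eventually_elim
    case (elim n)
    have "real n * t - 1 \<le> of_int \<lfloor>real n * t\<rfloor>" by linarith
    then have "(real n * t - 1) / real n \<le> of_int \<lfloor>real n * t\<rfloor> / real n" by (intro divide_right_mono) auto
    then show ?case using elim by (simp add: diff_divide_distrib)
  qed
  show "\<forall>\<^sub>F n in sequentially. of_int \<lfloor>real n * t\<rfloor> / real n \<le> t"
    using eventually_gt_at_top[of 0]
  proof eventually_elim
    case (elim n)
    have "of_int \<lfloor>real n * t\<rfloor> / real n \<le> (real n * t) / real n" by (intro divide_right_mono) auto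
    then show ?case using elim by simp
  qed
  show "(\<lambda>n. t - 1 / real n) \<longlonglongrightarrow> t"
    using tendsto_diff[OF tendsto_const[of t] lim_1_over_n] by simp
qed simp

locale parisi_brownian = parisi_covariance \<beta> d2 L + brownian_motion \<Omega> B
  for \<beta> d2 L and \<Omega> :: "'a measure" and B
begin

lemma dxi_continuous: "continuous_on {0..1} (dxi \<beta>)"
  using DERIV_dxi DERIV_isCont by (intro continuous_at_imp_continuous_on ballI) blast

lemma MB_measurable: "u \<in> {0..1} \<Longrightarrow> MB \<beta> B u \<in> borel_measurable \<Omega>"
  using measurable_B[OF dxi_nonneg, of u] by (simp add: MB_def[abs_def])

lemma MB_continuous: "\<omega> \<in> space \<Omega> \<Longrightarrow> continuous_on {0..1} (\<lambda>t. MB \<beta> B t \<omega>)"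
  unfolding MB_def
  by (rule continuous_on_compose2[OF continuous_paths dxi_continuous]) (use dxi_nonneg in auto)

text \<open>Rounding the time down to multiples of \<open>1 / n\<close> leaves countably many times,
  so the discretised process is jointly measurable. Every path is continuous, hence the
  discretisations converge at every point.\<close>

lemma MB_joint_measurable: "(\<lambda>p. MB \<beta> B (clamp01 (snd p)) (fst p)) \<in> borel_measurable (\<Omega> \<Otimes>\<^sub>M borel)"
proof (rule borel_measurable_LIMSEQ_real)
  fix p assume "p \<in> space (\<Omega> \<Otimes>\<^sub>M (borel :: real measure))"
  then have \<omega>: "fst p \<in> space \<Omega>" by (auto simp: space_pair_measure)
  show "(\<lambda>n. MB \<beta> B (clamp01 (of_int \<lfloor>real n * snd p\<rfloor> / real n)) (fst p)) \<longlonglongrightarrow> MB \<beta> B (clamp01 (snd p)) (fst p)"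
  proof (rule continuous_on_tendsto_compose[OF MB_continuous[OF \<omega>]])
    show "(\<lambda>n. clamp01 (of_int \<lfloor>real n * snd p\<rfloor> / real n)) \<longlonglongrightarrow> clamp01 (snd p)"
      by (rule continuous_on_tendsto_compose[OF continuous_clamp01[of UNIV] tendsto_floor_div]) auto
  qed auto
next
  fix n :: nat
  show "(\<lambda>p. MB \<beta> B (clamp01 (of_int \<lfloor>real n * snd p\<rfloor> / real n)) (fst p)) \<in> borel_measurable (\<Omega> \<Otimes>\<^sub>M borel)"
  proof (rule measurable_compose_countable[where f = "\<lambda>k p. MB \<beta> B (clamp01 (of_int k / real n)) (fst p)" and g = "\<lambda>p. \<lfloor>real n * snd p\<rfloor>"])
    show "(\<lambda>p. MB \<beta> B (clamp01 (of_int k / real n)) (fst p)) \<in> borel_measurable (\<Omega> \<Otimes>\<^sub>M borel)" for k :: int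
      by (rule measurable_compose[OF measurable_fst MB_measurable]) simp
  qed measurable
qed

lemma Phi_path_continuous:
  assumes M: "\<mu> \<in> M01" and \<omega>: "\<omega> \<in> space \<Omega>"
  shows "continuous_on {0..1} (\<lambda>t. Phi \<beta> \<mu> (MB \<beta> B t \<omega>) t)"
proof -
  have "continuous_on {0..1} ((\<lambda>(x, u). dxPhi \<beta> \<mu> 0 x u) \<circ> (\<lambda>t. (MB \<beta> B t \<omega>, t)))"
    by (rule continuous_on_compose)
      (auto intro!: continuous_on_Pair MB_continuous \<omega> continuous_on_id continuous_on_subset[OF dxPhi_continuous[OF M]])
  then show ?thesis by (simp add: o_def dxPhi_0)
qed

definition gap :: "real measure \<Rightarrow> real \<Rightarrow> 'a \<Rightarrow> real \<Rightarrow> real" where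
  "gap \<mu> u \<omega> t = Phi \<beta> \<mu> (MB \<beta> B u \<omega>) u - Phi \<beta> \<mu> (MB \<beta> B (clamp01 (min t u)) \<omega>) (clamp01 (min t u))"

lemma gap_continuous:
  assumes M: "\<mu> \<in> M01" and \<omega>: "\<omega> \<in> space \<Omega>"
  shows "continuous_on UNIV (gap \<mu> u \<omega>)"
proof -
  have "continuous_on UNIV ((\<lambda>t. Phi \<beta> \<mu> (MB \<beta> B t \<omega>) t) \<circ> (\<lambda>t. clamp01 (min t u)))"
  proof (rule continuous_on_compose)
    show "continuous_on UNIV (\<lambda>t. clamp01 (min t u))"
      by (rule continuous_on_compose2[OF continuous_clamp01[of UNIV]]) (auto intro!: continuous_intros)
    show "continuous_on ((\<lambda>t. clamp01 (min t u)) ` UNIV) (\<lambda>t. Phi \<beta> \<mu> (MB \<beta> B t \<omega>) t)"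
      by (rule continuous_on_subset[OF Phi_path_continuous[OF M \<omega>]]) auto
  qed
  then show ?thesis unfolding gap_def o_def by (intro continuous_intros)
qed

text \<open>Since the integrand of \<open>W\<close> vanishes at \<open>t = u\<close>, it extends by zero to a continuous function
  of \<open>t\<close>. Atoms of \<open>\<mu>\<close> at the end point therefore do no harm.\<close>

lemma W_eq:
  assumes M: "\<mu> \<in> M01" and u: "u \<in> {0..1}"
  shows "W \<beta> B \<mu> u \<omega> = (LINT t|\<mu>. gap \<mu> u \<omega> t)"
  unfolding W_def set_lebesgue_integral_def
proof (rule Bochner_Integration.integral_cong[OF refl])
  fix t assume "t \<in> space \<mu>"
  then have t: "t \<in> {0..1}" using M01_space[OF M] by simp
  show "indicator {0..u} t *\<^sub>R (Phi \<beta> \<mu> (MB \<beta> B u \<omega>) u - Phi \<beta> \<mu> (MB \<beta> B t \<omega>) t) = gap \<mu> u \<omega> t"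
  proof (cases "t \<le> u")
    case True
    then have "clamp01 (min t u) = t" using t by (simp add: clamp01_id)
    with True t show ?thesis by (simp add: gap_def)
  next
    case False
    then have "clamp01 (min t u) = u" using u by (simp add: clamp01_id)
    with False show ?thesis by (simp add: gap_def)
  qed
qed

text \<open>At most linear in one Brownian increment, with slope 1; exponential moments of
  \<open>W\<close> thereby reduce to Gaussian ones.\<close>

lemma gap_le:
  assumes M: "\<mu> \<in> M01" and u: "u \<in> {0..1}"
  shows "gap \<mu> u \<omega> t \<le> \<bar>MB \<beta> B u \<omega> - MB \<beta> B (clamp01 (min t u)) \<omega>\<bar> + time_lip"
proof -
  define s where "s = clamp01 (min t u)"
  have s: "s \<in> {0..1}" by (simp add: s_def)
  have "\<bar>u - s\<bar> \<le> 1" using u s by auto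
  then have "time_lip * \<bar>u - s\<bar> \<le> time_lip * 1" by (intro mult_left_mono time_lip_nonneg)
  then show ?thesis
    using nonexpansiveD[OF nonexpansive_Phi[OF M u], of "MB \<beta> B u \<omega>" "MB \<beta> B s \<omega>"]
      Phi_lipschitz_time[OF M u s, of "MB \<beta> B s \<omega>"]
    unfolding gap_def s_def[symmetric] by linarith
qed

lemma gap_joint_measurable:
  assumes M: "\<mu> \<in> M01" and u: "u \<in> {0..1}"
  shows "(\<lambda>(\<omega>, t). gap \<mu> u \<omega> t) \<in> borel_measurable (\<Omega> \<Otimes>\<^sub>M \<mu>)"
proof -
  define h where "h p = Phi \<beta> \<mu> (fst p) (clamp01 (snd p))" for p :: "real \<times> real"
  have "continuous_on UNIV ((\<lambda>(x, u). dxPhi \<beta> \<mu> 0 x u) \<circ> (\<lambda>p. (fst p, clamp01 (snd p))))"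
  proof (rule continuous_on_compose)
    have "continuous_on UNIV (\<lambda>p :: real \<times> real. clamp01 (snd p))"
      by (rule continuous_on_compose2[OF continuous_clamp01[of UNIV]]) (auto intro!: continuous_intros)
    then show "continuous_on UNIV (\<lambda>p :: real \<times> real. (fst p, clamp01 (snd p)))"
      by (intro continuous_intros)
    show "continuous_on ((\<lambda>p :: real \<times> real. (fst p, clamp01 (snd p))) ` UNIV) (\<lambda>(x, u). dxPhi \<beta> \<mu> 0 x u)"
      by (rule continuous_on_subset[OF dxPhi_continuous[OF M]]) auto
  qed
  then have hm: "h \<in> borel_measurable borel"
    by (intro borel_measurable_continuous_onI) (simp add: o_def h_def dxPhi_0)
  have hm2: "h \<in> borel_measurable (borel \<Otimes>\<^sub>M borel)" using hm by (simp add: borel_prod)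
  have id: "(\<lambda>t. t) \<in> borel_measurable \<mu>" by (rule M01_borel_measurable[OF M]) simp
  have sm: "(\<lambda>p. min (snd p) u) \<in> borel_measurable (\<Omega> \<Otimes>\<^sub>M \<mu>)"
    by (intro borel_measurable_min borel_measurable_const measurable_compose[OF measurable_snd id])
  have "(\<lambda>p. (fst p, min (snd p) u)) \<in> measurable (\<Omega> \<Otimes>\<^sub>M \<mu>) (\<Omega> \<Otimes>\<^sub>M borel)"
    by (rule measurable_Pair[OF measurable_fst sm])
  from measurable_compose[OF this MB_joint_measurable]
  have "(\<lambda>p. MB \<beta> B (clamp01 (min (snd p) u)) (fst p)) \<in> borel_measurable (\<Omega> \<Otimes>\<^sub>M \<mu>)" by simp
  from measurable_compose[OF measurable_Pair[OF this sm] hm2]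
  have 1: "(\<lambda>p. Phi \<beta> \<mu> (MB \<beta> B (clamp01 (min (snd p) u)) (fst p)) (clamp01 (min (snd p) u))) \<in> borel_measurable (\<Omega> \<Otimes>\<^sub>M \<mu>)"
    by (simp add: h_def)
  have "(\<lambda>p. (MB \<beta> B u (fst p), u)) \<in> measurable (\<Omega> \<Otimes>\<^sub>M \<mu>) (borel \<Otimes>\<^sub>M borel)"
    by (intro measurable_Pair measurable_const measurable_compose[OF measurable_fst MB_measurable[OF u]]) auto
  from measurable_compose[OF this hm2]
  have 2: "(\<lambda>p. Phi \<beta> \<mu> (MB \<beta> B u (fst p)) u) \<in> borel_measurable (\<Omega> \<Otimes>\<^sub>M \<mu>)"
    using u by (simp add: h_def clamp01_id)
  from borel_measurable_diff[OF 2 1] show ?thesis by (simp add: gap_def case_prod_beta')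
qed

lemma W_measurable:
  assumes M: "\<mu> \<in> M01" and u: "u \<in> {0..1}"
  shows "W \<beta> B \<mu> u \<in> borel_measurable \<Omega>"
proof -
  interpret M: prob_space \<mu> by (rule M01_prob_space[OF M])
  have "(\<lambda>\<omega>. LINT t|\<mu>. gap \<mu> u \<omega> t) \<in> borel_measurable \<Omega>"
    by (rule M.borel_measurable_lebesgue_integral[OF gap_joint_measurable[OF M u]])
  moreover have "W \<beta> B \<mu> u = (\<lambda>\<omega>. LINT t|\<mu>. gap \<mu> u \<omega> t)"
    using W_eq[OF M u] by (intro ext)
  ultimately show ?thesis by simp
qed

text \<open>\<open>exp (2 * \<bar>X\<bar>)\<close> is at most
  \<open>exp (2 * X) + exp (- 2 * X)\<close>, of mean \<open>2 * exp (2 * v)\<close>. Where the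
  derivative of \<xi> does not increase, the increment is 0 and has no density, hence the case
  distinction.\<close>

lemma exp_increment_moment:
  assumes s: "0 \<le> s" "s \<le> u" "u \<le> 1"
  shows "(\<integral>\<^sup>+ \<omega>. ennreal (exp (2 * \<bar>MB \<beta> B u \<omega> - MB \<beta> B s \<omega>\<bar>)) \<partial>\<Omega>) \<le> ennreal (2 * exp (2 * L))"
proof (cases "dxi \<beta> s = dxi \<beta> u")
  case True
  have "1 \<le> 2 * exp (2 * L)" using L_nonneg one_le_exp_iff[of "2 * L"] by linarith
  then have "ennreal 1 \<le> ennreal (2 * exp (2 * L))" by (rule ennreal_leI)
  then show ?thesis using True by (simp add: MB_def emeasure_space_1)
next
  case False
  define v where "v = dxi \<beta> u - dxi \<beta> s"
  have v: "0 < v" "v \<le> L" using False dxi_mono[of s u] dxi_diff_le_L[of s u] s by (auto simp: v_def)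
  have "distributed \<Omega> lborel (\<lambda>\<omega>. B (dxi \<beta> u) \<omega> - B (dxi \<beta> s) \<omega>) (normal_density 0 (sqrt v))"
    unfolding v_def by (rule gaussian_increments) (use v s dxi_nonneg[of s] in \<open>auto simp: v_def\<close>)
  then have "(\<integral>\<^sup>+ \<omega>. ennreal (exp (2 * \<bar>MB \<beta> B u \<omega> - MB \<beta> B s \<omega>\<bar>)) \<partial>\<Omega>) =
      (\<integral>\<^sup>+ z. ennreal (exp (2 * \<bar>z * sqrt v\<bar>)) \<partial>normal01)"
    unfolding MB_def by (rule nn_integral_normal_distributed) (use v in auto)
  also have "\<dots> \<le> (\<integral>\<^sup>+ z. ennreal (exp (2 * sqrt v * z) + exp (- (2 * sqrt v) * z)) \<partial>normal01)"
  proof (rule nn_integral_mono, rule ennreal_leI)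
    fix z :: real
    show "exp (2 * \<bar>z * sqrt v\<bar>) \<le> exp (2 * sqrt v * z) + exp (- (2 * sqrt v) * z)"
      using v exp_gt_zero[of "2 * sqrt v * z"] exp_gt_zero[of "- (2 * sqrt v) * z"]
      by (cases "0 \<le> z") (auto simp: abs_mult mult_ac)
  qed
  also have "\<dots> = ennreal (2 * exp (2 * v))"
  proof -
    note i = integrable_normal01_exp[of "2 * sqrt v"] integrable_normal01_exp[of "- (2 * sqrt v)"]
    have "(\<integral>\<^sup>+ z. ennreal (exp (2 * sqrt v * z) + exp (- (2 * sqrt v) * z)) \<partial>normal01) =
        ennreal (LINT z|normal01. exp (2 * sqrt v * z) + exp (- (2 * sqrt v) * z))"
      by (rule nn_integral_eq_integral[OF Bochner_Integration.integrable_add[OF i]]) (auto intro: add_nonneg_nonneg)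
    also have "(LINT z|normal01. exp (2 * sqrt v * z) + exp (- (2 * sqrt v) * z)) =
        (LINT z|normal01. exp (2 * sqrt v * z)) + (LINT z|normal01. exp (- (2 * sqrt v) * z))"
      by (rule Bochner_Integration.integral_add[OF i])
    also have "\<dots> = 2 * exp (2 * v)"
      unfolding integral_normal01_exp using v by (simp add: power_mult_distrib)
    finally show ?thesis .
  qed
  also have "\<dots> \<le> ennreal (2 * exp (2 * L))"
    using v by (intro ennreal_leI) simp
  finally show ?thesis .
qed

text \<open>The Gaussian moment of the increment times the contribution of the time-Lipschitz part,
  both for the square of \<open>exp W\<close>.\<close>

definition exp_W_bound :: real where
  "exp_W_bound = 2 * exp (2 * L) * exp (2 * time_lip)"

text \<open>Jensen moves the exponential inside the integral over \<mu>. After Tonelli only one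
  Brownian increment occurs for each fixed \<open>t\<close>, and its moment is bounded uniformly in
  \<open>t\<close>.\<close>

lemma exp_W_second_moment:
  assumes M: "\<mu> \<in> M01" and u: "u \<in> {0..1}"
  shows "(\<integral>\<^sup>+ \<omega>. ennreal ((exp (W \<beta> B \<mu> u \<omega>))\<^sup>2) \<partial>\<Omega>) \<le> ennreal exp_W_bound"
proof -
  interpret M: prob_space \<mu> by (rule M01_prob_space[OF M])
  interpret P: pair_sigma_finite \<Omega> \<mu> ..
  let ?g = "\<lambda>\<omega> t. ennreal (exp (2 * gap \<mu> u \<omega> t))"
  have gm: "case_prod ?g \<in> borel_measurable (\<Omega> \<Otimes>\<^sub>M \<mu>)"
    using gap_joint_measurable[OF M u] by (simp add: case_prod_beta')
  have jensen: "ennreal ((exp (W \<beta> B \<mu> u \<omega>))\<^sup>2) \<le> (\<integral>\<^sup>+ t. ?g \<omega> t \<partial>\<mu>)" if \<omega>: "\<omega> \<in> space \<Omega>" for \<omega>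
  proof -
    let ?a = "2 * W \<beta> B \<mu> u \<omega>"
    have ig: "integrable \<mu> (gap \<mu> u \<omega>)"
      by (rule M01_integrable_continuous[OF M gap_continuous[OF M \<omega>]])
    have ie: "integrable \<mu> (\<lambda>t. exp (2 * gap \<mu> u \<omega> t))"
      by (rule M01_integrable_continuous[OF M]) (intro continuous_intros gap_continuous M \<omega>)
    \<comment> \<open>Jensen by the tangent line of \<open>exp\<close> at \<open>?a\<close>, the
      mean of \<open>2 * gap\<close>.\<close>
    have "exp ?a = (LINT t|\<mu>. exp ?a * (1 + (2 * gap \<mu> u \<omega> t - ?a)))"
      using ig W_eq[OF M u, of \<omega>] by (simp add: M.prob_space)
    also have "\<dots> \<le> (LINT t|\<mu>. exp (2 * gap \<mu> u \<omega> t))"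
    proof (rule integral_mono[OF _ ie])
      show "integrable \<mu> (\<lambda>t. exp ?a * (1 + (2 * gap \<mu> u \<omega> t - ?a)))" using ig by simp
      fix t
      have "exp ?a * (1 + (2 * gap \<mu> u \<omega> t - ?a)) \<le> exp ?a * exp (2 * gap \<mu> u \<omega> t - ?a)"
        by (intro mult_left_mono exp_ge_add_one_self) auto
      then show "exp ?a * (1 + (2 * gap \<mu> u \<omega> t - ?a)) \<le> exp (2 * gap \<mu> u \<omega> t)"
        by (simp add: exp_add[symmetric])
    qed
    finally have "exp ?a \<le> (LINT t|\<mu>. exp (2 * gap \<mu> u \<omega> t))" .
    moreover have "(exp (W \<beta> B \<mu> u \<omega>))\<^sup>2 = exp ?a" by (simp add: power2_eq_square exp_add[symmetric])
    ultimately have "ennreal ((exp (W \<beta> B \<mu> u \<omega>))\<^sup>2) \<le> ennreal (LINT t|\<mu>. exp (2 * gap \<mu> u \<omega> t))"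
      by (simp add: ennreal_leI)
    also have "\<dots> = (\<integral>\<^sup>+ t. ?g \<omega> t \<partial>\<mu>)"
      by (rule nn_integral_eq_integral[symmetric]) (use ie in auto)
    finally show ?thesis .
  qed
  have inner: "(\<integral>\<^sup>+ \<omega>. ?g \<omega> t \<partial>\<Omega>) \<le> ennreal exp_W_bound" for t
  proof -
    define s where "s = clamp01 (min t u)"
    have s: "0 \<le> s" "s \<le> u" "u \<le> 1" using u by (auto simp: clamp01_def s_def)
    have [measurable]: "MB \<beta> B u \<in> borel_measurable \<Omega>" "MB \<beta> B s \<in> borel_measurable \<Omega>"
      using MB_measurable[OF u] MB_measurable[of s] s by auto
    have "(\<integral>\<^sup>+ \<omega>. ?g \<omega> t \<partial>\<Omega>) \<le> (\<integral>\<^sup>+ \<omega>. ennreal (exp (2 * time_lip)) * ennreal (exp (2 * \<bar>MB \<beta> B u \<omega> - MB \<beta> B s \<omega>\<bar>)) \<partial>\<Omega>)"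
    proof (rule nn_integral_mono)
      fix \<omega>
      have "2 * gap \<mu> u \<omega> t \<le> 2 * (\<bar>MB \<beta> B u \<omega> - MB \<beta> B s \<omega>\<bar> + time_lip)"
        using gap_le[OF M u, of \<omega> t] unfolding s_def[symmetric] by (rule mult_left_mono) simp
      then have "exp (2 * gap \<mu> u \<omega> t) \<le> exp (2 * (\<bar>MB \<beta> B u \<omega> - MB \<beta> B s \<omega>\<bar> + time_lip))"
        by (simp only: exp_le_cancel_iff)
      also have "\<dots> = exp (2 * time_lip) * exp (2 * \<bar>MB \<beta> B u \<omega> - MB \<beta> B s \<omega>\<bar>)"
        by (simp only: exp_add[symmetric] distrib_left add.commute)
      finally have "exp (2 * gap \<mu> u \<omega> t) \<le> exp (2 * time_lip) * exp (2 * \<bar>MB \<beta> B u \<omega> - MB \<beta> B s \<omega>\<bar>)" .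
      then show "?g \<omega> t \<le> ennreal (exp (2 * time_lip)) * ennreal (exp (2 * \<bar>MB \<beta> B u \<omega> - MB \<beta> B s \<omega>\<bar>))"
        by (simp add: ennreal_mult[symmetric] ennreal_leI)
    qed
    also have "\<dots> = ennreal (exp (2 * time_lip)) * (\<integral>\<^sup>+ \<omega>. ennreal (exp (2 * \<bar>MB \<beta> B u \<omega> - MB \<beta> B s \<omega>\<bar>)) \<partial>\<Omega>)"
      by (rule nn_integral_cmult) measurable
    also have "\<dots> \<le> ennreal (exp (2 * time_lip)) * ennreal (2 * exp (2 * L))"
      by (intro mult_left_mono exp_increment_moment s) auto
    also have "\<dots> = ennreal exp_W_bound"
      by (simp add: exp_W_bound_def ennreal_mult[symmetric] mult_ac)
    finally show ?thesis .
  qed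
  have "(\<integral>\<^sup>+ \<omega>. ennreal ((exp (W \<beta> B \<mu> u \<omega>))\<^sup>2) \<partial>\<Omega>) \<le> (\<integral>\<^sup>+ \<omega>. (\<integral>\<^sup>+ t. ?g \<omega> t \<partial>\<mu>) \<partial>\<Omega>)"
    by (rule nn_integral_mono) (rule jensen)
  also have "\<dots> = (\<integral>\<^sup>+ t. (\<integral>\<^sup>+ \<omega>. ?g \<omega> t \<partial>\<Omega>) \<partial>\<mu>)"
    by (rule P.Fubini'[OF gm, symmetric])
  also have "\<dots> \<le> (\<integral>\<^sup>+ t. ennreal exp_W_bound \<partial>\<mu>)"
    by (rule nn_integral_mono) (rule inner)
  also have "\<dots> = ennreal exp_W_bound" by (simp add: M.emeasure_space_1)
  finally show ?thesis .
qed

text \<open>Integrand and measure vary together. The integrands converge uniformly in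
  \<open>t\<close>, which disposes of the first change for any probability measures; the second is
  weak convergence tested on the fixed continuous limit.\<close>

lemma W_tendsto:
  assumes M: "\<And>n. \<mu>s n \<in> M01" "\<mu> \<in> M01" and d: "(\<lambda>n. d01 (\<mu>s n) \<mu>) \<longlonglongrightarrow> 0"
    and u: "\<And>n. us n \<in> {0..1}" "u \<in> {0..1}" "us \<longlonglongrightarrow> u" and \<omega>: "\<omega> \<in> space \<Omega>"
  shows "(\<lambda>n. W \<beta> B (\<mu>s n) (us n) \<omega>) \<longlonglongrightarrow> W \<beta> B \<mu> u \<omega>"
proof -
  let ?g = "gap \<mu> u \<omega>" and ?gs = "\<lambda>n. gap (\<mu>s n) (us n) \<omega>"
  let ?\<phi> = "\<lambda>t. Phi \<beta> \<mu> (MB \<beta> B t \<omega>) t"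
  have uc: "uniformly_continuous_on {0..1} ?\<phi>"
    by (rule compact_uniformly_continuous[OF Phi_path_continuous[OF M(2) \<omega>]]) simp
  have close: "\<forall>\<^sub>F n in sequentially. \<forall>t\<in>{0..1}. \<bar>?gs n t - ?g t\<bar> \<le> e" if e: "0 < e" for e
  proof -
    \<comment> \<open>Four differences share \<open>e\<close>: the change of measure and the change
      of time, each in both terms of \<open>gap\<close>. Uniform continuity along the path makes the
      change of time uniform in \<open>t\<close>.\<close>
    obtain \<delta> where \<delta>: "0 < \<delta>" "\<And>a b. a \<in> {0..1} \<Longrightarrow> b \<in> {0..1} \<Longrightarrow> dist b a < \<delta> \<Longrightarrow> dist (?\<phi> b) (?\<phi> a) < e / 4"
      using uc[unfolded uniformly_continuous_on_def, rule_format, of "e / 4"] e by auto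
    have "\<forall>\<^sub>F n in sequentially. dist (us n) u < \<delta>" using u(3) \<delta>(1) by (rule tendstoD)
    moreover have "(\<lambda>n. measure_lip * d01 (\<mu>s n) \<mu>) \<longlonglongrightarrow> measure_lip * 0" by (intro tendsto_intros d)
    then have "\<forall>\<^sub>F n in sequentially. measure_lip * d01 (\<mu>s n) \<mu> < e / 4"
      using e by (intro order_tendstoD(2)) auto
    ultimately show ?thesis
    proof eventually_elim
      case (elim n)
      show ?case
      proof
        fix t :: real assume t: "t \<in> {0..1}"
        have c: "clamp01 (min t (us n)) = min t (us n)" "clamp01 (min t u) = min t u"
          using t u(1)[of n] u(2) by (auto intro!: clamp01_id)
        have m01: "min t (us n) \<in> {0..1}" "min t u \<in> {0..1}" using t u(1)[of n] u(2) by auto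
        have "\<bar>min t (us n) - min t u\<bar> \<le> \<bar>us n - u\<bar>" by (simp add: min_def)
        then have "dist (min t (us n)) (min t u) < \<delta>" using elim(1) by (simp add: dist_real_def)
        then have 1: "\<bar>?\<phi> (min t (us n)) - ?\<phi> (min t u)\<bar> < e / 4"
          using \<delta>(2)[OF m01(2,1)] by (simp add: dist_real_def)
        have 2: "\<bar>?\<phi> (us n) - ?\<phi> u\<bar> < e / 4"
          using \<delta>(2)[OF u(2) u(1)[of n] elim(1)] by (simp add: dist_real_def)
        have 3: "\<bar>Phi \<beta> (\<mu>s n) x s - Phi \<beta> \<mu> x s\<bar> < e / 4" if "s \<in> {0..1}" for x s
          using Phi_lipschitz_measure[OF M(1)[of n] M(2) that, of x] elim(2) by linarith
        have tri: "\<bar>(p1 - q1) - (p3 - q3)\<bar> \<le> e"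
          if "\<bar>p1 - p2\<bar> < e / 4" "\<bar>p2 - p3\<bar> < e / 4" "\<bar>q1 - q2\<bar> < e / 4" "\<bar>q2 - q3\<bar> < e / 4"
          for p1 p2 p3 q1 q2 q3 :: real
          using that by linarith
        show "\<bar>?gs n t - ?g t\<bar> \<le> e"
          unfolding gap_def c by (rule tri[OF 3[OF u(1)] 2 3[OF m01(1)] 1])
      qed
    qed
  qed
  have ig: "integrable \<nu> (gap \<mu>' s \<omega>)" if "\<nu> \<in> M01" "\<mu>' \<in> M01" for \<nu> \<mu>' s
    by (rule M01_integrable_continuous[OF that(1) gap_continuous[OF that(2) \<omega>]])
  have "(\<lambda>n. (LINT t|\<mu>s n. ?gs n t) - (LINT t|\<mu>s n. ?g t)) \<longlonglongrightarrow> 0"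
  proof (rule tendstoI)
    fix e :: real assume e: "0 < e"
    then have "\<forall>\<^sub>F n in sequentially. \<forall>t\<in>{0..1}. \<bar>?gs n t - ?g t\<bar> \<le> e / 2" by (intro close) simp
    then show "\<forall>\<^sub>F n in sequentially. dist ((LINT t|\<mu>s n. ?gs n t) - (LINT t|\<mu>s n. ?g t)) 0 < e"
    proof eventually_elim
      case (elim n)
      interpret N: prob_space "\<mu>s n" by (rule M01_prob_space[OF M(1)])
      note i = ig[OF M(1)[of n] M(1)[of n], of "us n"] ig[OF M(1)[of n] M(2), of u]
      have "\<bar>(LINT t|\<mu>s n. ?gs n t) - (LINT t|\<mu>s n. ?g t)\<bar> = \<bar>LINT t|\<mu>s n. ?gs n t - ?g t\<bar>"
        by (simp add: Bochner_Integration.integral_diff[OF i])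
      also have "\<dots> \<le> (LINT t|\<mu>s n. \<bar>?gs n t - ?g t\<bar>)" by (rule integral_abs_bound)
      also have "\<dots> \<le> (LINT t|\<mu>s n. e / 2)"
      proof (rule integral_mono)
        show "integrable (\<mu>s n) (\<lambda>t. \<bar>?gs n t - ?g t\<bar>)" using i by auto
        fix t assume "t \<in> space (\<mu>s n)"
        then show "\<bar>?gs n t - ?g t\<bar> \<le> e / 2" using elim M01_space[OF M(1)] by blast
      qed simp
      also have "\<dots> = e / 2" by (simp add: N.prob_space)
      finally show ?case using e by (simp add: dist_real_def)
    qed
  qed
  from tendsto_add[OF this M01_integral_tendsto[OF M d gap_continuous[OF M(2) \<omega>, of u]]]
  show ?thesis by (simp add: W_eq[OF M(1) u(1)] W_eq[OF M(2) u(2)])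
qed

section \<open>Continuity and convergence of the weighted expectations\<close>

lemma PexpW_measurable:
  assumes M: "\<mu> \<in> M01" and u: "u \<in> {0..1}"
  shows "PexpW \<beta> B P \<mu> u \<in> borel_measurable \<Omega>"
proof -
  have "(\<lambda>\<omega>. dxPhi \<beta> \<mu> i (MB \<beta> B u \<omega>) u) \<in> borel_measurable \<Omega>" for i
  proof (rule measurable_compose[OF MB_measurable[OF u]])
    show "(\<lambda>x. dxPhi \<beta> \<mu> i x u) \<in> borel_measurable borel"
      using DERIV_isCont[OF DERIV_dxPhi[OF M u]]
      by (intro borel_measurable_continuous_onI continuous_at_imp_continuous_on ballI) blast
  qed
  then show ?thesis
    unfolding PexpW_def[abs_def]
    by (intro borel_measurable_times mpoly_eval_measurable measurable_compose[OF W_measurable[OF M u] borel_measurable_exp])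
qed

text \<open>The polynomial factor is bounded uniformly in path, time and measure, since its
  variables are derivatives of positive order; the unbounded \<Phi> is excluded by starting the
  indices at 1. Only \<open>exp W\<close> needs a moment estimate.\<close>

lemma PexpW_second_moment:
  assumes P: "mpoly_vars P \<subseteq> {1..j}"
  shows "\<exists>K. \<forall>\<mu>\<in>M01. \<forall>u\<in>{0..1}. integrable \<Omega> (\<lambda>\<omega>. (PexpW \<beta> B P \<mu> u \<omega>)\<^sup>2) \<and>
    expectation (\<lambda>\<omega>. (PexpW \<beta> B P \<mu> u \<omega>)\<^sup>2) \<le> K"
proof -
  obtain C where C: "0 \<le> C" "\<forall>y. (\<forall>i\<in>mpoly_vars P. \<bar>y i\<bar> \<le> deriv_bound (i - 1)) \<longrightarrow> \<bar>mpoly_eval P y\<bar> \<le> C"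
    using mpoly_eval_bounded[of P "\<lambda>i. deriv_bound (i - 1)"] by blast
  have "integrable \<Omega> (\<lambda>\<omega>. (PexpW \<beta> B P \<mu> u \<omega>)\<^sup>2) \<and> expectation (\<lambda>\<omega>. (PexpW \<beta> B P \<mu> u \<omega>)\<^sup>2) \<le> C\<^sup>2 * exp_W_bound"
    if M: "\<mu> \<in> M01" and u: "u \<in> {0..1}" for \<mu> u
  proof -
    have Pm[measurable]: "PexpW \<beta> B P \<mu> u \<in> borel_measurable \<Omega>" by (rule PexpW_measurable[OF M u])
    have Wm[measurable]: "W \<beta> B \<mu> u \<in> borel_measurable \<Omega>" by (rule W_measurable[OF M u])
    have le: "(PexpW \<beta> B P \<mu> u \<omega>)\<^sup>2 \<le> C\<^sup>2 * (exp (W \<beta> B \<mu> u \<omega>))\<^sup>2" for \<omega>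
    proof -
      have "\<bar>mpoly_eval P (\<lambda>i. dxPhi \<beta> \<mu> i (MB \<beta> B u \<omega>) u)\<bar> \<le> C"
      proof (rule C(2)[rule_format])
        fix i assume "i \<in> mpoly_vars P"
        \<comment> \<open>Variable \<open>i\<close> stands for the derivative of order
          \<open>i\<close>, which \<open>deriv_bound\<close> lists at \<open>i - 1\<close>.\<close>
        then have "i = Suc (i - 1)" using P by force
        then show "\<bar>dxPhi \<beta> \<mu> i (MB \<beta> B u \<omega>) u\<bar> \<le> deriv_bound (i - 1)"
          using dxPhi_bound[OF M u, of "i - 1"] by metis
      qed
      from power_mono[OF this abs_ge_zero, of 2] show ?thesis
        by (simp add: PexpW_def power_mult_distrib mult_right_mono)
    qed
    have Kn: "0 \<le> C\<^sup>2 * exp_W_bound" by (simp add: exp_W_bound_def)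
    have "(\<integral>\<^sup>+ \<omega>. ennreal ((PexpW \<beta> B P \<mu> u \<omega>)\<^sup>2) \<partial>\<Omega>) \<le> (\<integral>\<^sup>+ \<omega>. ennreal (C\<^sup>2) * ennreal ((exp (W \<beta> B \<mu> u \<omega>))\<^sup>2) \<partial>\<Omega>)"
      using le by (intro nn_integral_mono) (simp add: ennreal_mult[symmetric] ennreal_leI)
    also have "\<dots> = ennreal (C\<^sup>2) * (\<integral>\<^sup>+ \<omega>. ennreal ((exp (W \<beta> B \<mu> u \<omega>))\<^sup>2) \<partial>\<Omega>)"
      by (rule nn_integral_cmult) measurable
    also have "\<dots> \<le> ennreal (C\<^sup>2) * ennreal exp_W_bound"
      by (intro mult_left_mono exp_W_second_moment M u) auto
    also have "\<dots> = ennreal (C\<^sup>2 * exp_W_bound)"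
      by (rule ennreal_mult[symmetric]) (auto simp: exp_W_bound_def)
    finally have b: "(\<integral>\<^sup>+ \<omega>. ennreal ((PexpW \<beta> B P \<mu> u \<omega>)\<^sup>2) \<partial>\<Omega>) \<le> ennreal (C\<^sup>2 * exp_W_bound)" .
    have i: "integrable \<Omega> (\<lambda>\<omega>. (PexpW \<beta> B P \<mu> u \<omega>)\<^sup>2)"
      by (rule integrableI_bounded) (use b in \<open>auto intro: order.strict_trans1\<close>)
    have "ennreal (expectation (\<lambda>\<omega>. (PexpW \<beta> B P \<mu> u \<omega>)\<^sup>2)) \<le> ennreal (C\<^sup>2 * exp_W_bound)"
      using b by (subst nn_integral_eq_integral[OF i, symmetric]) auto
    then have "expectation (\<lambda>\<omega>. (PexpW \<beta> B P \<mu> u \<omega>)\<^sup>2) \<le> C\<^sup>2 * exp_W_bound"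
      using Kn by (simp only: ennreal_le_iff)
    with i show ?thesis by blast
  qed
  then show ?thesis by blast
qed

lemma PexpW_integrable:
  assumes "mpoly_vars P \<subseteq> {1..j}" "\<mu> \<in> M01" "u \<in> {0..1}"
  shows "integrable \<Omega> (PexpW \<beta> B P \<mu> u)"
  by (rule square_integrable_imp_integrable[OF PexpW_measurable[OF assms(2,3)]])
    (use PexpW_second_moment[OF assms(1)] assms(2,3) in blast)

text \<open>Measure and time move jointly: with a constant measure this is continuity in
  \<open>u\<close>, and with both varying it drives the compactness argument for uniformity.\<close>

lemma PexpW_expectation_tendsto:
  assumes P: "mpoly_vars P \<subseteq> {1..j}"
    and M: "\<And>n. \<mu>s n \<in> M01" "\<mu> \<in> M01" and d: "(\<lambda>n. d01 (\<mu>s n) \<mu>) \<longlonglongrightarrow> 0"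
    and u: "\<And>n. us n \<in> {0..1}" "u \<in> {0..1}" "us \<longlonglongrightarrow> u"
  shows "(\<lambda>n. expectation (PexpW \<beta> B P (\<mu>s n) (us n))) \<longlonglongrightarrow> expectation (PexpW \<beta> B P \<mu> u)"
proof -
  obtain K where K: "\<forall>\<mu>\<in>M01. \<forall>u\<in>{0..1}. integrable \<Omega> (\<lambda>\<omega>. (PexpW \<beta> B P \<mu> u \<omega>)\<^sup>2) \<and>
    expectation (\<lambda>\<omega>. (PexpW \<beta> B P \<mu> u \<omega>)\<^sup>2) \<le> K"
    using PexpW_second_moment[OF P] by blast
  show ?thesis
  proof (rule expectation_tendsto_bounded_second_moment[where K = K])
    fix \<omega> assume \<omega>: "\<omega> \<in> space \<Omega>"
    have "(\<lambda>n. MB \<beta> B (us n) \<omega>) \<longlonglongrightarrow> MB \<beta> B u \<omega>"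
      by (rule continuous_on_tendsto_compose[OF MB_continuous[OF \<omega>] u(3,2)]) (use u(1) in auto)
    then show "(\<lambda>n. PexpW \<beta> B P (\<mu>s n) (us n) \<omega>) \<longlonglongrightarrow> PexpW \<beta> B P \<mu> u \<omega>"
      unfolding PexpW_def
      by (intro tendsto_mult tendsto_exp W_tendsto[OF M d u \<omega>] mpoly_eval_tendsto dxPhi_tendsto[OF M d u])
  qed (use K M u PexpW_measurable in auto)
qed

lemma PexpW_expectation_continuous:
  assumes P: "mpoly_vars P \<subseteq> {1..j}" and M: "\<mu> \<in> M01"
  shows "continuous_on {0..1} (\<lambda>u. expectation (PexpW \<beta> B P \<mu> u))"
  unfolding continuous_on_sequentially o_def
proof (intro allI ballI impI, elim conjE)
  fix us :: "nat \<Rightarrow> real" and u assume u: "u \<in> {0..1}" "\<forall>n. us n \<in> {0..1}" "us \<longlonglongrightarrow> u"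
  show "(\<lambda>n. expectation (PexpW \<beta> B P \<mu> (us n))) \<longlonglongrightarrow> expectation (PexpW \<beta> B P \<mu> u)"
    by (rule PexpW_expectation_tendsto[OF P M M _ spec[OF u(2)] u(1,3)]) (simp add: d01_refl)
qed

text \<open>If uniformity failed, there would be times at which the expectations stay
  \<open>e\<close> apart for arbitrarily large indices. Along a convergent subsequence of these
  times both expectations tend to the value at the limit time, a contradiction.\<close>

lemma PexpW_expectation_uniform_limit:
  assumes P: "mpoly_vars P \<subseteq> {1..j}"
    and M: "\<And>n. n \<ge> 1 \<Longrightarrow> \<mu>s n \<in> M01" "\<mu> \<in> M01" and d: "(\<lambda>n. d01 (\<mu>s n) \<mu>) \<longlonglongrightarrow> 0"
  shows "uniform_limit {0..1} (\<lambda>n u. expectation (PexpW \<beta> B P (\<mu>s n) u)) (\<lambda>u. expectation (PexpW \<beta> B P \<mu> u)) sequentially"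
proof (rule ccontr)
  let ?a = "\<lambda>\<mu> u. expectation (PexpW \<beta> B P \<mu> u)"
  assume "\<not> ?thesis"
  then obtain e where e: "0 < e" "\<not> (\<forall>\<^sub>F n in sequentially. \<forall>u\<in>{0..1}. dist (?a (\<mu>s n) u) (?a \<mu> u) < e)"
    unfolding uniform_limit_iff by blast
  have "\<exists>n u. N \<le> n \<and> 1 \<le> n \<and> u \<in> {0..1} \<and> e \<le> dist (?a (\<mu>s n) u) (?a \<mu> u)" for N :: nat
  proof (rule ccontr)
    assume "\<not> ?thesis"
    then have "dist (?a (\<mu>s n) u) (?a \<mu> u) < e" if "N \<le> n" "1 \<le> n" "u \<in> {0..1}" for n u
      using that not_le by blast
    then have "\<forall>n\<ge>max N 1. \<forall>u\<in>{0..1}. dist (?a (\<mu>s n) u) (?a \<mu> u) < e" by simp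
    then show False using e(2) unfolding eventually_sequentially by blast
  qed
  \<comment> \<open>The index is kept at least 1 because \<open>\<mu>s 0\<close> need not lie in
    \<open>M01\<close>.\<close>
  then obtain m v where mv: "\<And>N. N \<le> m N" "\<And>N. 1 \<le> m N" "\<And>N. v N \<in> {0..1::real}"
      "\<And>N. e \<le> dist (?a (\<mu>s (m N)) (v N)) (?a \<mu> (v N))"
    by metis
  have "seq_compact {0..1::real}" by (simp add: compact_imp_seq_compact)
  then obtain u r where r: "u \<in> {0..1}" "strict_mono (r :: nat \<Rightarrow> nat)" "(v \<circ> r) \<longlonglongrightarrow> u"
    using mv(3) unfolding seq_compact_def by metis
  have "filterlim (\<lambda>k. m (r k)) sequentially sequentially"
  proof (rule filterlim_at_top_mono[OF filterlim_subseq[OF r(2)]])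
    show "\<forall>\<^sub>F k in sequentially. r k \<le> m (r k)" using mv(1) by simp
  qed
  then have dl: "(\<lambda>k. d01 (\<mu>s (m (r k))) \<mu>) \<longlonglongrightarrow> 0" by (rule filterlim_compose[OF d])
  have vl: "(\<lambda>k. v (r k)) \<longlonglongrightarrow> u" using r(3) by (simp add: o_def)
  have "(\<lambda>k. ?a (\<mu>s (m (r k))) (v (r k))) \<longlonglongrightarrow> ?a \<mu> u"
    by (rule PexpW_expectation_tendsto[OF P M(1)[OF mv(2)] M(2) dl mv(3) r(1) vl])
  moreover have "(\<lambda>k. ?a \<mu> (v (r k))) \<longlonglongrightarrow> ?a \<mu> u"
    by (rule PexpW_expectation_tendsto[OF P M(2) M(2) _ mv(3) r(1) vl]) (simp add: d01_refl)
  ultimately have "(\<lambda>k. dist (?a (\<mu>s (m (r k))) (v (r k))) (?a \<mu> (v (r k)))) \<longlonglongrightarrow> dist (?a \<mu> u) (?a \<mu> u)"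
    by (rule tendsto_dist)
  then have "e \<le> dist (?a \<mu> u) (?a \<mu> u)"
    by (rule tendsto_lowerbound) (use mv(4) in auto)
  then show False using e(1) by simp
qed

end

theorem proposition1:
  fixes \<beta> :: "nat \<Rightarrow> real"
    and \<mu> :: "real measure" and \<mu>s :: "nat \<Rightarrow> real measure"
    and \<Omega> :: "'a measure" and B :: "real \<Rightarrow> 'a \<Rightarrow> real"
  assumes "(\<lambda>p. 2 ^ p * (\<beta> p)\<^sup>2) summable_on {2..}"
    and "\<mu> \<in> M01"
    and "\<And>n. n \<ge> 1 \<Longrightarrow> \<mu>s n \<in> M01"
    and "(\<lambda>n. d01 (\<mu>s n) \<mu>) \<longlonglongrightarrow> 0"
    and "brownian_motion \<Omega> B"
  shows "(\<forall>j.
            (\<forall>x. \<forall>u\<in>{0..1}. dxPhi_exists \<beta> \<mu> j x u) \<and>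
            continuous_on (UNIV \<times> {0..1}) (\<lambda>(x, u). dxPhi \<beta> \<mu> j x u) \<and>
            uniform_limit (UNIV \<times> {0..1}) (\<lambda>n (x, u). dxPhi \<beta> (\<mu>s n) j x u)
              (\<lambda>(x, u). dxPhi \<beta> \<mu> j x u) sequentially) \<and>
         (\<forall>j\<ge>1. \<forall>P. mpoly_vars P \<subseteq> {1..j} \<longrightarrow>
            (\<forall>u\<in>{0..1}. integrable \<Omega> (PexpW \<beta> B P \<mu> u)) \<and>
            continuous_on {0..1} (\<lambda>u. LINT \<omega>|\<Omega>. PexpW \<beta> B P \<mu> u \<omega>) \<and>
            uniform_limit {0..1} (\<lambda>n u. LINT \<omega>|\<Omega>. PexpW \<beta> B P (\<mu>s n) u \<omega>)
              (\<lambda>u. LINT \<omega>|\<Omega>. PexpW \<beta> B P \<mu> u \<omega>) sequentially) \<and>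
         (continuous_on {0..1} (\<lambda>u. measure \<mu> {0..u}) \<longrightarrow>
            (\<forall>j. \<exists>D. continuous_on (UNIV \<times> {0..1}) (\<lambda>(x, u). D x u) \<and>
               (\<forall>x. \<forall>u\<in>{0..1}.
                  ((\<lambda>v. dxPhi \<beta> \<mu> j x v) has_real_derivative D x u) (at u within {0..1}))))"
proof -
  obtain d2 L where cov: "parisi_covariance \<beta> d2 L"
    using parisi_covariance_exists[OF assms(1)] by blast
  interpret parisi_brownian \<beta> d2 L \<Omega> B
    by (rule parisi_brownian.intro[OF cov assms(5)])
  show ?thesis
  proof (intro conjI allI impI ballI)
    show "dxPhi_exists \<beta> \<mu> j x u" if "u \<in> {0..1}" for j x u
      by (rule dxPhi_exists[OF assms(2) that])
    show "continuous_on (UNIV \<times> {0..1}) (\<lambda>(x, u). dxPhi \<beta> \<mu> j x u)" for j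
      by (rule dxPhi_continuous[OF assms(2)])
    show "uniform_limit (UNIV \<times> {0..1}) (\<lambda>n (x, u). dxPhi \<beta> (\<mu>s n) j x u) (\<lambda>(x, u). dxPhi \<beta> \<mu> j x u) sequentially" for j
      by (rule dxPhi_uniform_limit[OF assms(3,2,4)])
    fix j :: nat and P assume P: "mpoly_vars P \<subseteq> {1..j}"
    show "integrable \<Omega> (PexpW \<beta> B P \<mu> u)" if "u \<in> {0..1}" for u
      by (rule PexpW_integrable[OF P assms(2) that])
    show "continuous_on {0..1} (\<lambda>u. LINT \<omega>|\<Omega>. PexpW \<beta> B P \<mu> u \<omega>)"
      by (rule PexpW_expectation_continuous[OF P assms(2)])
    show "uniform_limit {0..1} (\<lambda>n u. LINT \<omega>|\<Omega>. PexpW \<beta> B P (\<mu>s n) u \<omega>) (\<lambda>u. LINT \<omega>|\<Omega>. PexpW \<beta> B P \<mu> u \<omega>) sequentially"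
      by (rule PexpW_expectation_uniform_limit[OF P assms(3,2,4)])
  next
    fix j assume F: "continuous_on {0..1} (\<lambda>u. measure \<mu> {0..u})"
    show "\<exists>D. continuous_on (UNIV \<times> {0..1}) (\<lambda>(x, u). D x u) \<and>
        (\<forall>x. \<forall>u\<in>{0..1}. ((\<lambda>v. dxPhi \<beta> \<mu> j x v) has_real_derivative D x u) (at u within {0..1}))"
      by (intro exI[of _ "time_deriv \<mu> j"] conjI allI ballI
          time_deriv_continuous[OF assms(2) F] DERIV_dxPhi_time[OF assms(2) F])
  qed
qed

end
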